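(* Assume that $\mathbf{Z}$ has i.i.d. standard complex Gaussian entries, that the matrices $\mathbf{C}_N$ are bounded in spectral norm, and that the spectral density $f\in L^1(-\pi,\pi)$ of the Toeplitz matrices $\mathbf{R}_M$ satisfies: (i) $f$ is positive and is bounded on $[-\pi,\pi]\setminus(-\delta,\delta)$ for every $\delta>0$; (ii) $f$ is even and $f(x)=L(|x|^{-1})/|x|^{a}$ for $x\in[-\pi,\pi]\setminus\{0\}$, where $0<a<1/2$ and $L$, defined on $[\pi^{-1},\infty)$, is slowly varying at $\infty$. Assume also that $M,N\to\infty$ with $N/M\to c\in(0,\infty)$. Then there exists a constant $K>0$ such that for any fixed $x>0$, $$\mathbb{P}\left(\left\|\hat{\mathbf{R}}_M-\xi_N\mathbf{R}_M\right\|>x\right)\le \exp\left(-\frac{K c\,M^{1-2a}x^2}{\|\mathbf{C}_N\|^2L^2(M)\log M}(1+o(1))\right),$$ where $o(1)$ is with respect to $M\to\infty$ and depends on $x$.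
   Context: For integers $M,N\ge1$, let $\mathbf{X}=\mathbf{C}_N^{1/2}\mathbf{Z}\mathbf{R}_M^{1/2}$, where $\mathbf{C}_N$ is an $N\times N$ positive semi-definite Hermitian (deterministic) matrix, $\mathbf{Z}$ is an $N\times M$ random matrix, and $\mathbf{R}_M=(r_{i-j})_{i,j=1}^M$ is the Toeplitz matrix with spectral density $f$, i.e. $r_k=\frac{1}{2\pi}\int_{-\pi}^{\pi}f(x)e^{-\mathbf{i}kx}\,dx$. Put $\xi_N=\frac1N\mathrm{tr}\,\mathbf{C}_N$. Let $S_{i,j}$ denote the entries of the $M\times M$ matrix $\frac1N\mathbf{X}^*\mathbf{X}$, and define $$\hat r_k=\frac{1}{M-|k|}\sum_i S_{i+k,i}\,\mathbf{1}_{\{1\le i,\ i+k\le M\}}\quad(|k|\le M-1),$$ where the sum is over $i$ with both $1\le i\le M$ and $1\le i+k\le M$, and $\hat{\mathbf{R}}_M=(\hat r_{i-j})_{1\le i,j\le M}$. $\|\cdot\|$ is the operator (spectral) norm.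
   Formalization: The formal statement also assumes that the spectral norms of C_N are bounded away from zero for all large N; with only an upper bound the claim is false (e.g. C_N = N^{-5} I) and the bound is undefined when C_N = 0. *)

theory Defs
  imports
    "HOL-Probability.Probability"
    "Jordan_Normal_Form.Schur_Decomposition"
begin

text \<open>Matrices are those of Jordan_Normal_Form, so rows and columns are numbered from \<open>0\<close>.\<close>

definition trace_mat :: "complex mat \<Rightarrow> complex" where
  "trace_mat A = (\<Sum>i<dim_row A. A $$ (i, i))"

definition eucl_norm :: "complex Matrix.vec \<Rightarrow> real" where
  "eucl_norm v = sqrt (\<Sum>i<dim_vec v. (cmod (vec_index v i))\<^sup>2)"

definition op_norm :: "complex mat \<Rightarrow> real" where
  "op_norm A = Sup {eucl_norm (A *\<^sub>v v) | v. v \<in> carrier_vec (dim_col A) \<and> eucl_norm v \<le> 1}"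

definition psd_hermitian :: "nat \<Rightarrow> complex mat \<Rightarrow> bool" where
  "psd_hermitian n A \<longleftrightarrow> A \<in> carrier_mat n n \<and> mat_adjoint A = A \<and>
     (\<forall>v \<in> carrier_vec n. 0 \<le> Re ((A *\<^sub>v v) \<bullet>c v))"

text \<open>A positive semi-definite Hermitian matrix has exactly one positive semi-definite Hermitian
  square root, so the choice made by \<open>SOME\<close> is not arbitrary.\<close>

definition psd_sqrt :: "complex mat \<Rightarrow> complex mat" where
  "psd_sqrt A = (SOME B. psd_hermitian (dim_row A) B \<and> B * B = A)"

definition fourier_coeff :: "(real \<Rightarrow> real) \<Rightarrow> int \<Rightarrow> complex" where
  "fourier_coeff f k =
     (LINT x:{-pi..pi}|lebesgue. complex_of_real (f x) * exp (- (\<i> * of_int k * of_real x)))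
       / (2 * of_real pi)"

definition toeplitz :: "nat \<Rightarrow> (int \<Rightarrow> complex) \<Rightarrow> complex mat" where
  "toeplitz m r = Matrix.mat m m (\<lambda>(i, j). r (int i - int j))"

text \<open>The measurable positive functions on \<open>[A, \<infinity>)\<close> that are slowly varying at infinity, in the
  sense of Karamata.\<close>

definition slowly_varying :: "real \<Rightarrow> (real \<Rightarrow> real) \<Rightarrow> bool" where
  "slowly_varying A L \<longleftrightarrow>
     set_borel_measurable lebesgue {A..} L \<and> (\<forall>t\<ge>A. 0 < L t) \<and>
     (\<forall>s>0. ((\<lambda>t. L (s * t) / L t) \<longlongrightarrow> 1) at_top)"

definition std_complex_gaussian :: "'w measure \<Rightarrow> ('w \<Rightarrow> complex) \<Rightarrow> bool" where
  "std_complex_gaussian P z \<longleftrightarrow>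
     distributed P lborel (\<lambda>w. Re (z w)) (normal_density 0 (1 / sqrt 2)) \<and>
     distributed P lborel (\<lambda>w. Im (z w)) (normal_density 0 (1 / sqrt 2)) \<and>
     prob_space.indep_var P borel (\<lambda>w. Re (z w)) borel (\<lambda>w. Im (z w))"

definition iid_complex_gaussian_matrix ::
    "'w measure \<Rightarrow> nat \<Rightarrow> nat \<Rightarrow> ('w \<Rightarrow> complex mat) \<Rightarrow> bool" where
  "iid_complex_gaussian_matrix P n m Z \<longleftrightarrow>
     (\<forall>w \<in> space P. Z w \<in> carrier_mat n m) \<and>
     (\<forall>i<n. \<forall>j<m. std_complex_gaussian P (\<lambda>w. Z w $$ (i, j))) \<and>
     prob_space.indep_vars P (\<lambda>_. borel) (\<lambda>ij w. Z w $$ ij) ({..<n} \<times> {..<m})"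

definition sample_matrix :: "complex mat \<Rightarrow> complex mat \<Rightarrow> complex mat \<Rightarrow> complex mat" where
  "sample_matrix C Z R = psd_sqrt C * Z * psd_sqrt R"

definition sample_cov :: "complex mat \<Rightarrow> complex mat" where
  "sample_cov X = (1 / of_nat (dim_row X)) \<cdot>\<^sub>m (mat_adjoint X * X)"

definition autocov_est :: "complex mat \<Rightarrow> int \<Rightarrow> complex" where
  "autocov_est S k =
     (\<Sum>i | i < dim_row S \<and> 0 \<le> int i + k \<and> int i + k < int (dim_row S).
        S $$ (nat (int i + k), i)) / of_int (int (dim_row S) - \<bar>k\<bar>)"

definition toeplitz_est :: "complex mat \<Rightarrow> complex mat" where
  "toeplitz_est X = toeplitz (dim_col X) (autocov_est (sample_cov X))"

definition xi :: "complex mat \<Rightarrow> complex" where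
  "xi C = trace_mat C / of_nat (dim_row C)"

end

theory Submission
  imports Defs "Jordan_Normal_Form.Spectral_Radius" "HOL-Real_Asymp.Real_Asymp"
begin

text \<open>Why the estimate holds. Write \<open>X = C\<^sup>1\<^sup>/\<^sup>2 Z R\<^sup>1\<^sup>/\<^sup>2\<close> for an \<open>n \<times> m\<close> sample and \<open>S = X\<^sup>* X / n\<close>. The error
matrix \<open>T\<close> (Toeplitz estimate minus \<open>\<xi> R\<close>) is itself Toeplitz. Three facts control its spectral norm.

First, the norm of a Toeplitz matrix is at most the maximum of the modulus of its symbol, and \<open>2 m\<close>
equispaced frequencies suffice, because an \<open>m \<times> m\<close> Toeplitz matrix is a corner of a circulant matrix
of size \<open>2 m\<close> whose eigenvalues are these values of the symbol (\<open>op_norm_toeplitz_le\<close>). No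
discretisation error arises, and a union bound costs only a factor that is linear in \<open>m\<close>.

Secondly, at a fixed frequency the symbol of \<open>T\<close> is a centred quadratic form
\<open>z\<^sup>* Q z - tr Q\<close> in the vector \<open>z\<close> of the entries of \<open>Z\<close>, where \<open>n Q\<close> is the Kronecker product of
\<open>C\<close> and the transpose of \<open>R\<^sup>1\<^sup>/\<^sup>2 W R\<^sup>1\<^sup>/\<^sup>2\<close>, and \<open>W\<close> carries the weights \<open>1 / (m - \<bar>i - j\<bar>)\<close> of the estimator, with
\<open>\<parallel>W\<parallel>\<^sub>F\<^sup>2 = O(log m)\<close>. If \<open>R \<le> u\<close> and \<open>C \<le> \<gamma>\<close> then \<open>\<parallel>Q\<parallel>\<^sub>F\<^sup>2 = O(\<gamma>\<^sup>2 u\<^sup>2 log m / n)\<close>. For a Hermitian form in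
a standard complex Gaussian vector \<open>E exp (z\<^sup>* Q z) = 1 / det (1 - Q)\<close> as long as \<open>Q < 1\<close>
(\<open>gaussian_form_integral\<close>), and the bound \<open>ln (1 - y) \<ge> - y - 2 y\<^sup>2\<close>, applied to the eigenvalues, turns
this into a sub-Gaussian tail (\<open>gaussian_form_tail\<close>, \<open>weighted_cov_tail\<close>). Optimising the Chernoff
bound gives \<open>P(\<parallel>T\<parallel> > x) \<le> 4 m exp (- n x\<^sup>2 / (32 \<gamma>\<^sup>2 u\<^sup>2 log m))\<close>, provided that \<open>u\<close> is large enough
for the optimal Chernoff parameter to be admissible (\<open>toeplitz_est_deviation\<close>).

Thirdly, \<open>u\<close> may be taken to be \<open>D m\<^sup>a L(m)\<close> (\<open>toeplitz_power_law_form_le\<close>). Indeed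
\<open>v\<^sup>* R v = (1 / 2 \<pi>) \<integral> f \<bar>p\<bar>\<^sup>2\<close> for the trigonometric polynomial \<open>p\<close> with coefficients \<open>v\<close>. Potter's bounds
(\<open>potter_bounds\<close>) give \<open>f = O(m\<^sup>a L(m))\<close> for \<open>\<bar>x\<bar> > 1 / m\<close>, where Parseval's identity is used; on the
rest they bound \<open>f\<close> by \<open>O(m\<^sup>a L(m))\<close> times an integrable power of \<open>m \<bar>x\<bar>\<close>, and there
\<open>\<bar>p\<bar>\<^sup>2 \<le> m \<parallel>v\<parallel>\<^sup>2\<close>.

Since \<open>m\<^sup>1\<^sup>-\<^sup>2\<^sup>a / L(m)\<^sup>2\<close> grows like a power of \<open>m\<close>, half of the exponent swallows the factor \<open>4 m\<close>. The
constant \<open>K\<close> is free, so the error term in the exponent can be taken to be zero.\<close>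

section \<open>Slow variation and Potter bounds\<close>

lemma slowly_varying_log_increment:
  assumes L: "slowly_varying A L" and "s > 0"
  shows "((\<lambda>t. ln (L (s * t)) - ln (L t)) \<longlongrightarrow> 0) at_top"
proof -
  have lim: "((\<lambda>t. ln (L (s * t) / L t)) \<longlongrightarrow> ln 1) at_top"
    using L \<open>s > 0\<close> by (intro tendsto_ln) (auto simp: slowly_varying_def)
  have "\<forall>\<^sub>F t in at_top. ln (L (s * t) / L t) = ln (L (s * t)) - ln (L t)"
    using eventually_ge_at_top[of "max A (A / s)"]
  proof eventually_elim
    case (elim t)
    then have "A \<le> s * t" "A \<le> t" using \<open>s > 0\<close> by (auto simp: field_simps)
    then have "0 < L (s * t)" "0 < L t" using L by (auto simp: slowly_varying_def)
    then show ?case by (simp add: ln_div)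
  qed
  from Lim_transform_eventually[OF lim this] show ?thesis by simp
qed

text \<open>For each \<open>v\<close> the increments tend to 0, so the sets on which they are small from index \<open>n\<close> on increase to
the whole interval, and their measures converge to its length. An arbitrary sequence is allowed
because the uniform convergence theorem below applies this to two sequences at once.\<close>

lemma slowly_varying_small_increments:
  fixes y :: "nat \<Rightarrow> real"
  assumes L: "slowly_varying A L" and A: "A > 0" and "\<epsilon> > 0"
    and y: "\<And>m. A \<le> y m" "filterlim y at_top sequentially"
  defines "S \<equiv> \<lambda>c n. {v \<in> {1..c}. \<forall>m\<ge>n. \<bar>ln (L (v * y m)) - ln (L (y m))\<bar> < \<epsilon>}"
  shows "S c n \<in> sets lebesgue"
    and "c \<ge> 1 \<Longrightarrow> (\<lambda>n. measure lebesgue (S c n)) \<longlonglongrightarrow> c - 1"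
proof -
  define g where "g t = indicator {A..} t *\<^sub>R L t" for t
  have g: "g \<in> borel_measurable lebesgue"
    using L unfolding slowly_varying_def set_borel_measurable_def g_def by auto
  have gm: "(\<lambda>v. g (y m * v)) \<in> borel_measurable lebesgue" for m
    using measurable_compose[OF lebesgue_measurable_scaling[of "y m"] g] by simp
  have gL: "g (y m * v) = L (v * y m)" if "v \<in> {1..c}" for v m c
  proof -
    have "A * 1 \<le> y m * v" using that y(1)[of m] A by (intro mult_mono) auto
    then show ?thesis by (simp add: g_def mult.commute)
  qed
  have S: "S c n = {1..c} \<inter> (\<Inter>m\<in>{n..}. {v \<in> space lebesgue. \<bar>ln (g (y m * v)) - ln (L (y m))\<bar> < \<epsilon>})" for c n
    unfolding S_def by (auto simp: gL)
  show meas: "S c n \<in> sets lebesgue" for c n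
  proof -
    have "{v \<in> space lebesgue. \<bar>ln (g (y m * v)) - ln (L (y m))\<bar> < \<epsilon>} \<in> sets lebesgue" for m
      using gm[of m] by measurable
    then show ?thesis unfolding S by (intro sets.Int sets.countable_INT) auto
  qed
  assume c: "c \<ge> 1"
  have inc: "incseq (S c)" unfolding S_def incseq_def by auto
  have "(\<Union>n. S c n) = {1..c}"
  proof (intro equalityI subsetI)
    fix v assume v: "v \<in> {1..c}"
    then have "((\<lambda>t. ln (L (v * t)) - ln (L t)) \<longlongrightarrow> 0) at_top"
      by (intro slowly_varying_log_increment[OF L]) auto
    then have "(\<lambda>m. ln (L (v * y m)) - ln (L (y m))) \<longlonglongrightarrow> 0"
      using filterlim_compose y(2) by blast
    then have "\<forall>\<^sub>F m in sequentially. \<bar>ln (L (v * y m)) - ln (L (y m))\<bar> < \<epsilon>"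
      using \<open>\<epsilon> > 0\<close> by (auto simp: tendsto_iff dist_real_def)
    then show "v \<in> (\<Union>n. S c n)" using v by (auto simp: S_def eventually_sequentially)
  qed (auto simp: S_def)
  moreover have "(\<lambda>n. emeasure lebesgue (S c n)) \<longlonglongrightarrow> emeasure lebesgue (\<Union>n. S c n)"
    using meas inc by (intro Lim_emeasure_incseq) auto
  ultimately have "(\<lambda>n. emeasure lebesgue (S c n)) \<longlonglongrightarrow> ennreal (c - 1)" using c by simp
  then have "(\<lambda>n. enn2real (emeasure lebesgue (S c n))) \<longlonglongrightarrow> enn2real (ennreal (c - 1))"
    by (intro tendsto_enn2real) (use c in auto)
  then show "(\<lambda>n. measure lebesgue (S c n)) \<longlonglongrightarrow> c - 1" using c by (simp add: measure_def)
qed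

text \<open>The uniform convergence theorem for slowly varying functions, by Steinhaus's argument. If the
increments over \<open>[x, u x]\<close> stayed large along sequences \<open>x\<^sub>n \<rightarrow> \<infinity>\<close> and \<open>u\<^sub>n\<close>, then each of the increments
from \<open>x\<^sub>n\<close> to \<open>v x\<^sub>n\<close> and from \<open>u\<^sub>n x\<^sub>n\<close> to \<open>w u\<^sub>n x\<^sub>n\<close> would be small for most \<open>v\<close> and most \<open>w\<close>.
Some \<open>v\<close> equals \<open>u\<^sub>n w\<close>, and the triangle inequality gives a contradiction.\<close>

lemma slowly_varying_uniform:
  assumes L: "slowly_varying A L" and A: "A > 0" and \<epsilon>: "\<epsilon> > 0"
  obtains T where "T \<ge> A" "\<And>x u. x \<ge> T \<Longrightarrow> u \<in> {1..2} \<Longrightarrow> \<bar>ln (L (u * x)) - ln (L x)\<bar> \<le> \<epsilon>"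
proof -
  have "\<exists>T\<ge>A. \<forall>x u. x \<ge> T \<longrightarrow> u \<in> {1..2} \<longrightarrow> \<bar>ln (L (u * x)) - ln (L x)\<bar> \<le> \<epsilon>"
  proof (rule ccontr)
    assume neg: "\<not> ?thesis"
    have "\<exists>x u. x \<ge> max A (real n) \<and> u \<in> {1..2} \<and> \<bar>ln (L (u * x)) - ln (L x)\<bar> > \<epsilon>" for n :: nat
    proof -
      have "\<not> (\<forall>x u. x \<ge> max A (real n) \<longrightarrow> u \<in> {1..2} \<longrightarrow> \<bar>ln (L (u * x)) - ln (L x)\<bar> \<le> \<epsilon>)"
        using neg max.cobounded1[of A "real n"] by blast
      then show ?thesis by (simp only: not_all not_imp not_le simp_thms)
    qed
    then obtain x u where xu: "\<And>n. x n \<ge> max A (real n)" "\<And>n. u n \<in> {1..2::real}"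
      "\<And>n. \<bar>ln (L (u n * x n)) - ln (L (x n))\<bar> > \<epsilon>" by metis
    have xlim: "filterlim x at_top sequentially"
      by (rule filterlim_at_top_mono[OF filterlim_real_sequentially]) (use xu(1) in auto)
    have ux: "x n \<le> u n * x n" for n
      using mult_right_mono[of 1 "u n" "x n"] xu(1)[of n] xu(2)[of n] by auto
    have uxlim: "filterlim (\<lambda>n. u n * x n) at_top sequentially"
      by (rule filterlim_at_top_mono[OF xlim]) (use ux in auto)
    define V where "V n = {v \<in> {1..4}. \<forall>m\<ge>n. \<bar>ln (L (v * x m)) - ln (L (x m))\<bar> < \<epsilon> / 2}" for n
    define W where "W n = {v \<in> {1..2}. \<forall>m\<ge>n. \<bar>ln (L (v * (u m * x m))) - ln (L (u m * x m))\<bar> < \<epsilon> / 2}" for n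
    have "A \<le> x n" "A \<le> u n * x n" for n using xu(1)[of n] ux[of n] by auto
    then have mV: "V n \<in> sets lebesgue" and mW: "W n \<in> sets lebesgue"
      and "(\<lambda>n. measure lebesgue (V n)) \<longlonglongrightarrow> 4 - 1" "(\<lambda>n. measure lebesgue (W n)) \<longlonglongrightarrow> 2 - 1" for n
      unfolding V_def W_def using \<epsilon> xlim uxlim
      by (intro slowly_varying_small_increments[OF L A]; simp)+
    then have "\<forall>\<^sub>F n in sequentially. measure lebesgue (V n) > 5/2 \<and> measure lebesgue (W n) > 1/2"
      by (intro eventually_conj order_tendstoD) auto
    then obtain n where n: "measure lebesgue (V n) > 5/2" "measure lebesgue (W n) > 1/2"
      by (auto simp: eventually_sequentially)
    define W' where "W' = (\<lambda>w. u n * w) ` W n"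
    have fm: "S \<in> sets lebesgue \<Longrightarrow> S \<subseteq> {1..4} \<Longrightarrow> S \<in> lmeasurable" for S :: "real set"
      by (rule bounded_set_imp_lmeasurable[OF bounded_subset[OF bounded_closed_interval]])
    have W'sub: "W' \<subseteq> {1..4}"
    proof
      fix z assume "z \<in> W'"
      then obtain w where w: "z = u n * w" "w \<in> {1..2}" by (auto simp: W'_def W_def)
      have "1 * 1 \<le> u n * w" "u n * w \<le> 2 * 2" using w(2) xu(2)[of n] by (intro mult_mono; auto)+
      then show "z \<in> {1..4}" using w by auto
    qed
    have mW': "measure lebesgue W' = \<bar>u n\<bar> * measure lebesgue (W n)"
      using measure_lebesgue_affine[of "u n" 0 "W n"] by (simp add: W'_def)
    have "W' = (*\<^sub>R) (1 / u n) -` W n \<inter> space lebesgue"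
      using xu(2)[of n] by (force simp: W'_def)
    also have "\<dots> \<in> sets lebesgue" by (rule measurable_sets[OF lebesgue_measurable_scaling mW])
    finally have W'm: "W' \<in> lmeasurable" using W'sub by (rule fm)
    have Vm: "V n \<in> lmeasurable" by (rule fm[OF mV]) (auto simp: V_def)
    \<comment> \<open>Both sets lie in \<open>[1, 4]\<close>, of length 3, and their measures exceed 5/2 and 1/2.\<close>
    have "V n \<inter> W' \<noteq> {}"
    proof
      assume d: "V n \<inter> W' = {}"
      have "1 * (1/2) < \<bar>u n\<bar> * measure lebesgue (W n)"
        using n(2) xu(2)[of n] by (intro mult_le_less_imp_less) auto
      then have "3 < measure lebesgue (V n) + measure lebesgue W'" using n(1) mW' by simp
      also have "\<dots> = measure lebesgue (V n \<union> W')"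
        using measure_Un3[OF Vm W'm] d by simp
      also have "\<dots> \<le> measure lebesgue {1..4::real}"
      proof (rule measure_mono_fmeasurable)
        have "V n \<subseteq> {1..4}" by (simp only: V_def Collect_restrict)
        then show "V n \<union> W' \<subseteq> {1..4}" using W'sub by (rule Un_least)
      qed (use fmeasurable.Un[OF Vm W'm, THEN fmeasurableD] in simp_all)
      finally show False by simp
    qed
    then obtain w where w: "w \<in> W n" "u n * w \<in> V n" unfolding W'_def by blast
    then have "\<bar>ln (L (w * (u n * x n))) - ln (L (u n * x n))\<bar> < \<epsilon> / 2"
      "\<bar>ln (L (u n * w * x n)) - ln (L (x n))\<bar> < \<epsilon> / 2" by (simp_all add: W_def V_def)
    moreover have "u n * w * x n = w * (u n * x n)" by simp
    ultimately show False using xu(3)[of n] by (simp only:)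
  qed
  then obtain T where "T \<ge> A" "\<forall>x u. x \<ge> T \<longrightarrow> u \<in> {1..2} \<longrightarrow> \<bar>ln (L (u * x)) - ln (L x)\<bar> \<le> \<epsilon>"
    by (elim exE conjE)
  then show thesis by (intro that[of T]) simp_all
qed

text \<open>Dyadic chaining: an interval \<open>[s, t]\<close> is crossed in about \<open>log\<^sub>2 (t / s)\<close> steps, each of which changes
\<open>ln L\<close> by at most \<open>\<eta> ln 2\<close>.\<close>

lemma potter_bounds:
  assumes L: "slowly_varying A L" and A: "A > 0" and \<eta>: "\<eta> > 0"
  obtains T where "T \<ge> A" "\<And>s t. T \<le> s \<Longrightarrow> s \<le> t \<Longrightarrow> L t \<le> 2 powr \<eta> * (t / s) powr \<eta> * L s"
    "\<And>s t. T \<le> s \<Longrightarrow> s \<le> t \<Longrightarrow> L s \<le> 2 powr \<eta> * (t / s) powr \<eta> * L t"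
proof -
  define \<epsilon> where "\<epsilon> = \<eta> * ln 2"
  have \<epsilon>: "\<epsilon> > 0" using \<eta> by (simp add: \<epsilon>_def)
  obtain T where T: "T \<ge> A" "\<And>x u. x \<ge> T \<Longrightarrow> u \<in> {1..2} \<Longrightarrow> \<bar>ln (L (u * x)) - ln (L x)\<bar> \<le> \<epsilon>"
    using slowly_varying_uniform[OF L A \<epsilon>] by blast
  have chain: "\<bar>ln (L t) - ln (L s)\<bar> \<le> real (Suc n) * \<epsilon>"
    if "T \<le> s" "2 ^ n * s \<le> t" "t \<le> 2 ^ Suc n * s" for s t n
    using that
  proof (induction n arbitrary: s)
    case 0
    then have "t = (t / s) * s" "t / s \<in> {1..2}" using T(1) A by (auto simp: field_simps)
    then show ?case using T(2)[of s "t / s"] 0 by auto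
  next
    case (Suc n)
    have "T \<le> 2 * s" using Suc.prems(1) T(1) A by linarith
    then have "\<bar>ln (L t) - ln (L (2 * s))\<bar> \<le> real (Suc n) * \<epsilon>"
      using Suc.prems by (intro Suc.IH) (auto simp: mult_ac)
    moreover have "\<bar>ln (L (2 * s)) - ln (L s)\<bar> \<le> \<epsilon>" using T(2)[of s 2] Suc.prems by auto
    ultimately show ?case by (simp add: algebra_simps)
  qed
  have main: "\<bar>ln (L t) - ln (L s)\<bar> \<le> \<eta> * ln 2 + \<eta> * ln (t / s)" if st: "T \<le> s" "s \<le> t" for s t
  proof -
    have s: "s > 0" using st T(1) A by linarith
    define n where "n = nat \<lfloor>log 2 (t / s)\<rfloor>"
    have ts: "t / s \<ge> 1" using st s by simp
    then have "real n \<le> log 2 (t / s)" "log 2 (t / s) < real n + 1"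
      by (auto simp: n_def)
    then have "2 powr real n \<le> t / s" "t / s < 2 powr real (Suc n)"
      using ts by (simp_all add: le_log_iff log_less_iff add.commute)
    then have n: "2 ^ n \<le> t / s" "t / s < 2 ^ Suc n"
      by (simp_all add: powr_realpow del: of_nat_Suc power_Suc)
    have "\<bar>ln (L t) - ln (L s)\<bar> \<le> real (Suc n) * \<epsilon>"
      using n st s by (intro chain) (simp_all add: pos_le_divide_eq pos_divide_less_eq del: power_Suc)
    also have "\<dots> = \<eta> * ln 2 + \<eta> * ln (2 ^ n)" by (simp add: \<epsilon>_def ln_realpow algebra_simps)
    also have "\<dots> \<le> \<eta> * ln 2 + \<eta> * ln (t / s)"
      using n \<eta> by (intro add_left_mono mult_left_mono) (auto simp: ln_mono)
    finally show ?thesis .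
  qed
  have mult: "p \<le> 2 powr \<eta> * r powr \<eta> * q"
    if "p > 0" "q > 0" "r > 0" "ln p - ln q \<le> \<eta> * ln 2 + \<eta> * ln r" for p q r :: real
  proof -
    have "p = exp (ln p)" using that by simp
    also have "\<dots> \<le> exp (\<eta> * ln 2 + \<eta> * ln r + ln q)"
      using that(4) by (subst exp_le_cancel_iff) linarith
    also have "\<dots> = 2 powr \<eta> * r powr \<eta> * q" using that by (simp add: exp_add powr_def)
    finally show ?thesis .
  qed
  have pos: "L s > 0" if "T \<le> s" for s using L that T(1) by (auto simp: slowly_varying_def)
  show thesis
  proof (rule that[OF T(1)])
    fix s t assume st: "T \<le> s" "s \<le> t"
    have "s > 0" using st T(1) A by linarith
    then show "L t \<le> 2 powr \<eta> * (t / s) powr \<eta> * L s" "L s \<le> 2 powr \<eta> * (t / s) powr \<eta> * L t"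
      using main[OF st] pos[of s] pos[of t] st by (intro mult; simp)+
  qed
qed

lemma slowly_varying_power_bounds:
  assumes L: "slowly_varying A L" and A: "A > 0" and \<eta>: "\<eta> > 0"
  obtains B T where "B > 0" "T \<ge> A" "\<And>t. t \<ge> T \<Longrightarrow> L t \<le> B * t powr \<eta>"
    "\<And>t. t \<ge> T \<Longrightarrow> t powr - \<eta> \<le> B * L t"
proof -
  obtain T where T: "T \<ge> A" and up: "\<And>s t. T \<le> s \<Longrightarrow> s \<le> t \<Longrightarrow> L t \<le> 2 powr \<eta> * (t / s) powr \<eta> * L s"
    and lo: "\<And>s t. T \<le> s \<Longrightarrow> s \<le> t \<Longrightarrow> L s \<le> 2 powr \<eta> * (t / s) powr \<eta> * L t"
    using potter_bounds[OF L A \<eta>] by blast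
  have pos: "T > 0" "L T > 0" using T A L by (auto simp: slowly_varying_def)
  define p q where "p = 2 powr \<eta> * L T / T powr \<eta>" and "q = 2 powr \<eta> / (T powr \<eta> * L T)"
  have pq: "p > 0" "q > 0" using pos by (auto simp: p_def q_def)
  have Lpos: "L t > 0" if "t \<ge> T" for t using L T that by (auto simp: slowly_varying_def)
  show thesis
  proof (rule that[of "p + q" T])
    fix t assume t: "t \<ge> T"
    have "L t \<le> p * t powr \<eta>" using up[OF order_refl t] pos t by (simp add: p_def powr_divide mult_ac)
    also have "\<dots> \<le> (p + q) * t powr \<eta>" using pq by (intro mult_right_mono) auto
    finally show "L t \<le> (p + q) * t powr \<eta>" .
    have "1 \<le> q * t powr \<eta> * L t"
      using lo[OF order_refl t] pos t by (simp add: q_def powr_divide field_simps)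
    then have "t powr - \<eta> \<le> t powr - \<eta> * (q * t powr \<eta> * L t)" by (simp add: mult_le_cancel_left1)
    also have "\<dots> = q * L t" using pos t by (simp add: powr_minus field_simps)
    also have "\<dots> \<le> (p + q) * L t" using pq Lpos[OF t] by (intro mult_right_mono) auto
    finally show "t powr - \<eta> \<le> (p + q) * L t" .
  qed (use T pq in auto)
qed

lemma power_times_slowly_varying_at_top:
  assumes L: "slowly_varying A L" and A: "A > 0" and a: "a > 0"
  shows "filterlim (\<lambda>t. t powr a * L t) at_top at_top"
proof -
  obtain B T where B: "B > 0" "T \<ge> A" "\<And>t. t \<ge> T \<Longrightarrow> t powr - (a / 2) \<le> B * L t"
    using slowly_varying_power_bounds[OF L A, of "a / 2"] a by (metis half_gt_zero)
  show ?thesis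
  proof (rule filterlim_at_top_mono)
    show "filterlim (\<lambda>t. t powr (a / 2) / B) at_top at_top" using a B(1) by real_asymp
    show "\<forall>\<^sub>F t in at_top. t powr (a / 2) / B \<le> t powr a * L t"
      using eventually_ge_at_top[of T]
    proof eventually_elim
      case (elim t)
      have "t powr (a / 2) = t powr a * t powr - (a / 2)" by (simp flip: powr_add)
      also have "\<dots> \<le> t powr a * (B * L t)" using B(3)[OF elim] by (intro mult_left_mono) auto
      finally show ?case using B(1) by (simp add: field_simps)
    qed
  qed
qed

section \<open>Hermitian matrices\<close>

definition norm_sq :: "complex Matrix.vec \<Rightarrow> real" where
  "norm_sq v = (\<Sum>i<dim_vec v. (cmod (vec_index v i))\<^sup>2)"

definition frob_sq :: "complex mat \<Rightarrow> real" where
  "frob_sq A = (\<Sum>i<dim_row A. \<Sum>j<dim_col A. (cmod (A $$ (i, j)))\<^sup>2)"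

definition real_diag :: "nat \<Rightarrow> (nat \<Rightarrow> real) \<Rightarrow> complex mat" where
  "real_diag n d = Matrix.mat n n (\<lambda>(i, j). if i = j then complex_of_real (d i) else 0)"

lemma dim_mat_adjoint [simp]: "dim_row (mat_adjoint A) = dim_col A" "dim_col (mat_adjoint A) = dim_row A"
  by (simp_all add: mat_adjoint_def)

lemma index_mat_adjoint [simp]:
  fixes A :: "complex mat"
  shows "i < dim_col A \<Longrightarrow> j < dim_row A \<Longrightarrow> mat_adjoint A $$ (i, j) = cnj (A $$ (j, i))"
  unfolding mat_adjoint_def by (subst mat_of_rows_index) simp_all

lemma mat_adjoint_carrier [simp, intro]: "A \<in> carrier_mat n m \<Longrightarrow> mat_adjoint A \<in> carrier_mat m n"
  by (intro carrier_matI) simp_all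

lemma mat_adjoint_mat_adjoint [simp]: "mat_adjoint (mat_adjoint (A :: complex mat)) = A"
  by (rule eq_matI) auto

text \<open>Equality of a matrix with its adjoint loops as a rewrite rule for entries, hence this form with the
conjugate on the left.\<close>

lemma hermitian_entry:
  fixes A :: "complex mat"
  assumes "A \<in> carrier_mat n n" "mat_adjoint A = A" "i < n" "j < n"
  shows "cnj (A $$ (j, i)) = A $$ (i, j)"
proof -
  have "mat_adjoint A $$ (i, j) = cnj (A $$ (j, i))" using assms(1,3,4) by simp
  then show ?thesis unfolding assms(2) by simp
qed

lemma mult_mat_index:
  assumes "i < dim_row A" "j < dim_col B" "dim_col A = dim_row B"
  shows "(A * B) $$ (i, j) = (\<Sum>k<dim_row B. A $$ (i, k) * B $$ (k, j))"
  using assms by (simp add: scalar_prod_def atLeast0LessThan)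

lemma mult_mat_vec_index:
  assumes "i < dim_row A" "dim_col A = dim_vec v"
  shows "vec_index (A *\<^sub>v v) i = (\<Sum>k<dim_vec v. A $$ (i, k) * vec_index v k)"
  using assms by (simp add: scalar_prod_def atLeast0LessThan)

lemma mat_adjoint_mult:
  fixes A B :: "complex mat"
  assumes "A \<in> carrier_mat n k" "B \<in> carrier_mat k m"
  shows "mat_adjoint (A * B) = mat_adjoint B * mat_adjoint A"
  using assms by (intro eq_matI) (auto simp: scalar_prod_def mult.commute)

lemma cscalar_prod_mat_adjoint:
  fixes A :: "complex mat"
  assumes A: "A \<in> carrier_mat n m" and v: "v \<in> carrier_vec m" and w: "w \<in> carrier_vec n"
  shows "(mat_adjoint A *\<^sub>v w) \<bullet>c v = w \<bullet>c (A *\<^sub>v v)"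
proof -
  have "(mat_adjoint A *\<^sub>v w) \<bullet>c v = (\<Sum>i<m. \<Sum>j<n. cnj (A $$ (j, i)) * vec_index w j * cnj (vec_index v i))"
    using assms by (auto simp: scalar_prod_def atLeast0LessThan sum_distrib_right intro!: sum.cong)
  also have "\<dots> = (\<Sum>j<n. \<Sum>i<m. cnj (A $$ (j, i)) * vec_index w j * cnj (vec_index v i))"
    by (rule sum.swap)
  also have "\<dots> = w \<bullet>c (A *\<^sub>v v)"
    using assms by (auto simp: scalar_prod_def atLeast0LessThan sum_distrib_left mult_ac intro!: sum.cong)
  finally show ?thesis .
qed

lemma cscalar_prod_self: "v \<bullet>c v = complex_of_real (norm_sq v)"
  by (simp add: scalar_prod_def norm_sq_def atLeast0LessThan flip: complex_norm_square)

lemma norm_sq_nonneg [simp]: "0 \<le> norm_sq v"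
  by (simp add: norm_sq_def sum_nonneg)

lemma eucl_norm_eq: "eucl_norm v = sqrt (norm_sq v)"
  by (simp add: eucl_norm_def norm_sq_def)

lemma norm_sq_eq_0_iff: "v \<in> carrier_vec n \<Longrightarrow> norm_sq v = 0 \<longleftrightarrow> v = 0\<^sub>v n"
  unfolding norm_sq_def by (subst sum_nonneg_eq_0_iff) (auto intro!: eq_vecI)

lemma frob_sq_cols: "frob_sq A = (\<Sum>j<dim_col A. norm_sq (col A j))"
  unfolding frob_sq_def norm_sq_def by (subst sum.swap) simp

lemma frob_sq_mat_adjoint [simp]: "frob_sq (mat_adjoint A) = frob_sq A"
  unfolding frob_sq_def by (subst sum.swap) simp

lemma frob_sq_nonneg [simp]: "0 \<le> frob_sq A"
  by (simp add: frob_sq_def sum_nonneg)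

lemma trace_mult_commute:
  assumes "A \<in> carrier_mat n m" "B \<in> carrier_mat m n"
  shows "trace_mat (A * B) = trace_mat (B * A)"
proof -
  have "trace_mat (A * B) = (\<Sum>i<n. \<Sum>k<m. A $$ (i, k) * B $$ (k, i))"
    using assms by (auto simp: trace_mat_def mult_mat_index simp del: index_mult_mat(1))
  also have "\<dots> = (\<Sum>k<m. \<Sum>i<n. B $$ (k, i) * A $$ (i, k))"
    by (subst sum.swap) (simp add: mult.commute)
  also have "\<dots> = trace_mat (B * A)"
    using assms by (auto simp: trace_mat_def mult_mat_index simp del: index_mult_mat(1))
  finally show ?thesis .
qed

lemma trace_adjoint_mult: "trace_mat (mat_adjoint A * A) = complex_of_real (frob_sq A)"
  by (simp add: trace_mat_def frob_sq_cols scalar_prod_def norm_sq_def atLeast0LessThan mult.commute flip: complex_norm_square)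

text \<open>Every nonzero vector is, up to normalisation, the first column of a unitary matrix: extend it to a
basis and apply Gram-Schmidt. The vectors that the library returns are orthogonal but not
normalised.\<close>

lemma unitary_completion:
  fixes v :: "complex Matrix.vec"
  assumes v: "v \<in> carrier_vec n" "v \<noteq> 0\<^sub>v n"
  obtains U where "U \<in> carrier_mat n n" "mat_adjoint U * U = 1\<^sub>m n" "U * mat_adjoint U = 1\<^sub>m n"
    "col U 0 = complex_of_real (1 / sqrt (norm_sq v)) \<cdot>\<^sub>v v"
proof -
  have n: "n \<noteq> 0" using v by auto
  interpret cof_vec_space n "TYPE(complex)" .
  define b where "b = basis_completion v"
  define ws where "ws = gram_schmidt n b"
  from basis_completion[OF v, folded b_def]
  have dist_b: "distinct b" and indep: "\<not> lin_dep (set b)" and b: "set b \<subseteq> carrier_vec n"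
    and hdb: "hd b = v" and len_b: "length b = n" by auto
  from hdb len_b n obtain vs where bv: "b = v # vs" by (cases b) auto
  from gram_schmidt_result[OF b dist_b indep refl, folded ws_def]
  have ws: "set ws \<subseteq> carrier_vec n" "corthogonal ws" "length ws = n" by (auto simp: len_b)
  from gram_schmidt_hd[OF v(1), of vs, folded bv] have hdws: "hd ws = v" unfolding ws_def .
  define U where "U = Matrix.mat n n (\<lambda>(i, j). vec_index (ws ! j) i / complex_of_real (sqrt (norm_sq (ws ! j))))"
  have U: "U \<in> carrier_mat n n" by (simp add: U_def)
  have wsc: "ws ! j \<in> carrier_vec n" if "j < n" for j using ws that by auto
  have ip: "ws ! j \<bullet>c ws ! i = (\<Sum>k<n. vec_index (ws ! j) k * cnj (vec_index (ws ! i) k))" if "i < n" "j < n" for i j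
    using wsc[OF that(1)] wsc[OF that(2)] by (simp add: scalar_prod_def atLeast0LessThan)
  have UU: "mat_adjoint U * U = 1\<^sub>m n"
  proof (rule eq_matI)
    fix i j assume ij: "i < dim_row (1\<^sub>m n)" "j < dim_col (1\<^sub>m n)"
    have "(mat_adjoint U * U) $$ (i, j) =
        (\<Sum>k<n. (vec_index (ws ! j) k * cnj (vec_index (ws ! i) k)) / (complex_of_real (sqrt (norm_sq (ws ! i))) * complex_of_real (sqrt (norm_sq (ws ! j)))))"
      using ij U by (simp add: mult_mat_index U_def mult_ac del: index_mult_mat(1))
    also have "\<dots> = (ws ! j \<bullet>c ws ! i) / (complex_of_real (sqrt (norm_sq (ws ! i))) * complex_of_real (sqrt (norm_sq (ws ! j))))"
      using ij ip[of i j] by (simp add: sum_divide_distrib)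
    also have "\<dots> = 1\<^sub>m n $$ (i, j)"
    proof (cases "i = j")
      case True
      have "ws ! i \<bullet>c ws ! i \<noteq> 0" using corthogonalD[OF ws(2), of i i] ij ws(3) by simp
      then have "norm_sq (ws ! i) \<noteq> 0" by (simp add: cscalar_prod_self)
      then have "complex_of_real (sqrt (norm_sq (ws ! i))) * complex_of_real (sqrt (norm_sq (ws ! i))) = complex_of_real (norm_sq (ws ! i))"
        "complex_of_real (norm_sq (ws ! i)) \<noteq> 0"
        by (simp_all flip: of_real_mult)
      then show ?thesis using True ij by (simp add: cscalar_prod_self)
    next
      case False
      then have "ws ! j \<bullet>c ws ! i = 0" using corthogonalD[OF ws(2), of j i] ij ws(3) by simp
      then show ?thesis using False ij by simp
    qed
    finally show "(mat_adjoint U * U) $$ (i, j) = 1\<^sub>m n $$ (i, j)" .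
  qed (use U in auto)
  have "ws ! 0 = v" using hdws ws(3) n hd_conv_nth[of ws] by fastforce
  then have "col U 0 = complex_of_real (1 / sqrt (norm_sq v)) \<cdot>\<^sub>v v"
    using n v by (intro eq_vecI) (auto simp: U_def)
  moreover have "U * mat_adjoint U = 1\<^sub>m n"
    using mat_mult_left_right_inverse[OF _ U UU] U by auto
  ultimately show thesis using that U UU by blast
qed

text \<open>By induction on the size. A unitary matrix that starts with an eigenvector conjugates the matrix
into one whose first column is a multiple of the first basis vector; being Hermitian, this matrix
is block diagonal, and the induction hypothesis diagonalises the remaining block.\<close>

lemma hermitian_spectral_theorem:
  assumes "A \<in> carrier_mat n n" "mat_adjoint A = A"
  obtains U d where "U \<in> carrier_mat n n" "mat_adjoint U * U = 1\<^sub>m n" "U * mat_adjoint U = 1\<^sub>m n"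
    "A = U * real_diag n d * mat_adjoint U"
proof -
  have "\<exists>U d. U \<in> carrier_mat n n \<and> mat_adjoint U * U = 1\<^sub>m n \<and> U * mat_adjoint U = 1\<^sub>m n \<and>
    A = U * real_diag n d * mat_adjoint U"
    using assms
  proof (induction n arbitrary: A)
    case 0
    have "A = 1\<^sub>m 0 * real_diag 0 (\<lambda>_. 0) * mat_adjoint (1\<^sub>m 0)"
      by (rule eq_matI) (use 0 in simp_all)
    moreover have "mat_adjoint (1\<^sub>m 0) = (1\<^sub>m 0 :: complex mat)" by (rule eq_matI) simp_all
    ultimately show ?case
      by (intro exI[of _ "1\<^sub>m 0"] exI[of _ "\<lambda>_. 0 :: real"]) simp
  next
    case (Suc n)
    note A = Suc.prems(1) and herm = Suc.prems(2)
    note sq = mult_carrier_mat[of _ "Suc n" "Suc n" _ "Suc n"] mat_adjoint_mult[of _ "Suc n" "Suc n" _ "Suc n"]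
      assoc_mult_mat[of _ "Suc n" "Suc n" _ "Suc n" _ "Suc n"]
    have "spectrum A \<noteq> {}" using spectrum_non_empty[OF A] by simp
    then obtain e v where ev: "eigenvector A v e" by (auto simp: spectrum_def eigenvalue_def)
    then have v: "v \<in> carrier_vec (Suc n)" "v \<noteq> 0\<^sub>v (Suc n)" and Av: "A *\<^sub>v v = e \<cdot>\<^sub>v v"
      using A by (auto simp: eigenvector_def)
    obtain U where U: "U \<in> carrier_mat (Suc n) (Suc n)" and UU: "mat_adjoint U * U = 1\<^sub>m (Suc n)"
      "U * mat_adjoint U = 1\<^sub>m (Suc n)" and U0: "col U 0 = complex_of_real (1 / sqrt (norm_sq v)) \<cdot>\<^sub>v v"
      using unitary_completion[OF v] by blast
    have U': "mat_adjoint U \<in> carrier_mat (Suc n) (Suc n)" using U by simp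
    define A' where "A' = mat_adjoint U * (A * U)"
    have A': "A' \<in> carrier_mat (Suc n) (Suc n)" using A U by (simp add: A'_def sq)
    have hA': "mat_adjoint A' = A'"
      using A U U' herm by (simp add: A'_def sq)
    have colAU: "col (A * U) 0 = e \<cdot>\<^sub>v col U 0"
    proof -
      have "col (A * U) 0 = A *\<^sub>v col U 0" by (rule col_mult2[OF A U]) simp
      also have "\<dots> = complex_of_real (1 / sqrt (norm_sq v)) \<cdot>\<^sub>v (A *\<^sub>v v)"
        unfolding U0 by (rule mult_mat_vec[OF A v(1)])
      also have "\<dots> = e \<cdot>\<^sub>v col U 0"
        unfolding U0 Av by (simp only: smult_smult_assoc mult.commute)
      finally show ?thesis .
    qed
    have A'0: "A' $$ (i, 0) = (if i = 0 then e else 0)" if i: "i < Suc n" for i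
    proof -
      have "A' $$ (i, 0) = scalar_prod (row (mat_adjoint U) i) (col (A * U) 0)"
        using A U i by (simp add: A'_def)
      also have "\<dots> = e * (scalar_prod (row (mat_adjoint U) i) (col U 0))"
        unfolding colAU
      proof (rule scalar_prod_smult_distrib[of _ "Suc n"])
        show "row (mat_adjoint U) i \<in> carrier_vec (Suc n)" using U' i by auto
        show "col U 0 \<in> carrier_vec (Suc n)" using col_dim[of U 0] U by simp
      qed
      also have "scalar_prod (row (mat_adjoint U) i) (col U 0) = (mat_adjoint U * U) $$ (i, 0)"
        using U i by simp
      finally show ?thesis unfolding UU(1) using i by simp
    qed
    have A'sym: "A' $$ (i, j) = cnj (A' $$ (j, i))" if "i < Suc n" "j < Suc n" for i j
      using arg_cong[OF hA', of "\<lambda>M. M $$ (i, j)"] A' that by simp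
    have e: "complex_of_real (Re e) = e"
      using A'sym[of 0 0] A'0[of 0] by (simp add: complex_eq_iff)
    define A3 where "A3 = Matrix.mat n n (\<lambda>(i, j). A' $$ (Suc i, Suc j))"
    have "mat_adjoint A3 = A3"
    proof (rule eq_matI)
      fix i j assume "i < dim_row A3" "j < dim_col A3"
      then show "mat_adjoint A3 $$ (i, j) = A3 $$ (i, j)"
        using A'sym[of "Suc i" "Suc j"] by (simp add: A3_def)
    qed (simp_all add: A3_def)
    moreover have "A3 \<in> carrier_mat n n" by (simp add: A3_def)
    ultimately obtain V d where V: "V \<in> carrier_mat n n" and VV: "mat_adjoint V * V = 1\<^sub>m n" "V * mat_adjoint V = 1\<^sub>m n"
      and A3: "A3 = V * real_diag n d * mat_adjoint V"
      using Suc.IH[of A3] by blast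
    define D where "D = real_diag (Suc n) (case_nat (Re e) d)"
    define E where "E = Matrix.mat 1 1 (\<lambda>_. e)"
    \<comment> \<open>In this basis the matrix is \<open>e\<close> followed by the block \<open>A3\<close>, which \<open>V\<close> diagonalises.\<close>
    define W where "W = four_block_mat (1\<^sub>m 1) (0\<^sub>m 1 n) (0\<^sub>m n 1) V"
    have W: "W \<in> carrier_mat (Suc n) (Suc n)" using V four_block_carrier_mat[of "1\<^sub>m 1" 1 1 V n n] by (simp add: W_def)
    have D: "D \<in> carrier_mat (Suc n) (Suc n)" by (simp add: D_def real_diag_def)
    have D4: "D = four_block_mat E (0\<^sub>m 1 n) (0\<^sub>m n 1) (real_diag n d)"
      using e by (intro eq_matI) (auto simp: D_def E_def real_diag_def split: nat.splits)
    have W': "mat_adjoint W = four_block_mat (1\<^sub>m 1) (0\<^sub>m 1 n) (0\<^sub>m n 1) (mat_adjoint V)"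
      using V W by (intro eq_matI) (auto simp: W_def)
    have V': "mat_adjoint V \<in> carrier_mat n n" "real_diag n d \<in> carrier_mat n n" "E \<in> carrier_mat 1 1"
      using V by (auto simp: real_diag_def E_def)
    have blk: "four_block_mat X1 (0\<^sub>m 1 n) (0\<^sub>m n 1) X4 * four_block_mat Y1 (0\<^sub>m 1 n) (0\<^sub>m n 1) Y4 =
        four_block_mat (X1 * Y1) (0\<^sub>m 1 n) (0\<^sub>m n 1) (X4 * Y4)"
      if "X1 \<in> carrier_mat 1 1" "Y1 \<in> carrier_mat 1 1" "X4 \<in> carrier_mat n n" "Y4 \<in> carrier_mat n n" for X1 Y1 X4 Y4 :: "complex mat"
      using that by (subst mult_four_block_mat[OF that(1) _ _ that(3) that(2) _ _ that(4)]) auto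
    have A'4: "A' = four_block_mat E (0\<^sub>m 1 n) (0\<^sub>m n 1) A3"
    proof (rule eq_matI)
      fix i j assume "i < dim_row (four_block_mat E (0\<^sub>m 1 n) (0\<^sub>m n 1) A3)" "j < dim_col (four_block_mat E (0\<^sub>m 1 n) (0\<^sub>m n 1) A3)"
      then have ij: "i < Suc n" "j < Suc n" by (simp_all add: E_def A3_def)
      show "A' $$ (i, j) = four_block_mat E (0\<^sub>m 1 n) (0\<^sub>m n 1) A3 $$ (i, j)"
        using ij A'0[of i] A'0[of j] A'sym[of 0 j] by (cases i; cases j) (simp_all add: E_def A3_def)
    qed (use A' in \<open>auto simp: E_def A3_def\<close>)
    have WDW: "W * D * mat_adjoint W = A'"
      unfolding A'4 A3 unfolding W' D4 unfolding W_def
      using V V' by (simp add: blk mult_carrier_mat[of _ n n _ n] del: One_nat_def)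
    have "U * A' * mat_adjoint U = (U * mat_adjoint U) * A * (U * mat_adjoint U)"
      using A U U' by (simp add: A'_def sq)
    then have "A = U * A' * mat_adjoint U" using A UU by simp
    also have "\<dots> = (U * W) * D * mat_adjoint (U * W)"
      unfolding WDW[symmetric] using U U' W D by (simp add: sq)
    finally have UWD: "A = (U * W) * D * mat_adjoint (U * W)" .
    have "mat_adjoint W * W = four_block_mat (1\<^sub>m 1) (0\<^sub>m 1 n) (0\<^sub>m n 1) (1\<^sub>m n)"
      unfolding W' unfolding W_def using V V' VV by (simp add: blk del: One_nat_def)
    then have WW: "mat_adjoint W * W = 1\<^sub>m (Suc n)" by simp
    have "mat_adjoint (U * W) * (U * W) = mat_adjoint W * (mat_adjoint U * U) * W"
      using U U' W by (simp add: sq)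
    then have UW: "mat_adjoint (U * W) * (U * W) = 1\<^sub>m (Suc n)" using UU W WW by simp
    have UWc: "U * W \<in> carrier_mat (Suc n) (Suc n)" using U W by (rule mult_carrier_mat)
    have "(U * W) * mat_adjoint (U * W) = 1\<^sub>m (Suc n)"
      using mat_mult_left_right_inverse[OF _ UWc UW] UWc by simp
    with UWc UW UWD show ?case unfolding D_def by blast
  qed
  then show thesis using that by blast
qed

lemma cscalar_prod_col:
  fixes A U :: "complex mat"
  assumes A: "A \<in> carrier_mat n n" and U: "U \<in> carrier_mat n n" and i: "i < n"
  shows "(A *\<^sub>v col U i) \<bullet>c col U i = (mat_adjoint U * (A * U)) $$ (i, i)"
proof -
  have "(mat_adjoint U * (A * U)) $$ (i, i) = scalar_prod (row (mat_adjoint U) i) (col (A * U) i)"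
    using A U i by simp
  also have "row (mat_adjoint U) i = conjugate (col U i)"
    using U i by (intro eq_vecI) simp_all
  also have "col (A * U) i = A *\<^sub>v col U i" using col_mult2[OF A U i] .
  also have "scalar_prod (conjugate (col U i)) (A *\<^sub>v col U i) = (A *\<^sub>v col U i) \<bullet>c col U i"
    using A U col_dim[of U i] by (intro comm_scalar_prod[of _ n]) simp_all
  finally show ?thesis by simp
qed

text \<open>This converts bounds for the quadratic form of a Hermitian matrix into bounds for its eigenvalues.\<close>

lemma spectral_form_at_eigenvector:
  fixes A U :: "complex mat"
  assumes U: "U \<in> carrier_mat n n" "mat_adjoint U * U = 1\<^sub>m n"
    and A: "A = U * real_diag n d * mat_adjoint U" and i: "i < n"
  shows "(A *\<^sub>v col U i) \<bullet>c col U i = complex_of_real (d i)" "norm_sq (col U i) = 1"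
proof -
  have D: "real_diag n d \<in> carrier_mat n n" by (simp add: real_diag_def)
  note sq = mult_carrier_mat[of _ n n _ n] assoc_mult_mat[of _ n n _ n _ n]
  have Ac: "A \<in> carrier_mat n n" using U D by (simp add: A sq)
  have "mat_adjoint U * (A * U) = (mat_adjoint U * U) * real_diag n d * (mat_adjoint U * U)"
    using U(1) D by (simp add: A sq)
  also have "\<dots> = real_diag n d" using U(2) D by simp
  finally show "(A *\<^sub>v col U i) \<bullet>c col U i = complex_of_real (d i)"
    using cscalar_prod_col[OF Ac U(1) i] i by (simp add: real_diag_def)
  have "complex_of_real (norm_sq (col U i)) = (1\<^sub>m n *\<^sub>v col U i) \<bullet>c col U i"
    using U(1) col_dim[of U i] by (simp add: cscalar_prod_self)
  also have "\<dots> = (mat_adjoint U * (1\<^sub>m n * U)) $$ (i, i)"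
    by (rule cscalar_prod_col[OF _ U(1) i]) simp
  also have "\<dots> = 1" using U i by simp
  finally show "norm_sq (col U i) = 1" by (simp only: of_real_eq_1_iff)
qed

lemma psd_hermitian_adjoint_mult:
  assumes S: "S \<in> carrier_mat n n"
  shows "psd_hermitian n (mat_adjoint S * S)"
proof -
  have "0 \<le> Re ((mat_adjoint S * S *\<^sub>v v) \<bullet>c v)" if v: "v \<in> carrier_vec n" for v
  proof -
    have "(mat_adjoint S * S *\<^sub>v v) \<bullet>c v = (mat_adjoint S *\<^sub>v (S *\<^sub>v v)) \<bullet>c v"
      using S v by (subst assoc_mult_mat_vec[of _ n n _ n]) auto
    also have "\<dots> = complex_of_real (norm_sq (S *\<^sub>v v))"
      using S v by (subst cscalar_prod_mat_adjoint[of S n n]) (auto simp: cscalar_prod_self)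
    finally show ?thesis by simp
  qed
  moreover have "mat_adjoint (mat_adjoint S * S) = mat_adjoint S * S"
    using S by (subst mat_adjoint_mult[of _ n n _ n]) simp_all
  ultimately show ?thesis
    using S mult_carrier_mat[of "mat_adjoint S" n n S n] by (simp add: psd_hermitian_def)
qed

lemma real_diag_mult: "real_diag n d * real_diag n e = real_diag n (\<lambda>i. d i * e i)"
  by (intro eq_matI) (auto simp: real_diag_def scalar_prod_def sum.delta if_distrib cong: if_cong)

lemma mat_adjoint_real_diag [simp]: "mat_adjoint (real_diag n d) = real_diag n d"
  by (intro eq_matI) (auto simp: real_diag_def)

text \<open>A witness for the choice in the definition of the square root is the matrix with the same
eigenvectors and with the roots of the eigenvalues.\<close>

lemma psd_sqrt_root:
  assumes A: "psd_hermitian n A"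
  shows "psd_hermitian n (psd_sqrt A)" "psd_sqrt A * psd_sqrt A = A"
proof -
  have Ac: "A \<in> carrier_mat n n" "mat_adjoint A = A" using A by (auto simp: psd_hermitian_def)
  obtain U d where U: "U \<in> carrier_mat n n" "mat_adjoint U * U = 1\<^sub>m n"
    and AU: "A = U * real_diag n d * mat_adjoint U"
    using hermitian_spectral_theorem[OF Ac] by blast
  have d: "d i \<ge> 0" if i: "i < n" for i
  proof -
    have "0 \<le> Re ((A *\<^sub>v col U i) \<bullet>c col U i)"
      using A U(1) col_dim[of U i] by (simp add: psd_hermitian_def)
    then show ?thesis using spectral_form_at_eigenvector(1)[OF U AU i] by simp
  qed
  \<comment> \<open>Fourth roots of the eigenvalues: positivity of the root \<open>B\<close> is read off from \<open>B = S\<^sup>* S\<close>.\<close>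
  define S where "S = real_diag n (\<lambda>i. sqrt (sqrt (d i))) * mat_adjoint U"
  have rd: "real_diag n e \<in> carrier_mat n n" for e by (simp add: real_diag_def)
  have U': "mat_adjoint U \<in> carrier_mat n n" using U(1) by simp
  note sq = mult_carrier_mat[of _ n n _ n] assoc_mult_mat[of _ n n _ n _ n] mat_adjoint_mult[of _ n n _ n]
  have S: "S \<in> carrier_mat n n" using U' rd by (simp add: S_def sq)
  define B where "B = U * real_diag n (\<lambda>i. sqrt (d i)) * mat_adjoint U"
  have "mat_adjoint S * S = U * (real_diag n (\<lambda>i. sqrt (sqrt (d i))) * real_diag n (\<lambda>i. sqrt (sqrt (d i)))) * mat_adjoint U"
    using U(1) U' rd by (simp add: S_def sq)
  also have "real_diag n (\<lambda>i. sqrt (sqrt (d i))) * real_diag n (\<lambda>i. sqrt (sqrt (d i))) = real_diag n (\<lambda>i. sqrt (d i))"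
    unfolding real_diag_mult by (rule eq_matI) (auto simp: real_diag_def d simp flip: of_real_mult)
  finally have "mat_adjoint S * S = B" by (simp add: B_def)
  then have "psd_hermitian n B" using psd_hermitian_adjoint_mult[OF S] by simp
  moreover have "B * B = A"
  proof -
    have "B * B = U * real_diag n (\<lambda>i. sqrt (d i)) * (mat_adjoint U * U) * real_diag n (\<lambda>i. sqrt (d i)) * mat_adjoint U"
      using U(1) U' rd by (simp add: B_def sq)
    also have "\<dots> = U * (real_diag n (\<lambda>i. sqrt (d i)) * real_diag n (\<lambda>i. sqrt (d i))) * mat_adjoint U"
      using U U' rd by (simp add: sq left_mult_one_mat[of _ n n])
    also have "real_diag n (\<lambda>i. sqrt (d i)) * real_diag n (\<lambda>i. sqrt (d i)) = real_diag n d"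
      unfolding real_diag_mult by (rule eq_matI) (auto simp: real_diag_def d simp flip: of_real_mult)
    finally show ?thesis by (simp add: AU)
  qed
  ultimately have "\<exists>B. psd_hermitian (dim_row A) B \<and> B * B = A" using Ac by auto
  from someI_ex[OF this] show "psd_hermitian n (psd_sqrt A)" "psd_sqrt A * psd_sqrt A = A"
    unfolding psd_sqrt_def using Ac by auto
qed

text \<open>This converts bounds for the quadratic form of \<open>B\<^sup>2\<close> into bounds for the operator norm of \<open>B\<close>.\<close>

lemma norm_sq_mult_root:
  assumes B: "B \<in> carrier_mat n n" "mat_adjoint B = B" and v: "v \<in> carrier_vec n"
  shows "norm_sq (B *\<^sub>v v) = Re ((B * B *\<^sub>v v) \<bullet>c v)"
proof -
  have "(B * B *\<^sub>v v) \<bullet>c v = (mat_adjoint B *\<^sub>v (B *\<^sub>v v)) \<bullet>c v"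
    using B v by (subst assoc_mult_mat_vec[of _ n n _ n]) auto
  also have "\<dots> = complex_of_real (norm_sq (B *\<^sub>v v))"
    using B(1) v by (subst cscalar_prod_mat_adjoint[of B n n]) (auto simp: cscalar_prod_self)
  finally show ?thesis by simp
qed

lemma frob_sq_root_mult_le:
  assumes B: "B \<in> carrier_mat n n" "mat_adjoint B = B"
    and u: "\<And>v. v \<in> carrier_vec n \<Longrightarrow> Re ((B * B *\<^sub>v v) \<bullet>c v) \<le> u * norm_sq v"
  shows "Y \<in> carrier_mat n m \<Longrightarrow> frob_sq (B * Y) \<le> u * frob_sq Y"
    and "Y \<in> carrier_mat m n \<Longrightarrow> frob_sq (Y * B) \<le> u * frob_sq Y"
proof -
  show left: "frob_sq (B * Y) \<le> u * frob_sq Y" if Y: "Y \<in> carrier_mat n m" for Y m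
  proof -
    have "frob_sq (B * Y) = (\<Sum>j<m. norm_sq (col (B * Y) j))"
      unfolding frob_sq_cols using Y by (simp only: index_mult_mat carrier_matD)
    also have "\<dots> = (\<Sum>j<m. norm_sq (B *\<^sub>v col Y j))"
      by (intro sum.cong refl) (simp only: col_mult2[OF B(1) Y] lessThan_iff)
    also have "\<dots> \<le> (\<Sum>j<m. u * norm_sq (col Y j))"
    proof (rule sum_mono)
      fix j
      have c: "col Y j \<in> carrier_vec n" using Y col_dim[of Y j] by simp
      show "norm_sq (B *\<^sub>v col Y j) \<le> u * norm_sq (col Y j)"
        using norm_sq_mult_root[OF B c] u[OF c] by simp
    qed
    also have "\<dots> = u * frob_sq Y" using Y by (simp add: frob_sq_cols sum_distrib_left)
    finally show ?thesis .
  qed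
  assume Y: "Y \<in> carrier_mat m n"
  have "frob_sq (Y * B) = frob_sq (mat_adjoint (Y * B))" by simp
  also have "mat_adjoint (Y * B) = B * mat_adjoint Y" using mat_adjoint_mult[OF Y B(1)] B(2) by simp
  also have "frob_sq \<dots> \<le> u * frob_sq (mat_adjoint Y)" by (rule left[OF mat_adjoint_carrier[OF Y]])
  finally show "frob_sq (Y * B) \<le> u * frob_sq Y" by simp
qed

lemma trace_unitary_conj:
  assumes U: "U \<in> carrier_mat n n" "mat_adjoint U * U = 1\<^sub>m n"
  shows "trace_mat (U * real_diag n d * mat_adjoint U) = complex_of_real (\<Sum>i<n. d i)"
proof -
  have D: "real_diag n d \<in> carrier_mat n n" by (simp add: real_diag_def)
  note sq = mult_carrier_mat[of _ n n _ n] assoc_mult_mat[of _ n n _ n _ n]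
  have "trace_mat (U * (real_diag n d * mat_adjoint U)) = trace_mat (real_diag n d * mat_adjoint U * U)"
    using U(1) D by (intro trace_mult_commute[of _ n n]) (auto simp: sq)
  also have "real_diag n d * mat_adjoint U * U = real_diag n d" using U D by (simp add: sq)
  finally show ?thesis using U(1) D by (simp add: sq) (simp add: trace_mat_def real_diag_def)
qed

text \<open>The factors of the determinant are \<open>1 - d\<close> for the eigenvalues \<open>d\<close> of \<open>Q\<close>, whose sum is the trace and
whose sum of squares is the squared Frobenius norm; the claim comes down to \<open>ln (1 - d) \<ge> - d - 2 d\<^sup>2\<close> for \<open>\<bar>d\<bar> \<le> 1/2\<close>.\<close>

lemma det_one_minus_ge:
  assumes Q: "Q \<in> carrier_mat n n" "mat_adjoint Q = Q"
    and s: "\<And>v. v \<in> carrier_vec n \<Longrightarrow> \<bar>Re ((Q *\<^sub>v v) \<bullet>c v)\<bar> \<le> 1 / 2 * norm_sq v"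
  shows "Im (det (1\<^sub>m n - Q)) = 0"
    "exp (- Re (trace_mat Q) - 2 * frob_sq Q) \<le> Re (det (1\<^sub>m n - Q))"
proof -
  obtain U d where U: "U \<in> carrier_mat n n" "mat_adjoint U * U = 1\<^sub>m n" "U * mat_adjoint U = 1\<^sub>m n"
    and QU: "Q = U * real_diag n d * mat_adjoint U"
    using hermitian_spectral_theorem[OF Q] by blast
  have rd: "real_diag n e \<in> carrier_mat n n" for e by (simp add: real_diag_def)
  have U': "mat_adjoint U \<in> carrier_mat n n" using U(1) by simp
  note sq = mult_carrier_mat[of _ n n _ n] assoc_mult_mat[of _ n n _ n _ n]
  have d: "\<bar>d i\<bar> \<le> 1 / 2" if i: "i < n" for i
    using s[of "col U i"] spectral_form_at_eigenvector[OF U(1,2) QU i] U(1) col_dim[of U i] by simp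
  have tr: "Re (trace_mat Q) = (\<Sum>i<n. d i)"
    unfolding QU trace_unitary_conj[OF U(1,2)] by simp
  have "mat_adjoint Q * Q = U * real_diag n d * (mat_adjoint U * U) * real_diag n d * mat_adjoint U"
    unfolding Q(2) unfolding QU using U(1) U' rd by (simp add: sq)
  also have "\<dots> = U * (real_diag n d * real_diag n d) * mat_adjoint U"
    using U U' rd by (simp add: sq left_mult_one_mat[of _ n n])
  finally have "complex_of_real (frob_sq Q) = complex_of_real (\<Sum>i<n. d i * d i)"
    unfolding trace_adjoint_mult[symmetric] real_diag_mult using trace_unitary_conj[OF U(1,2)] by simp
  then have fr: "frob_sq Q = (\<Sum>i<n. (d i)\<^sup>2)" by (simp only: of_real_eq_iff power2_eq_square)
  have "1\<^sub>m n - Q = U * real_diag n (\<lambda>i. 1 - d i) * mat_adjoint U"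
  proof -
    have "real_diag n (\<lambda>i. 1 - d i) = 1\<^sub>m n - real_diag n d"
      by (intro eq_matI) (auto simp: real_diag_def)
    then have "U * real_diag n (\<lambda>i. 1 - d i) * mat_adjoint U = (U * 1\<^sub>m n - U * real_diag n d) * mat_adjoint U"
      using U(1) rd by (simp add: mult_minus_distrib_mat[of _ n n _ n])
    also have "\<dots> = U * mat_adjoint U - Q"
      using U U' rd unfolding QU by (subst minus_mult_distrib_mat[of _ n n _ _ n]) (auto simp: sq)
    finally show ?thesis using U(3) by simp
  qed
  then have "det (1\<^sub>m n - Q) = det U * det (real_diag n (\<lambda>i. 1 - d i)) * det (mat_adjoint U)"
    using U(1) U' rd by (simp add: det_mult[of _ n] sq)
  also have "\<dots> = det (U * mat_adjoint U) * det (real_diag n (\<lambda>i. 1 - d i))"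
    using U(1) U' by (simp add: det_mult[of _ n])
  also have "\<dots> = det (real_diag n (\<lambda>i. 1 - d i))" using U(3) by simp
  also have "\<dots> = prod_list (diag_mat (real_diag n (\<lambda>i. 1 - d i)))"
    by (rule det_upper_triangular[OF _ rd]) (auto simp: real_diag_def upper_triangular_def)
  also have "\<dots> = complex_of_real (\<Prod>i<n. 1 - d i)"
    by (simp add: diag_mat_def real_diag_def prod.distinct_set_conv_list[symmetric] atLeast0LessThan)
  finally have det: "det (1\<^sub>m n - Q) = complex_of_real (\<Prod>i<n. 1 - d i)" .
  then show "Im (det (1\<^sub>m n - Q)) = 0" by (simp only: Im_complex_of_real)
  have "exp (- Re (trace_mat Q) - 2 * frob_sq Q) = (\<Prod>i<n. exp (- d i - 2 * (d i)\<^sup>2))"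
    unfolding tr fr by (simp add: exp_sum[symmetric] sum_subtractf sum_negf sum_distrib_left)
  also have "\<dots> \<le> (\<Prod>i<n. 1 - d i)"
  proof (intro prod_mono conjI)
    fix i assume "i \<in> {..<n}"
    then have di: "\<bar>d i\<bar> \<le> 1 / 2" using d by simp
    then have "\<bar>ln (1 + - d i) - - d i\<bar> \<le> 2 * (- d i)\<^sup>2"
      by (intro abs_ln_one_plus_x_minus_x_bound) simp
    then have "- d i - 2 * (d i)\<^sup>2 \<le> ln (1 - d i)" by simp
    then show "exp (- d i - 2 * (d i)\<^sup>2) \<le> 1 - d i" using di by (subst ln_ge_iff[symmetric]) auto
  qed simp
  finally show "exp (- Re (trace_mat Q) - 2 * frob_sq Q) \<le> Re (det (1\<^sub>m n - Q))"
    unfolding det Re_complex_of_real .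
qed

lemma cmod_sum_mult_sq_le:
  fixes f g :: "'i \<Rightarrow> complex"
  shows "(cmod (\<Sum>i\<in>A. f i * g i))\<^sup>2 \<le> (\<Sum>i\<in>A. (cmod (f i))\<^sup>2) * (\<Sum>i\<in>A. (cmod (g i))\<^sup>2)"
proof -
  have "cmod (\<Sum>i\<in>A. f i * g i) \<le> (\<Sum>i\<in>A. cmod (f i) * cmod (g i))"
    by (rule order_trans[OF norm_sum]) (simp add: norm_mult)
  then have "(cmod (\<Sum>i\<in>A. f i * g i))\<^sup>2 \<le> (\<Sum>i\<in>A. cmod (f i) * cmod (g i))\<^sup>2"
    by (intro power_mono) auto
  also have "\<dots> \<le> (\<Sum>i\<in>A. (cmod (f i))\<^sup>2) * (\<Sum>i\<in>A. (cmod (g i))\<^sup>2)"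
    by (rule Cauchy_Schwarz_ineq_sum)
  finally show ?thesis .
qed

lemma norm_sq_mult_mat_vec_le:
  assumes A: "A \<in> carrier_mat n m" and v: "v \<in> carrier_vec m"
  shows "norm_sq (A *\<^sub>v v) \<le> frob_sq A * norm_sq v"
proof -
  have "norm_sq (A *\<^sub>v v) = (\<Sum>i<n. (cmod (\<Sum>k<m. A $$ (i, k) * vec_index v k))\<^sup>2)"
    using A v by (simp add: norm_sq_def mult_mat_vec_index del: index_mult_mat_vec)
  also have "\<dots> \<le> (\<Sum>i<n. (\<Sum>k<m. (cmod (A $$ (i, k)))\<^sup>2) * (\<Sum>k<m. (cmod (vec_index v k))\<^sup>2))"
    by (intro sum_mono cmod_sum_mult_sq_le)
  also have "\<dots> = frob_sq A * norm_sq v"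
    using A v by (simp add: frob_sq_def norm_sq_def sum_distrib_right)
  finally show ?thesis .
qed

lemma frob_sq_mult_le:
  assumes A: "A \<in> carrier_mat n m" and B: "B \<in> carrier_mat m k"
  shows "frob_sq (A * B) \<le> frob_sq A * frob_sq B"
proof -
  have "frob_sq (A * B) = (\<Sum>j<k. norm_sq (col (A * B) j))"
    unfolding frob_sq_cols using B by (simp only: index_mult_mat carrier_matD)
  also have "\<dots> = (\<Sum>j<k. norm_sq (A *\<^sub>v col B j))"
    by (intro sum.cong refl) (simp only: col_mult2[OF A B] lessThan_iff)
  also have "\<dots> \<le> (\<Sum>j<k. frob_sq A * norm_sq (col B j))"
    using B col_dim[of B] by (intro sum_mono norm_sq_mult_mat_vec_le[OF A]) simp
  also have "\<dots> = frob_sq A * frob_sq B"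
    using B by (simp add: frob_sq_cols sum_distrib_left)
  finally show ?thesis .
qed

lemma cmod_trace_adjoint_mult_le:
  assumes A: "A \<in> carrier_mat n m" and B: "B \<in> carrier_mat n m"
  shows "cmod (trace_mat (mat_adjoint A * B)) \<le> sqrt (frob_sq A) * sqrt (frob_sq B)"
proof -
  have "trace_mat (mat_adjoint A * B) = (\<Sum>(i, k)\<in>{..<m} \<times> {..<n}. cnj (A $$ (k, i)) * B $$ (k, i))"
    using A B by (simp add: trace_mat_def mult_mat_index sum.cartesian_product[symmetric] del: index_mult_mat(1))
  then have "(cmod (trace_mat (mat_adjoint A * B)))\<^sup>2
      \<le> (\<Sum>x\<in>{..<m} \<times> {..<n}. (cmod (cnj (A $$ (snd x, fst x))))\<^sup>2) * (\<Sum>x\<in>{..<m} \<times> {..<n}. (cmod (B $$ (snd x, fst x)))\<^sup>2)"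
    using cmod_sum_mult_sq_le[of "\<lambda>x. cnj (A $$ (snd x, fst x))" "\<lambda>x. B $$ (snd x, fst x)" "{..<m} \<times> {..<n}"]
    by (simp add: case_prod_beta)
  also have "\<dots> = frob_sq A * frob_sq B"
  proof -
    have "(\<Sum>x\<in>{..<m} \<times> {..<n}. (cmod (D $$ (snd x, fst x)))\<^sup>2) = frob_sq D" if "D \<in> carrier_mat n m" for D :: "complex mat"
    proof -
      have "(\<Sum>x\<in>{..<m} \<times> {..<n}. (cmod (D $$ (snd x, fst x)))\<^sup>2) = (\<Sum>i<m. \<Sum>k<n. (cmod (D $$ (k, i)))\<^sup>2)"
        by (simp add: sum.cartesian_product case_prod_beta)
      then show ?thesis using that by (subst (asm) sum.swap) (simp add: frob_sq_def)
    qed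
    from this[OF A] this[OF B] show ?thesis by simp
  qed
  finally show ?thesis
    unfolding real_sqrt_mult[symmetric] by (rule real_le_rsqrt)
qed

text \<open>The supremum in the definition of the operator norm is over a bounded set because the Frobenius norm
dominates it.\<close>

lemma eucl_norm_mult_le_op_norm:
  assumes A: "A \<in> carrier_mat n m" and v: "v \<in> carrier_vec m"
  shows "eucl_norm (A *\<^sub>v v) \<le> op_norm A * eucl_norm v"
proof (cases "norm_sq v = 0")
  case True
  then have "v = 0\<^sub>v m" using norm_sq_eq_0_iff[OF v] by simp
  then show ?thesis using norm_sq_mult_mat_vec_le[OF A v] True by (simp add: eucl_norm_eq)
next
  case False
  define r where "r = eucl_norm v"
  have r: "r > 0" using False by (simp add: r_def eucl_norm_eq less_le)
  have scale: "eucl_norm (complex_of_real c \<cdot>\<^sub>v w) = c * eucl_norm w" if "c \<ge> 0" for c w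
  proof -
    have "norm_sq (complex_of_real c \<cdot>\<^sub>v w) = c\<^sup>2 * norm_sq w"
      by (simp add: norm_sq_def norm_mult power_mult_distrib sum_distrib_left)
    then show ?thesis using that by (simp add: eucl_norm_eq real_sqrt_mult)
  qed
  have "eucl_norm (complex_of_real (1 / r) \<cdot>\<^sub>v v) = 1"
    using r by (subst scale) (auto simp: r_def)
  moreover have "bdd_above {eucl_norm (A *\<^sub>v v) |v. v \<in> carrier_vec (dim_col A) \<and> eucl_norm v \<le> 1}"
  proof (rule bdd_aboveI)
    fix z assume "z \<in> {eucl_norm (A *\<^sub>v v) |v. v \<in> carrier_vec (dim_col A) \<and> eucl_norm v \<le> 1}"
    then obtain w where w: "w \<in> carrier_vec m" "eucl_norm w \<le> 1" "z = eucl_norm (A *\<^sub>v w)" using A by auto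
    have "norm_sq (A *\<^sub>v w) \<le> frob_sq A * norm_sq w" by (rule norm_sq_mult_mat_vec_le[OF A w(1)])
    also have "\<dots> \<le> frob_sq A * 1" using w(2) by (intro mult_left_mono) (auto simp: eucl_norm_eq)
    finally show "z \<le> sqrt (frob_sq A)" by (simp add: w(3) eucl_norm_eq)
  qed
  ultimately have "eucl_norm (A *\<^sub>v (complex_of_real (1 / r) \<cdot>\<^sub>v v)) \<le> op_norm A"
    unfolding op_norm_def using A v by (intro cSup_upper) auto
  also have "A *\<^sub>v (complex_of_real (1 / r) \<cdot>\<^sub>v v) = complex_of_real (1 / r) \<cdot>\<^sub>v (A *\<^sub>v v)"
    by (rule mult_mat_vec[OF A v])
  also have "eucl_norm \<dots> = (1 / r) * eucl_norm (A *\<^sub>v v)" using r by (intro scale) simp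
  finally show ?thesis using r by (simp add: r_def[symmetric] field_simps)
qed

lemma form_le_op_norm:
  assumes A: "A \<in> carrier_mat n n" and v: "v \<in> carrier_vec n"
  shows "Re ((A *\<^sub>v v) \<bullet>c v) \<le> op_norm A * norm_sq v"
proof -
  have Av: "A *\<^sub>v v \<in> carrier_vec n" using A v by (rule mult_mat_vec_carrier)
  have "(A *\<^sub>v v) \<bullet>c v = (\<Sum>i<n. vec_index (A *\<^sub>v v) i * cnj (vec_index v i))"
    using A v by (simp add: scalar_prod_def atLeast0LessThan)
  then have "(cmod ((A *\<^sub>v v) \<bullet>c v))\<^sup>2 \<le> norm_sq (A *\<^sub>v v) * norm_sq v"
    using cmod_sum_mult_sq_le[of "vec_index (A *\<^sub>v v)" "\<lambda>i. cnj (vec_index v i)" "{..<n}"] carrier_vecD[OF Av] carrier_vecD[OF v]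
    by (simp add: norm_sq_def)
  then have "cmod ((A *\<^sub>v v) \<bullet>c v) \<le> eucl_norm (A *\<^sub>v v) * eucl_norm v"
    unfolding eucl_norm_eq real_sqrt_mult[symmetric] by (rule real_le_rsqrt)
  also have "\<dots> \<le> op_norm A * eucl_norm v * eucl_norm v"
    by (intro mult_right_mono eucl_norm_mult_le_op_norm[OF A v]) (simp add: eucl_norm_eq)
  also have "\<dots> = op_norm A * norm_sq v" by (simp add: eucl_norm_eq)
  finally show ?thesis using complex_Re_le_cmod[of "(A *\<^sub>v v) \<bullet>c v"] by linarith
qed

lemma trace_mat_adjoint: "A \<in> carrier_mat n n \<Longrightarrow> trace_mat (mat_adjoint A) = cnj (trace_mat A)"
  by (simp add: trace_mat_def)

lemma trace_hermitian_mult_real: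
  assumes A: "A \<in> carrier_mat n n" "mat_adjoint A = A" and B: "B \<in> carrier_mat n n" "mat_adjoint B = B"
  shows "Im (trace_mat (A * B)) = 0"
proof -
  have "cnj (trace_mat (A * B)) = trace_mat (mat_adjoint (A * B))"
    using A B by (intro trace_mat_adjoint[symmetric, of _ n]) (rule mult_carrier_mat)
  also have "\<dots> = trace_mat (A * B)"
    unfolding mat_adjoint_mult[OF A(1) B(1)] A(2) B(2) by (rule trace_mult_commute[OF B(1) A(1)])
  finally show ?thesis by (simp add: complex_eq_iff)
qed

section \<open>Quadratic forms in Gaussian vectors\<close>

lemma nn_integral_normal_density:
  assumes "\<sigma> > 0"
  shows "(\<integral>\<^sup>+x. ennreal (normal_density \<mu> \<sigma> x) \<partial>lborel) = 1"
proof -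
  interpret prob_space "density lborel (normal_density \<mu> \<sigma>)"
    by (rule prob_space_normal_density[OF assms])
  show ?thesis using emeasure_space_1 by (simp add: emeasure_density)
qed

text \<open>Completing the square turns the integrand into a multiple of another normal density.\<close>

lemma real_gaussian_exp_quadratic:
  fixes a b :: real
  assumes "a > 0"
  shows "(\<integral>\<^sup>+x. ennreal (normal_density 0 (1 / sqrt 2) x) * ennreal (exp ((1 - a) * x\<^sup>2 + 2 * b * x)) \<partial>lborel)
    = ennreal (exp (b\<^sup>2 / a) / sqrt a)"
proof -
  have eq: "normal_density 0 (1 / sqrt 2) x * exp ((1 - a) * x\<^sup>2 + 2 * b * x)
      = exp (b\<^sup>2 / a) / sqrt a * normal_density (b / a) (1 / sqrt (2 * a)) x" for x
  proof -
    have "normal_density 0 (1 / sqrt 2) x = exp (- x\<^sup>2) / sqrt pi"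
      by (simp add: normal_density_def power_divide)
    moreover have "normal_density (b / a) (1 / sqrt (2 * a)) x = sqrt a / sqrt pi * exp (- (a * (x - b / a)\<^sup>2))"
      using assms by (simp add: normal_density_def power_divide real_sqrt_divide)
    moreover have "- x\<^sup>2 + ((1 - a) * x\<^sup>2 + 2 * b * x) = b\<^sup>2 / a + - (a * (x - b / a)\<^sup>2)"
      using assms by (simp add: power2_eq_square field_simps)
    then have "exp (- x\<^sup>2) * exp ((1 - a) * x\<^sup>2 + 2 * b * x) = exp (b\<^sup>2 / a) * exp (- (a * (x - b / a)\<^sup>2))"
      by (simp only: exp_add[symmetric])
    ultimately show ?thesis using assms by simp
  qed
  have "(\<integral>\<^sup>+x. ennreal (normal_density 0 (1 / sqrt 2) x) * ennreal (exp ((1 - a) * x\<^sup>2 + 2 * b * x)) \<partial>lborel)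
     = (\<integral>\<^sup>+x. ennreal (exp (b\<^sup>2 / a) / sqrt a) * ennreal (normal_density (b / a) (1 / sqrt (2 * a)) x) \<partial>lborel)"
    using assms by (simp add: ennreal_mult[symmetric] eq)
  also have "\<dots> = ennreal (exp (b\<^sup>2 / a) / sqrt a)"
    using assms by (simp add: nn_integral_cmult nn_integral_normal_density)
  finally show ?thesis .
qed

text \<open>One integration step: the exponent is \<open>1 - a\<close> times the squared modulus, plus a linear term, so that
the Gaussian weight \<open>exp (- \<bar>z\<bar>\<^sup>2)\<close> leaves \<open>exp (- a \<bar>z\<bar>\<^sup>2)\<close>. Real and imaginary part separate.\<close>

lemma (in prob_space) complex_gaussian_exp_quadratic:
  fixes a :: real and b :: complex
  assumes z: "std_complex_gaussian M z" and "a > 0"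
  shows "(\<integral>\<^sup>+w. ennreal (exp ((1 - a) * (cmod (z w))\<^sup>2 + 2 * Re (cnj (z w) * b))) \<partial>M)
    = ennreal (exp ((cmod b)\<^sup>2 / a) / a)"
proof -
  have Re: "distributed M lborel (\<lambda>w. Re (z w)) (normal_density 0 (1 / sqrt 2))"
    and Im: "distributed M lborel (\<lambda>w. Im (z w)) (normal_density 0 (1 / sqrt 2))"
    and ind: "indep_var borel (\<lambda>w. Re (z w)) borel (\<lambda>w. Im (z w))"
    using z by (auto simp: std_complex_gaussian_def)
  define g where "g \<beta> x = ennreal (exp ((1 - a) * x\<^sup>2 + 2 * \<beta> * x))" for \<beta> x :: real
  have gm: "g \<beta> \<in> borel_measurable borel" for \<beta> unfolding g_def by measurable
  have int: "(\<integral>\<^sup>+w. g \<beta> (X w) \<partial>M) = ennreal (exp (\<beta>\<^sup>2 / a) / sqrt a)"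
    if X: "distributed M lborel X (normal_density 0 (1 / sqrt 2))" for \<beta> X
    using distributed_nn_integral[OF X, of "g \<beta>"] gm real_gaussian_exp_quadratic[OF \<open>a > 0\<close>]
    by (simp add: g_def)
  have "indep_var borel (g (Re b) \<circ> (\<lambda>w. Re (z w))) borel (g (Im b) \<circ> (\<lambda>w. Im (z w)))"
    by (rule indep_var_compose[OF ind gm gm])
  then have "indep_vars (\<lambda>_. borel) (case_bool (\<lambda>w. g (Re b) (Re (z w))) (\<lambda>w. g (Im b) (Im (z w)))) UNIV"
    unfolding indep_var_def by (simp add: comp_def case_bool_if cong: if_cong)
  from indep_vars_nn_integral[OF _ this]
  have "(\<integral>\<^sup>+w. g (Re b) (Re (z w)) * g (Im b) (Im (z w)) \<partial>M)
      = (\<integral>\<^sup>+w. g (Re b) (Re (z w)) \<partial>M) * (\<integral>\<^sup>+w. g (Im b) (Im (z w)) \<partial>M)"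
    by (simp add: UNIV_bool mult.commute)
  also have "\<dots> = ennreal (exp ((Re b)\<^sup>2 / a) / sqrt a * (exp ((Im b)\<^sup>2 / a) / sqrt a))"
    unfolding int[OF Re] int[OF Im] using \<open>a > 0\<close> by (subst ennreal_mult) auto
  also have "exp ((Re b)\<^sup>2 / a) / sqrt a * (exp ((Im b)\<^sup>2 / a) / sqrt a) = exp ((cmod b)\<^sup>2 / a) / a"
    using \<open>a > 0\<close> by (simp add: cmod_power2 add_divide_distrib exp_add)
  finally have "(\<integral>\<^sup>+w. g (Re b) (Re (z w)) * g (Im b) (Im (z w)) \<partial>M) = ennreal (exp ((cmod b)\<^sup>2 / a) / a)" .
  moreover have "g (Re b) (Re (z w)) * g (Im b) (Im (z w))
      = ennreal (exp ((1 - a) * (cmod (z w))\<^sup>2 + 2 * Re (cnj (z w) * b)))" for w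
    by (simp add: g_def ennreal_mult[symmetric] exp_add[symmetric] cmod_power2 algebra_simps)
  ultimately show ?thesis by simp
qed

text \<open>Elimination of the last column: multiplication by a unipotent block matrix makes the matrix block
upper triangular.\<close>

lemma det_schur_complement:
  fixes a :: "nat \<Rightarrow> nat \<Rightarrow> complex"
  assumes "a n n \<noteq> 0"
  shows "det (Matrix.mat (Suc n) (Suc n) (\<lambda>(i, j). a i j))
    = a n n * det (Matrix.mat n n (\<lambda>(i, j). a i j - a i n * a n j / a n n))"
proof -
  define A where "A = Matrix.mat n n (\<lambda>(i, j). a i j)"
  define c where "c = Matrix.mat n 1 (\<lambda>(i, j). a i n)"
  define r where "r = Matrix.mat 1 n (\<lambda>(i, j). a n j)"
  define \<alpha> where "\<alpha> = Matrix.mat 1 1 (\<lambda>_. a n n)"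
  define k where "k = Matrix.mat 1 n (\<lambda>(i, j). - a n j / a n n)"
  define S where "S = Matrix.mat n n (\<lambda>(i, j). a i j - a i n * a n j / a n n)"
  note cs = A_def c_def r_def \<alpha>_def k_def S_def
  have car: "A \<in> carrier_mat n n" "c \<in> carrier_mat n 1" "r \<in> carrier_mat 1 n" "\<alpha> \<in> carrier_mat 1 1"
    "k \<in> carrier_mat 1 n" "S \<in> carrier_mat n n" by (simp_all add: cs)
  have "Matrix.mat (Suc n) (Suc n) (\<lambda>(i, j). a i j) = four_block_mat A c r \<alpha>"
    by (rule eq_matI) (auto simp: cs less_Suc_eq)
  then have "det (Matrix.mat (Suc n) (Suc n) (\<lambda>(i, j). a i j)) = det (four_block_mat A c r \<alpha>)"
    by simp
  also have "\<dots> = det (four_block_mat A c r \<alpha>) * det (four_block_mat (1\<^sub>m n) (0\<^sub>m n 1) k (1\<^sub>m 1))"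
    by (subst det_four_block_mat_upper_right_zero[of "1\<^sub>m n" n _ 1]) (use car in auto)
  also have "\<dots> = det (four_block_mat A c r \<alpha> * four_block_mat (1\<^sub>m n) (0\<^sub>m n 1) k (1\<^sub>m 1))"
    by (rule det_mult[symmetric, of _ "n + 1"]) (use car in auto)
  also have "four_block_mat A c r \<alpha> * four_block_mat (1\<^sub>m n) (0\<^sub>m n 1) k (1\<^sub>m 1)
      = four_block_mat (A * 1\<^sub>m n + c * k) (A * 0\<^sub>m n 1 + c * 1\<^sub>m 1) (r * 1\<^sub>m n + \<alpha> * k) (r * 0\<^sub>m n 1 + \<alpha> * 1\<^sub>m 1)"
    by (rule mult_four_block_mat[OF car(1-4) one_carrier_mat zero_carrier_mat car(5) one_carrier_mat])
  also have "A * 1\<^sub>m n + c * k = S"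
    unfolding right_mult_one_mat[OF car(1)] by (rule eq_matI) (simp_all add: cs scalar_prod_def)
  also have "A * 0\<^sub>m n 1 + c * 1\<^sub>m 1 = c" using car by simp
  also have "r * 1\<^sub>m n + \<alpha> * k = 0\<^sub>m 1 n"
    unfolding right_mult_one_mat[OF car(3)] using assms
    by (intro eq_matI) (simp_all add: cs scalar_prod_def)
  also have "r * 0\<^sub>m n 1 + \<alpha> * 1\<^sub>m 1 = \<alpha>" using car by simp
  also have "det (four_block_mat S c (0\<^sub>m 1 n) \<alpha>) = det S * det \<alpha>"
    by (rule det_four_block_mat_lower_left_zero[OF car(6,2) refl car(4)])
  also have "det \<alpha> = a n n" by (simp add: \<alpha>_def det_single)
  finally show ?thesis by (simp add: S_def)
qed

text \<open>Coefficients and vectors are functions on the natural numbers here, so that splitting off the last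
of \<open>n + 1\<close> variables leaves the coefficients and the vector as they are.\<close>

definition quad_form :: "nat \<Rightarrow> (nat \<Rightarrow> nat \<Rightarrow> complex) \<Rightarrow> (nat \<Rightarrow> complex) \<Rightarrow> real" where
  "quad_form n a z = Re (\<Sum>i<n. \<Sum>j<n. cnj (z i) * a i j * z j)"

lemma quad_form_cong:
  "(\<And>i j. i < n \<Longrightarrow> j < n \<Longrightarrow> a i j = b i j) \<Longrightarrow> (\<And>i. i < n \<Longrightarrow> y i = z i) \<Longrightarrow> quad_form n a y = quad_form n b z"
  by (simp add: quad_form_def)

text \<open>The form of the Schur complement is what remains after completing the square in the last variable.\<close>

lemma complete_square_form:
  fixes z :: "nat \<Rightarrow> complex"
  assumes herm: "\<And>i. i < n \<Longrightarrow> a i n = cnj (a n i)" and \<alpha>: "a n n = complex_of_real \<alpha>" "\<alpha> \<noteq> 0"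
  defines "l \<equiv> \<Sum>j<n. a n j * z j"
  shows "quad_form (Suc n) a z =
    quad_form n (\<lambda>i j. a i j - a i n * a n j / a n n) z + (cmod l)\<^sup>2 / \<alpha>
      + \<alpha> * (cmod (z n))\<^sup>2 + 2 * Re (cnj (z n) * l)"
proof -
  have cl: "(\<Sum>i<n. cnj (z i) * a i n) = cnj l"
    unfolding l_def by (simp add: herm mult.commute)
  have "(\<Sum>i<n. \<Sum>j<n. cnj (z i) * (a i n * a n j / a n n) * z j)
      = (\<Sum>i<n. cnj (z i) * a i n) * (\<Sum>j<n. a n j * z j) / a n n"
    unfolding sum_product sum_divide_distrib by (intro sum.cong refl) (simp add: mult_ac)
  also have "\<dots> = complex_of_real ((cmod l)\<^sup>2 / \<alpha>)"
    unfolding cl l_def[symmetric] \<alpha> by (simp add: complex_norm_square mult.commute del: of_real_power)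
  finally have s: "(\<Sum>i<n. \<Sum>j<n. cnj (z i) * (a i n * a n j / a n n) * z j) = complex_of_real ((cmod l)\<^sup>2 / \<alpha>)" .
  have "quad_form (Suc n) a z = Re (\<Sum>i<n. \<Sum>j<n. cnj (z i) * a i j * z j)
      + Re ((\<Sum>i<n. cnj (z i) * a i n) * z n) + Re (cnj (z n) * l) + Re (a n n * (z n * cnj (z n)))"
    by (simp add: quad_form_def l_def sum.distrib sum_distrib_left sum_distrib_right mult_ac)
  also have "Re ((\<Sum>i<n. cnj (z i) * a i n) * z n) = Re (cnj (z n) * l)"
    unfolding cl by (simp add: algebra_simps)
  also have "Re (a n n * (z n * cnj (z n))) = \<alpha> * (cmod (z n))\<^sup>2"
    unfolding \<alpha>(1) complex_norm_square[symmetric] by simp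
  also have "Re (\<Sum>i<n. \<Sum>j<n. cnj (z i) * a i j * z j) =
      quad_form n (\<lambda>i j. a i j - a i n * a n j / a n n) z + (cmod l)\<^sup>2 / \<alpha>"
    using arg_cong[OF s, of Re] by (simp add: quad_form_def algebra_simps sum_subtractf)
  finally show ?thesis by simp
qed

text \<open>The factors enter through one integral formula only, so that the laws of the entries of the random
matrix can serve as factors directly, without being identified with one fixed Gaussian measure.\<close>

locale gaussian_coordinates = product_sigma_finite \<mu> for \<mu> :: "nat \<Rightarrow> complex measure" +
  assumes sets_\<mu>: "\<And>i. sets (\<mu> i) = sets borel"
    and exp_quadratic: "\<And>i a b. a > 0 \<Longrightarrow>
      (\<integral>\<^sup>+z. ennreal (exp ((1 - a) * (cmod z)\<^sup>2 + 2 * Re (cnj z * b))) \<partial>\<mu> i) = ennreal (exp ((cmod b)\<^sup>2 / a) / a)"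
begin

lemma measurable_form:
  "(\<lambda>z. ennreal (exp ((\<Sum>i<n. (cmod (z i))\<^sup>2) - quad_form n a z))) \<in> borel_measurable (Pi\<^sub>M {..<n} \<mu>)"
proof -
  have c: "(\<lambda>z. z i) \<in> borel_measurable (Pi\<^sub>M {..<n} \<mu>)" if "i \<in> {..<n}" for i
    using measurable_component_singleton[of i "{..<n}" \<mu>] that
    by (simp add: measurable_cong_sets[OF refl sets_\<mu>])
  have "(\<lambda>z. quad_form n a z) \<in> borel_measurable (Pi\<^sub>M {..<n} \<mu>)"
    unfolding quad_form_def using c
    by (intro measurable_compose[OF _ borel_measurable_continuous_onI[of Re]] borel_measurable_sum
        borel_measurable_times measurable_compose[OF c borel_measurable_continuous_onI[of cnj]])
      (auto intro!: continuous_intros)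
  moreover have "(\<lambda>z. (\<Sum>i<n. (cmod (z i))\<^sup>2)) \<in> borel_measurable (Pi\<^sub>M {..<n} \<mu>)"
    using c by (intro borel_measurable_sum) measurable
  ultimately show ?thesis by measurable
qed

text \<open>Induction on the dimension, integrating out the last coordinate. The integral over it contributes
the reciprocal of the last pivot and replaces the matrix by its Schur complement, which is again
positive definite and whose determinant is the determinant divided by the pivot.\<close>

lemma gaussian_form_integral:
  assumes herm: "\<And>i j. i < n \<Longrightarrow> j < n \<Longrightarrow> a i j = cnj (a j i)"
    and pos: "\<And>z. \<exists>i<n. z i \<noteq> 0 \<Longrightarrow> 0 < quad_form n a z"
  shows "\<exists>D>0. det (Matrix.mat n n (\<lambda>(i, j). a i j)) = complex_of_real D \<and>
    (\<integral>\<^sup>+z. ennreal (exp ((\<Sum>i<n. (cmod (z i))\<^sup>2) - quad_form n a z)) \<partial>Pi\<^sub>M {..<n} \<mu>) = ennreal (1 / D)"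
  using assms
proof (induction n arbitrary: a)
  case 0
  show ?case by (intro exI[of _ 1]) (simp add: quad_form_def PiM_empty nn_integral_count_space_finite)
next
  case (Suc n)
  note herm = Suc.prems(1) and pos = Suc.prems(2)
  define \<alpha> where "\<alpha> = Re (a n n)"
  have \<alpha>: "a n n = complex_of_real \<alpha>" using herm[of n n] by (simp add: \<alpha>_def complex_eq_iff)
  define e :: "nat \<Rightarrow> complex" where "e i = (if i = n then 1 else 0)" for i
  have e: "e n = 1" "e i = 0" if "i < n" for i using that by (auto simp: e_def)
  have "0 < quad_form (Suc n) a e" by (rule pos) (auto simp: e_def)
  also have "\<dots> = \<alpha>" by (simp add: quad_form_def \<alpha>_def e(2)) (simp add: e_def)
  finally have "\<alpha> > 0" .
  define b where "b i j = a i j - a i n * a n j / a n n" for i j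
  define l where "l z = (\<Sum>j<n. a n j * z j)" for z :: "nat \<Rightarrow> complex"
  have hn: "a i n = cnj (a n i)" if "i < n" for i using that by (intro herm) auto
  have split: "quad_form (Suc n) a z = quad_form n b z + (cmod (l z))\<^sup>2 / \<alpha> + \<alpha> * (cmod (z n))\<^sup>2 + 2 * Re (cnj (z n) * l z)" for z
    unfolding b_def l_def 
    by (rule complete_square_form[where n = n and a = a, OF _ \<alpha>]) (use hn \<open>\<alpha> > 0\<close> in simp_all)
  have "\<exists>D>0. det (Matrix.mat n n (\<lambda>(i, j). b i j)) = complex_of_real D \<and>
    (\<integral>\<^sup>+z. ennreal (exp ((\<Sum>i<n. (cmod (z i))\<^sup>2) - quad_form n b z)) \<partial>Pi\<^sub>M {..<n} \<mu>) = ennreal (1 / D)"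
  proof (rule Suc.IH)
    fix i j assume ij: "i < n" "j < n"
    then have h: "a i j = cnj (a j i)" "a i n = cnj (a n i)" "a n j = cnj (a j n)" by (intro herm; simp)+
    show "b i j = cnj (b j i)" unfolding b_def h(1) unfolding h(2,3) by (simp add: \<alpha> mult.commute)
  next
    fix z :: "nat \<Rightarrow> complex" assume z: "\<exists>i<n. z i \<noteq> 0"
    \<comment> \<open>The value of the last variable that minimises the form; what is left is the form of the complement.\<close>
    define z' where "z' = z(n := - l z / a n n)"
    have lz: "l z' = l z" by (simp add: l_def z'_def)
    have "0 < quad_form (Suc n) a z'" using z by (intro pos) (auto simp: z'_def)
    also have "\<dots> = quad_form n b z + (cmod (l z))\<^sup>2 / \<alpha> + \<alpha> * (cmod (l z / a n n))\<^sup>2 + 2 * Re (cnj (- l z / a n n) * l z)"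
      unfolding split lz using quad_form_cong[of n b b z' z] by (simp add: z'_def)
    also have "\<alpha> * (cmod (l z / a n n))\<^sup>2 = (cmod (l z))\<^sup>2 / \<alpha>"
      using \<open>\<alpha> > 0\<close> by (simp add: \<alpha> norm_divide power_divide power2_eq_square)
    also have "cnj (- l z / a n n) * l z = complex_of_real (- ((cmod (l z))\<^sup>2 / \<alpha>))"
      by (simp add: \<alpha> complex_norm_square mult.commute del: of_real_power)
    finally show "0 < quad_form n b z" by simp
  qed
  then obtain D where D: "D > 0" "det (Matrix.mat n n (\<lambda>(i, j). b i j)) = complex_of_real D"
    "(\<integral>\<^sup>+z. ennreal (exp ((\<Sum>i<n. (cmod (z i))\<^sup>2) - quad_form n b z)) \<partial>Pi\<^sub>M {..<n} \<mu>) = ennreal (1 / D)"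
    by blast
  have det: "det (Matrix.mat (Suc n) (Suc n) (\<lambda>(i, j). a i j)) = complex_of_real (\<alpha> * D)"
    using det_schur_complement[of a n] D(2) \<open>\<alpha> > 0\<close> by (simp add: b_def \<alpha>)
  let ?F = "\<lambda>n a z. ennreal (exp ((\<Sum>i<n. (cmod (z i))\<^sup>2) - quad_form n a z))"
  have inner: "(\<integral>\<^sup>+y. ?F (Suc n) a (x(n := y)) \<partial>\<mu> n) = ennreal (1 / \<alpha>) * ?F n b x" for x
  proof -
    have lx: "l (x(n := y)) = l x" for y by (simp add: l_def)
    have "?F (Suc n) a (x(n := y)) = ennreal (exp (- (cmod (l x))\<^sup>2 / \<alpha>)) * ?F n b x
        * ennreal (exp ((1 - \<alpha>) * (cmod y)\<^sup>2 + 2 * Re (cnj y * (- l x))))" for y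
    proof -
      have "(\<Sum>i<Suc n. (cmod ((x(n := y)) i))\<^sup>2) - quad_form (Suc n) a (x(n := y))
        = - (cmod (l x))\<^sup>2 / \<alpha> + ((\<Sum>i<n. (cmod (x i))\<^sup>2) - quad_form n b x)
          + ((1 - \<alpha>) * (cmod y)\<^sup>2 + 2 * Re (cnj y * (- l x)))"
        unfolding split lx using quad_form_cong[of n b b "x(n := y)" x] by (simp add: algebra_simps)
      then show ?thesis by (simp only: exp_add ennreal_mult exp_ge_zero mult_nonneg_nonneg)
    qed
    then have "(\<integral>\<^sup>+y. ?F (Suc n) a (x(n := y)) \<partial>\<mu> n) = ennreal (exp (- (cmod (l x))\<^sup>2 / \<alpha>)) * ?F n b x
        * (\<integral>\<^sup>+y. ennreal (exp ((1 - \<alpha>) * (cmod y)\<^sup>2 + 2 * Re (cnj y * (- l x)))) \<partial>\<mu> n)"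
      by (simp only:) (rule nn_integral_cmult, simp add: measurable_cong_sets[OF sets_\<mu> refl])
    also have "\<dots> = ennreal (exp (- (cmod (l x))\<^sup>2 / \<alpha>)) * ?F n b x * ennreal (exp ((cmod (l x))\<^sup>2 / \<alpha>) / \<alpha>)"
      using exp_quadratic[OF \<open>\<alpha> > 0\<close>, of n "- l x"] by simp
    also have "\<dots> = ennreal (exp (- (cmod (l x))\<^sup>2 / \<alpha>) * (exp ((cmod (l x))\<^sup>2 / \<alpha>) / \<alpha>)) * ?F n b x"
      using \<open>\<alpha> > 0\<close> by (subst ennreal_mult) (simp_all add: mult_ac)
    also have "exp (- (cmod (l x))\<^sup>2 / \<alpha>) * (exp ((cmod (l x))\<^sup>2 / \<alpha>) / \<alpha>) = 1 / \<alpha>"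
      by (simp add: exp_minus)
    finally show ?thesis .
  qed
  have "(\<integral>\<^sup>+z. ?F (Suc n) a z \<partial>Pi\<^sub>M (insert n {..<n}) \<mu>)
      = (\<integral>\<^sup>+x. (\<integral>\<^sup>+y. ?F (Suc n) a (x(n := y)) \<partial>\<mu> n) \<partial>Pi\<^sub>M {..<n} \<mu>)"
    by (rule product_nn_integral_insert) (use measurable_form[of "Suc n" a] in \<open>simp_all add: lessThan_Suc\<close>)
  also have "\<dots> = ennreal (1 / \<alpha>) * ennreal (1 / D)"
    unfolding inner using measurable_form[of n b] by (simp add: nn_integral_cmult D(3))
  also have "\<dots> = ennreal (1 / (\<alpha> * D))" using \<open>\<alpha> > 0\<close> D(1) by (simp add: ennreal_mult[symmetric])
  finally have "(\<integral>\<^sup>+z. ?F (Suc n) a z \<partial>Pi\<^sub>M {..<Suc n} \<mu>) = ennreal (1 / (\<alpha> * D))"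
    by (simp only: lessThan_Suc)
  then show ?case using det D(1) \<open>\<alpha> > 0\<close> by (intro exI[of _ "\<alpha> * D"]) simp
qed

end

lemma quad_form_eq_cscalar_prod:
  assumes "Q \<in> carrier_mat n n"
  shows "Re ((Q *\<^sub>v Matrix.vec n z) \<bullet>c Matrix.vec n z) = quad_form n (\<lambda>i j. Q $$ (i, j)) z"
proof -
  have "(Q *\<^sub>v Matrix.vec n z) \<bullet>c Matrix.vec n z = (\<Sum>i<n. (\<Sum>j<n. Q $$ (i, j) * z j) * cnj (z i))"
    using assms by (simp add: scalar_prod_def atLeast0LessThan)
  then show ?thesis by (simp add: quad_form_def sum_distrib_left sum_distrib_right mult_ac)
qed

lemma (in prob_space) borel_measurable_form:
  assumes z: "\<And>i. i < n \<Longrightarrow> z i \<in> borel_measurable M" and Q: "Q \<in> carrier_mat n n"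
  shows "(\<lambda>w. Re ((Q *\<^sub>v Matrix.vec n (\<lambda>i. z i w)) \<bullet>c Matrix.vec n (\<lambda>i. z i w))) \<in> borel_measurable M"
  unfolding quad_form_eq_cscalar_prod[OF Q] quad_form_def using z
  by (intro measurable_compose[OF _ borel_measurable_Re] borel_measurable_sum
      borel_measurable_times measurable_compose[OF z borel_measurable_continuous_onI[of cnj]])
    (auto intro!: continuous_intros)

text \<open>The exponent is \<open>\<parallel>z\<parallel>\<^sup>2\<close> minus the form of \<open>1 - Q\<close>, so the expectation is the reciprocal of a
determinant that is bounded from below through the eigenvalues of \<open>Q\<close>.\<close>

lemma (in prob_space) gaussian_form_mgf:
  assumes "n > 0" and gauss: "\<And>i. i < n \<Longrightarrow> std_complex_gaussian M (z i)"
    and ind: "indep_vars (\<lambda>_. borel) z {..<n}"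
    and Q: "Q \<in> carrier_mat n n" "mat_adjoint Q = Q"
    and s: "\<And>v. v \<in> carrier_vec n \<Longrightarrow> \<bar>Re ((Q *\<^sub>v v) \<bullet>c v)\<bar> \<le> 1 / 2 * norm_sq v"
  defines "X \<equiv> \<lambda>w. Re ((Q *\<^sub>v Matrix.vec n (\<lambda>i. z i w)) \<bullet>c Matrix.vec n (\<lambda>i. z i w))"
  shows "(\<integral>\<^sup>+w. ennreal (exp (X w)) \<partial>M) \<le> ennreal (exp (Re (trace_mat Q) + 2 * frob_sq Q))"
proof -
  \<comment> \<open>The locale wants a law for every index, so the family is continued beyond \<open>n\<close> by its first member.\<close>
  define y where "y i = (if i < n then z i else z 0)" for i
  have gy: "std_complex_gaussian M (y i)" for i using gauss \<open>n > 0\<close> by (simp add: y_def)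
  have zm: "z i \<in> borel_measurable M" if "i < n" for i
    using ind that by (auto simp: indep_vars_def)
  have ym: "y i \<in> borel_measurable M" for i using zm \<open>n > 0\<close> by (simp add: y_def)
  have iy: "indep_vars (\<lambda>_. borel) y {..<n}"
    using ind by (rule indep_vars_cong[THEN iffD1, rotated -1]) (auto simp: y_def)
  define \<mu> where "\<mu> i = distr M borel (y i)" for i
  interpret gaussian_coordinates \<mu>
  proof (intro gaussian_coordinates.intro product_sigma_finite.intro gaussian_coordinates_axioms.intro)
    show "sigma_finite_measure (\<mu> i)" for i
      unfolding \<mu>_def using ym prob_space_distr prob_space_imp_sigma_finite by blast
    show "sets (\<mu> i) = sets borel" for i by (simp add: \<mu>_def)
    fix i and a :: real and b :: complex assume "a > 0"
    have "(\<lambda>z. exp ((1 - a) * (cmod z)\<^sup>2 + 2 * Re (cnj z * b))) \<in> borel_measurable borel"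
      by (intro borel_measurable_continuous_onI continuous_intros)
    then show "(\<integral>\<^sup>+z. ennreal (exp ((1 - a) * (cmod z)\<^sup>2 + 2 * Re (cnj z * b))) \<partial>\<mu> i) = ennreal (exp ((cmod b)\<^sup>2 / a) / a)"
      unfolding \<mu>_def using complex_gaussian_exp_quadratic[OF gy \<open>a > 0\<close>] ym
      by (subst nn_integral_distr) auto
  qed
  define a where "a i j = (1\<^sub>m n - Q) $$ (i, j)" for i j
  have form_a: "quad_form n a u = (\<Sum>i<n. (cmod (u i))\<^sup>2) - quad_form n (\<lambda>i j. Q $$ (i, j)) u" for u
  proof -
    have "(\<Sum>i<n. \<Sum>j<n. cnj (u i) * a i j * u j)
      = (\<Sum>i<n. \<Sum>j<n. (if i = j then cnj (u i) * u j else 0)) - (\<Sum>i<n. \<Sum>j<n. cnj (u i) * Q $$ (i, j) * u j)"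
      unfolding sum_subtractf[symmetric] using Q(1)
      by (intro sum.cong refl) (simp add: a_def algebra_simps)
    also have "(\<Sum>i<n. \<Sum>j<n. (if i = j then cnj (u i) * u j else 0)) = complex_of_real (\<Sum>i<n. (cmod (u i))\<^sup>2)"
      by (simp add: mult.commute flip: complex_norm_square)
    finally show ?thesis by (simp add: quad_form_def)
  qed
  have sQ: "\<bar>quad_form n (\<lambda>i j. Q $$ (i, j)) u\<bar> \<le> 1 / 2 * (\<Sum>i<n. (cmod (u i))\<^sup>2)" for u
    using s[of "Matrix.vec n u"] quad_form_eq_cscalar_prod[OF Q(1), of u] by (simp add: norm_sq_def)
  have mat: "Matrix.mat n n (\<lambda>(i, j). a i j) = 1\<^sub>m n - Q"
    using Q(1) by (intro eq_matI) (simp_all add: a_def)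
  have "\<exists>D>0. det (Matrix.mat n n (\<lambda>(i, j). a i j)) = complex_of_real D \<and>
    (\<integral>\<^sup>+u. ennreal (exp ((\<Sum>i<n. (cmod (u i))\<^sup>2) - quad_form n a u)) \<partial>Pi\<^sub>M {..<n} \<mu>) = ennreal (1 / D)"
  proof (rule gaussian_form_integral)
    fix i j assume ij: "i < n" "j < n"
    have "mat_adjoint Q $$ (i, j) = cnj (Q $$ (j, i))" using Q(1) ij by simp
    then show "a i j = cnj (a j i)" unfolding Q(2) using Q(1) ij by (simp add: a_def)
  next
    fix u :: "nat \<Rightarrow> complex" assume "\<exists>i<n. u i \<noteq> 0"
    then obtain i where "i < n" "u i \<noteq> 0" by blast
    then have "0 < (\<Sum>i<n. (cmod (u i))\<^sup>2)" by (intro sum_pos2[of _ i]) auto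
    then show "0 < quad_form n a u" using sQ[of u] unfolding form_a by linarith
  qed
  then obtain D where D: "D > 0" "det (1\<^sub>m n - Q) = complex_of_real D"
    "(\<integral>\<^sup>+u. ennreal (exp ((\<Sum>i<n. (cmod (u i))\<^sup>2) - quad_form n a u)) \<partial>Pi\<^sub>M {..<n} \<mu>) = ennreal (1 / D)"
    unfolding mat by blast
  have X: "X w = (\<Sum>i<n. (cmod ((\<lambda>i\<in>{..<n}. y i w) i))\<^sup>2) - quad_form n a (\<lambda>i\<in>{..<n}. y i w)" for w
    unfolding X_def quad_form_eq_cscalar_prod[OF Q(1)] form_a
    by (simp add: y_def quad_form_def)
  have PiM: "distr M (Pi\<^sub>M {..<n} (\<lambda>_. borel)) (\<lambda>w. \<lambda>i\<in>{..<n}. y i w) = Pi\<^sub>M {..<n} \<mu>"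
    unfolding \<mu>_def using \<open>n > 0\<close> ym iy by (subst indep_vars_iff_distr_eq_PiM[symmetric]) auto
  have ymeas: "(\<lambda>w. \<lambda>i\<in>{..<n}. y i w) \<in> measurable M (Pi\<^sub>M {..<n} (\<lambda>_. borel))"
    using ym by (intro measurable_restrict) auto
  have setsPi: "sets (Pi\<^sub>M {..<n} \<mu>) = sets (Pi\<^sub>M {..<n} (\<lambda>_. borel))"
    by (intro sets_PiM_cong) (simp_all add: sets_\<mu>)
  have fm: "(\<lambda>u. ennreal (exp ((\<Sum>i<n. (cmod (u i))\<^sup>2) - quad_form n a u))) \<in> borel_measurable (Pi\<^sub>M {..<n} (\<lambda>_. borel))"
    using measurable_form[of n a] by (simp only: measurable_cong_sets[OF setsPi refl])
  have "(\<integral>\<^sup>+w. ennreal (exp (X w)) \<partial>M) = ennreal (1 / D)"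
    unfolding X D(3)[symmetric] PiM[symmetric] 
    by (subst nn_integral_distr[OF ymeas]) (use fm in simp_all)
  also have "1 / D \<le> exp (Re (trace_mat Q) + 2 * frob_sq Q)"
  proof -
    have "exp (- Re (trace_mat Q) - 2 * frob_sq Q) \<le> D"
      using det_one_minus_ge(2)[OF Q s] D(2) by simp
    then have "1 / D \<le> 1 / exp (- Re (trace_mat Q) - 2 * frob_sq Q)"
      by (intro divide_left_mono) (use D(1) in auto)
    also have "\<dots> = exp (Re (trace_mat Q) + 2 * frob_sq Q)" by (simp add: exp_minus[symmetric] inverse_eq_divide[symmetric])
    finally show ?thesis .
  qed
  finally show "(\<integral>\<^sup>+w. ennreal (exp (X w)) \<partial>M) \<le> ennreal (exp (Re (trace_mat Q) + 2 * frob_sq Q))"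
    by (simp add: ennreal_leI)
qed

text \<open>Markov's inequality for \<open>exp (t X)\<close>. The parameter \<open>s\<close> bounds the operator norm of \<open>Q\<close> and limits \<open>t\<close>, while \<open>F\<close>
bounds the squared Frobenius norm and acts as the variance.\<close>

lemma (in prob_space) gaussian_form_tail:
  assumes "n > 0" and gauss: "\<And>i. i < n \<Longrightarrow> std_complex_gaussian M (z i)"
    and ind: "indep_vars (\<lambda>_. borel) z {..<n}"
    and Q: "Q \<in> carrier_mat n n" "mat_adjoint Q = Q"
    and s: "\<And>v. v \<in> carrier_vec n \<Longrightarrow> \<bar>Re ((Q *\<^sub>v v) \<bullet>c v)\<bar> \<le> s * norm_sq v"
    and F: "frob_sq Q \<le> F" and t: "0 \<le> t" "t * s \<le> 1 / 2"
  defines "X \<equiv> \<lambda>w. Re ((Q *\<^sub>v Matrix.vec n (\<lambda>i. z i w)) \<bullet>c Matrix.vec n (\<lambda>i. z i w))"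
  shows "prob {w \<in> space M. X w - Re (trace_mat Q) \<ge> x} \<le> exp (- t * x + 2 * t\<^sup>2 * F)"
proof -
  have smult: "Re ((complex_of_real r \<cdot>\<^sub>m Q *\<^sub>v v) \<bullet>c v) = r * Re ((Q *\<^sub>v v) \<bullet>c v)" if "v \<in> carrier_vec n" for r v
  proof -
    have "complex_of_real r \<cdot>\<^sub>m Q *\<^sub>v v = complex_of_real r \<cdot>\<^sub>v (Q *\<^sub>v v)"
      using Q(1) that by (intro eq_vecI) (auto simp: scalar_prod_def sum_distrib_left mult_ac)
    then show ?thesis
      using Q(1) that by (simp add: smult_scalar_prod_distrib[of _ n])
  qed
  have tQ: "complex_of_real r \<cdot>\<^sub>m Q \<in> carrier_mat n n"
    "trace_mat (complex_of_real r \<cdot>\<^sub>m Q) = complex_of_real r * trace_mat Q" "frob_sq (complex_of_real r \<cdot>\<^sub>m Q) = r\<^sup>2 * frob_sq Q" for r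
    using Q by (simp_all add: trace_mat_def frob_sq_def sum_distrib_left norm_mult power_mult_distrib)
  have tQ_adj: "mat_adjoint (complex_of_real r \<cdot>\<^sub>m Q) = complex_of_real r \<cdot>\<^sub>m Q" for r
  proof (rule eq_matI)
    fix i j assume "i < dim_row (complex_of_real r \<cdot>\<^sub>m Q)" "j < dim_col (complex_of_real r \<cdot>\<^sub>m Q)"
    then show "mat_adjoint (complex_of_real r \<cdot>\<^sub>m Q) $$ (i, j) = (complex_of_real r \<cdot>\<^sub>m Q) $$ (i, j)"
      using Q(1) arg_cong[OF Q(2), of "\<lambda>A. A $$ (i, j)"] by simp
  qed (use Q in simp_all)
  have bound: "\<bar>Re ((complex_of_real t \<cdot>\<^sub>m Q *\<^sub>v v) \<bullet>c v)\<bar> \<le> 1 / 2 * norm_sq v" if v: "v \<in> carrier_vec n" for v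
  proof -
    have "\<bar>Re ((complex_of_real t \<cdot>\<^sub>m Q *\<^sub>v v) \<bullet>c v)\<bar> = t * \<bar>Re ((Q *\<^sub>v v) \<bullet>c v)\<bar>"
      unfolding smult[OF v] using t by (simp add: abs_mult)
    also have "\<dots> \<le> t * (s * norm_sq v)" using s[OF v] t by (intro mult_left_mono)
    also have "\<dots> \<le> 1 / 2 * norm_sq v" using mult_right_mono[OF t(2), of "norm_sq v"] by (simp add: mult_ac)
    finally show ?thesis .
  qed
  have Xm: "X \<in> borel_measurable M"
    unfolding X_def using ind by (intro borel_measurable_form Q(1)) (auto simp: indep_vars_def)
  have "emeasure M {w \<in> space M. X w - Re (trace_mat Q) \<ge> x}
      \<le> emeasure M {w \<in> space M. 1 \<le> ennreal (exp (- t * (Re (trace_mat Q) + x))) * ennreal (exp (t * X w))}"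
  proof (rule emeasure_mono)
    show "{w \<in> space M. X w - Re (trace_mat Q) \<ge> x}
      \<subseteq> {w \<in> space M. 1 \<le> ennreal (exp (- t * (Re (trace_mat Q) + x))) * ennreal (exp (t * X w))}"
    proof (intro Collect_mono impI conjI; elim conjE)
      fix w assume "x \<le> X w - Re (trace_mat Q)"
      then have "0 \<le> - t * (Re (trace_mat Q) + x) + t * X w"
        using t(1) mult_left_mono[of "Re (trace_mat Q) + x" "X w" t] by simp
      then have "1 \<le> exp (- t * (Re (trace_mat Q) + x)) * exp (t * X w)"
        by (simp only: exp_add[symmetric] one_le_exp_iff)
      then show "1 \<le> ennreal (exp (- t * (Re (trace_mat Q) + x))) * ennreal (exp (t * X w))"
        by (subst ennreal_mult[symmetric]) auto
    qed
  qed (use Xm in measurable)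
  also have "\<dots> \<le> ennreal (exp (- t * (Re (trace_mat Q) + x))) * (\<integral>\<^sup>+w. ennreal (exp (t * X w)) * indicator (space M) w \<partial>M)"
    by (rule nn_integral_Markov_inequality) (use Xm in measurable)
  also have "(\<integral>\<^sup>+w. ennreal (exp (t * X w)) * indicator (space M) w \<partial>M) = (\<integral>\<^sup>+w. ennreal (exp (t * X w)) \<partial>M)"
    by (intro nn_integral_cong) auto
  also have "\<dots> \<le> ennreal (exp (t * Re (trace_mat Q) + 2 * (t\<^sup>2 * F)))"
  proof -
    have "(\<integral>\<^sup>+w. ennreal (exp (t * X w)) \<partial>M) \<le> ennreal (exp (t * Re (trace_mat Q) + 2 * (t\<^sup>2 * frob_sq Q)))"
      using gaussian_form_mgf[OF \<open>n > 0\<close> gauss ind tQ(1) tQ_adj bound]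
      unfolding X_def smult[OF vec_carrier] tQ(2,3) by simp
    also have "\<dots> \<le> ennreal (exp (t * Re (trace_mat Q) + 2 * (t\<^sup>2 * F)))"
      using F by (intro ennreal_leI) (simp add: mult_left_mono)
    finally show ?thesis .
  qed
  also have "ennreal (exp (- t * (Re (trace_mat Q) + x))) * ennreal (exp (t * Re (trace_mat Q) + 2 * (t\<^sup>2 * F)))
      = ennreal (exp (- t * x + 2 * t\<^sup>2 * F))"
    by (simp add: ennreal_mult[symmetric] exp_add[symmetric] algebra_simps)
  finally show "prob {w \<in> space M. X w - Re (trace_mat Q) \<ge> x} \<le> exp (- t * x + 2 * t\<^sup>2 * F)"
    by (simp add: emeasure_eq_measure mult_left_mono)
qed

section \<open>Toeplitz matrices as integrals of their spectral density\<close>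

definition trig_poly :: "complex Matrix.vec \<Rightarrow> real \<Rightarrow> complex" where
  "trig_poly v x = (\<Sum>j<dim_vec v. vec_index v j * exp (\<i> * of_nat j * of_real x))"

lemma set_integrable_mult_bounded:
  fixes g :: "real \<Rightarrow> real" and h :: "real \<Rightarrow> complex"
  assumes g: "set_integrable lebesgue S g" and h: "h \<in> borel_measurable lebesgue" "\<And>x. norm (h x) \<le> B"
  shows "set_integrable lebesgue S (\<lambda>x. complex_of_real (g x) * h x)"
  unfolding set_integrable_def
proof (rule Bochner_Integration.integrable_bound)
  show "integrable lebesgue (\<lambda>x. B * (indicator S x *\<^sub>R g x))"
    using g by (simp add: set_integrable_def)
  have "(\<lambda>x. indicator S x *\<^sub>R g x) \<in> borel_measurable lebesgue"
    using g by (simp add: set_integrable_def borel_measurable_integrable)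
  then have "(\<lambda>x. complex_of_real (indicator S x *\<^sub>R g x) * h x) \<in> borel_measurable lebesgue"
    using h(1) by measurable
  then show "(\<lambda>x. indicator S x *\<^sub>R (complex_of_real (g x) * h x)) \<in> borel_measurable lebesgue"
    by (simp add: scaleR_conv_of_real mult.assoc)
  have "B \<ge> 0" using h(2)[of 0] norm_ge_zero[of "h 0"] by linarith
  have "norm (indicator S x *\<^sub>R (complex_of_real (g x) * h x)) \<le> norm (B * (indicator S x *\<^sub>R g x))" for x
    using mult_mono[OF h(2) order_refl, of "\<bar>g x\<bar>" x] \<open>B \<ge> 0\<close> by (simp add: norm_mult abs_mult indicator_def mult.commute)
  then show "AE x in lebesgue. norm (indicator S x *\<^sub>R (complex_of_real (g x) * h x)) \<le> norm (B * (indicator S x *\<^sub>R g x))"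
    by simp
qed

lemma borel_measurable_lebesgue_continuous:
  "continuous_on UNIV h \<Longrightarrow> h \<in> borel_measurable lebesgue"
  by (intro measurable_completion) (simp add: borel_measurable_continuous_onI)

lemma set_integrable_fourier:
  assumes "set_integrable lebesgue {-pi..pi} f"
  shows "set_integrable lebesgue {-pi..pi} (\<lambda>x. complex_of_real (f x) * exp (- (\<i> * of_int k * of_real x)))"
  by (rule set_integrable_mult_bounded[where B = 1, OF assms])
    (auto intro!: borel_measurable_lebesgue_continuous continuous_intros)

lemma fourier_coeff_minus: "fourier_coeff f (- k) = cnj (fourier_coeff f k)"
proof -
  have "indicator {-pi..pi} x *\<^sub>R (complex_of_real (f x) * exp (- (\<i> * of_int (- k) * of_real x)))
      = cnj (indicator {-pi..pi} x *\<^sub>R (complex_of_real (f x) * exp (- (\<i> * of_int k * of_real x))))" for x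
    by (simp add: exp_cnj)
  then show ?thesis
    by (simp only: fourier_coeff_def set_lebesgue_integral_def Bochner_Integration.integral_cnj) simp
qed

lemma toeplitz_carrier [simp]: "toeplitz m r \<in> carrier_mat m m"
  by (simp add: toeplitz_def)

lemma toeplitz_fourier_hermitian: "mat_adjoint (toeplitz m (fourier_coeff f)) = toeplitz m (fourier_coeff f)"
  by (intro eq_matI) (simp_all add: toeplitz_def flip: fourier_coeff_minus)

text \<open>Expanded with frequencies \<open>i - j\<close>, which is the form in which Fourier coefficients enter the entries
of a Toeplitz matrix.\<close>

lemma norm_trig_poly_sq:
  "complex_of_real ((cmod (trig_poly v x))\<^sup>2) = (\<Sum>i<dim_vec v. \<Sum>j<dim_vec v.
     exp (- (\<i> * of_int (int i - int j) * of_real x)) * vec_index v j * cnj (vec_index v i))"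
proof -
  have e: "exp (- (\<i> * of_int (int i - int j) * of_real x)) = exp (- (\<i> * of_nat i * of_real x)) * exp (\<i> * of_nat j * of_real x)" for i j
    by (simp add: exp_add[symmetric] algebra_simps)
  have "complex_of_real ((cmod (trig_poly v x))\<^sup>2) = cnj (trig_poly v x) * trig_poly v x"
    by (subst mult.commute) (rule complex_norm_square)
  also have "\<dots> = (\<Sum>i<dim_vec v. \<Sum>j<dim_vec v.
      exp (- (\<i> * of_nat i * of_real x)) * exp (\<i> * of_nat j * of_real x) * vec_index v j * cnj (vec_index v i))"
    unfolding trig_poly_def cnj_sum sum_product
    by (intro sum.cong refl) (simp add: exp_cnj mult_ac)
  finally show ?thesis unfolding e .
qed

lemma toeplitz_fourier_form:
  assumes f: "set_integrable lebesgue {-pi..pi} f" and v: "v \<in> carrier_vec m"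
  shows "set_integrable lebesgue {-pi..pi} (\<lambda>x. f x * (cmod (trig_poly v x))\<^sup>2)"
    and "Re ((toeplitz m (fourier_coeff f) *\<^sub>v v) \<bullet>c v)
      = (LINT x:{-pi..pi}|lebesgue. f x * (cmod (trig_poly v x))\<^sup>2) / (2 * pi)"
proof -
  define F where "F i j x = complex_of_real (f x) * exp (- (\<i> * of_int (int i - int j) * of_real x))" for i j :: nat and x :: real
  have F: "set_integrable lebesgue {-pi..pi} (F i j)" for i j
    unfolding F_def by (rule set_integrable_fourier[OF f])
  have Fv: "set_integrable lebesgue {-pi..pi} (\<lambda>x. F i j x * vec_index v j * cnj (vec_index v i))" for i j
    using F[of i j] by (intro set_integrable_mult_left) auto
  have sum_int: "set_integrable lebesgue {-pi..pi} (\<lambda>x. \<Sum>i<m. \<Sum>j<m. F i j x * vec_index v j * cnj (vec_index v i))"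
    using Fv unfolding set_integrable_def scaleR_sum_right by (intro Bochner_Integration.integrable_sum)
  have pt: "complex_of_real (f x * (cmod (trig_poly v x))\<^sup>2) = (\<Sum>i<m. \<Sum>j<m. F i j x * vec_index v j * cnj (vec_index v i))" for x
    using v unfolding of_real_mult norm_trig_poly_sq by (simp add: F_def sum_distrib_left mult.assoc)
  have "integrable lebesgue (\<lambda>x. complex_of_real (indicator {-pi..pi} x *\<^sub>R (f x * (cmod (trig_poly v x))\<^sup>2)))"
    using sum_int unfolding pt[symmetric] set_integrable_def by (simp add: scaleR_conv_of_real)
  then show "set_integrable lebesgue {-pi..pi} (\<lambda>x. f x * (cmod (trig_poly v x))\<^sup>2)"
    unfolding set_integrable_def by (simp only: complex_of_real_integrable_eq)
  have "(toeplitz m (fourier_coeff f) *\<^sub>v v) \<bullet>c v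
     = (\<Sum>i<m. \<Sum>j<m. fourier_coeff f (int i - int j) * vec_index v j * cnj (vec_index v i))"
    using v by (simp add: toeplitz_def scalar_prod_def atLeast0LessThan sum_distrib_right)
  also have "\<dots> = (\<Sum>i<m. \<Sum>j<m. LINT x:{-pi..pi}|lebesgue. F i j x * vec_index v j * cnj (vec_index v i)) / complex_of_real (2 * pi)"
    by (simp add: fourier_coeff_def F_def sum_divide_distrib set_integral_mult_left)
  also have "(\<Sum>i<m. \<Sum>j<m. LINT x:{-pi..pi}|lebesgue. F i j x * vec_index v j * cnj (vec_index v i))
     = (LINT x:{-pi..pi}|lebesgue. \<Sum>i<m. \<Sum>j<m. F i j x * vec_index v j * cnj (vec_index v i))"
    unfolding set_lebesgue_integral_def scaleR_sum_right
    by (simp only: Bochner_Integration.integral_sum Bochner_Integration.integrable_sum Fv[unfolded set_integrable_def])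
  also have "\<dots> = complex_of_real (LINT x:{-pi..pi}|lebesgue. f x * (cmod (trig_poly v x))\<^sup>2)"
    unfolding pt[symmetric] by (rule set_integral_complex_of_real)
  finally show "Re ((toeplitz m (fourier_coeff f) *\<^sub>v v) \<bullet>c v)
      = (LINT x:{-pi..pi}|lebesgue. f x * (cmod (trig_poly v x))\<^sup>2) / (2 * pi)"
    by (simp only: of_real_divide[symmetric] Re_complex_of_real)
qed

lemma integral_exp_period:
  fixes k :: int
  shows "(LINT x:{-pi..pi}|lebesgue. exp (- (\<i> * of_int k * of_real x))) = (if k = 0 then 2 * of_real pi else 0)"
proof (cases "k = 0")
  case True
  have "set_integrable lebesgue {-pi..pi} (\<lambda>x. 1 :: complex)"
    by (rule absolutely_integrable_continuous_real) simp
  from set_lebesgue_integral_eq_integral(2)[OF this] show ?thesis using True by (simp add: scaleR_conv_of_real)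
next
  case False
  define F where "F x = exp (- (\<i> * of_int k * of_real x)) / (- (\<i> * of_int k))" for x :: real
  have "((\<lambda>x. exp (- (\<i> * of_int k * of_real x))) has_integral (F pi - F (- pi))) {-pi..pi}"
  proof (rule fundamental_theorem_of_calculus)
    fix x :: real
    have "((\<lambda>z. exp (- (\<i> * of_int k * z)) / (- (\<i> * of_int k))) has_field_derivative exp (- (\<i> * of_int k * of_real x))) (at (of_real x))"
      using False by (auto intro!: derivative_eq_intros)
    from has_vector_derivative_real_field[OF this]
    show "(F has_vector_derivative exp (- (\<i> * of_int k * of_real x))) (at x within {-pi..pi})"
      unfolding F_def by (rule has_vector_derivative_at_within)
  qed simp
  moreover have "F pi = F (- pi)"
  proof -
    have "exp (- (\<i> * of_int k * of_real pi) + \<i> * (of_int k * (of_real pi * 2))) = exp (- (\<i> * of_int k * of_real pi))"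
      by (rule exp_plus_2pin)
    moreover have "- (\<i> * of_int k * of_real pi) + \<i> * (of_int k * (of_real pi * 2)) = - (\<i> * of_int k * of_real (- pi))"
      by (simp add: algebra_simps)
    ultimately show ?thesis by (simp only: F_def)
  qed
  moreover have "set_integrable lebesgue {-pi..pi} (\<lambda>x. exp (- (\<i> * of_int k * of_real x)))"
    by (rule absolutely_integrable_continuous_real) (intro continuous_intros)
  ultimately show ?thesis
    using set_lebesgue_integral_eq_integral(2) False by (metis (no_types, lifting) diff_self integral_unique)
qed

text \<open>Parseval's identity is the Toeplitz form of the constant density, whose Toeplitz matrix is the
identity.\<close>

lemma parseval_trig_poly:
  assumes v: "v \<in> carrier_vec m"
  shows "set_integrable lebesgue {-pi..pi} (\<lambda>x. (cmod (trig_poly v x))\<^sup>2)"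
    and "(LINT x:{-pi..pi}|lebesgue. (cmod (trig_poly v x))\<^sup>2) = 2 * pi * norm_sq v"
proof -
  have one: "set_integrable lebesgue {-pi..pi} (\<lambda>x. 1 :: real)"
    by (rule absolutely_integrable_continuous_real) simp
  have "fourier_coeff (\<lambda>_. 1) k = (if k = 0 then 1 else 0)" for k
    using integral_exp_period[of k] by (simp add: fourier_coeff_def)
  then have "toeplitz m (fourier_coeff (\<lambda>_. 1)) = 1\<^sub>m m"
    by (intro eq_matI) (auto simp: toeplitz_def)
  then have "norm_sq v = (LINT x:{-pi..pi}|lebesgue. (cmod (trig_poly v x))\<^sup>2) / (2 * pi)"
    using toeplitz_fourier_form(2)[OF one v] v by (simp add: cscalar_prod_self)
  then show "(LINT x:{-pi..pi}|lebesgue. (cmod (trig_poly v x))\<^sup>2) = 2 * pi * norm_sq v"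
    by simp
  show "set_integrable lebesgue {-pi..pi} (\<lambda>x. (cmod (trig_poly v x))\<^sup>2)"
    using toeplitz_fourier_form(1)[OF one v] by simp
qed

lemma norm_sum_sq_le:
  fixes g :: "nat \<Rightarrow> complex"
  shows "(cmod (\<Sum>j<m. g j))\<^sup>2 \<le> real m * (\<Sum>j<m. (cmod (g j))\<^sup>2)"
proof -
  have "(cmod (\<Sum>j<m. g j))\<^sup>2 \<le> (\<Sum>j<m. cmod (g j))\<^sup>2"
    by (intro power_mono norm_sum) simp
  also have "\<dots> \<le> (\<Sum>j<m. (cmod (g j))\<^sup>2) * (\<Sum>j<m. 1\<^sup>2)"
    using Cauchy_Schwarz_ineq_sum[of "\<lambda>j. cmod (g j)" "\<lambda>_. 1" "{..<m}"] by simp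
  finally show ?thesis by (simp add: mult.commute)
qed

lemma trig_poly_sq_le: "(cmod (trig_poly v x))\<^sup>2 \<le> real (dim_vec v) * norm_sq v"
  unfolding trig_poly_def norm_sq_def
  by (rule order_trans[OF norm_sum_sq_le]) (simp add: norm_mult)

lemma integral_abs_powr:
  fixes b h :: real
  assumes b: "b < 1" and h: "h > 0"
  shows "set_integrable lebesgue {-h..h} (\<lambda>x. \<bar>x\<bar> powr - b)"
    and "(LINT x:{-h..h}|lebesgue. \<bar>x\<bar> powr - b) = 2 * h powr (1 - b) / (1 - b)"
proof -
  have pos: "((\<lambda>x. \<bar>x\<bar> powr - b) has_integral h powr (- b + 1) / (- b + 1)) {0..h}"
    using has_integral_powr_from_0[of "- b" h] b h
    by (subst has_integral_cong[where g = "\<lambda>x. x powr - b"]) auto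
  then have neg: "((\<lambda>x. \<bar>x\<bar> powr - b) has_integral h powr (- b + 1) / (- b + 1)) {-h..0}"
    using has_integral_reflect_real[of "\<lambda>x. \<bar>x\<bar> powr - b" _ h 0] h by simp
  have tot: "((\<lambda>x. \<bar>x\<bar> powr - b) has_integral 2 * h powr (1 - b) / (1 - b)) {-h..h}"
    using has_integral_combine[OF _ _ neg pos] h by (simp add: field_simps)
  then have abs: "(\<lambda>x. \<bar>x\<bar> powr - b) absolutely_integrable_on {-h..h}"
    by (intro nonnegative_absolutely_integrable_1) auto
  then show "set_integrable lebesgue {-h..h} (\<lambda>x. \<bar>x\<bar> powr - b)" .
  show "(LINT x:{-h..h}|lebesgue. \<bar>x\<bar> powr - b) = 2 * h powr (1 - b) / (1 - b)"
    using set_lebesgue_integral_eq_integral(2)[OF abs] integral_unique[OF tot] by simp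
qed

lemma toeplitz_fourier_psd:
  assumes f: "set_integrable lebesgue {-pi..pi} f" and pos: "\<And>x. x \<in> {-pi..pi} - {0} \<Longrightarrow> 0 < f x"
  shows "psd_hermitian m (toeplitz m (fourier_coeff f))"
proof -
  have "0 \<le> Re ((toeplitz m (fourier_coeff f) *\<^sub>v v) \<bullet>c v)" if v: "v \<in> carrier_vec m" for v
  proof -
    have "AE x in lebesgue. x \<noteq> (0 :: real)" using AE_lborel_singleton by (rule AE_completion)
    then have "AE x in lebesgue. 0 \<le> indicator {-pi..pi} x *\<^sub>R (f x * (cmod (trig_poly v x))\<^sup>2)"
    proof eventually_elim
      case (elim x)
      then have "x \<in> {-pi..pi} \<Longrightarrow> 0 \<le> f x" using pos[of x] by simp
      then show ?case by (simp add: indicator_def)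
    qed
    then have "0 \<le> (LINT x:{-pi..pi}|lebesgue. f x * (cmod (trig_poly v x))\<^sup>2)"
      unfolding set_lebesgue_integral_def by (rule integral_nonneg_AE)
    then show ?thesis using toeplitz_fourier_form(2)[OF f v] by simp
  qed
  then show ?thesis by (simp add: psd_hermitian_def toeplitz_fourier_hermitian)
qed

text \<open>Outside the window \<open>\<bar>x\<bar> \<le> 1 / m\<close> the density is at most \<open>G\<close> and Parseval's identity gives \<open>G \<parallel>v\<parallel>\<^sup>2\<close>.
Inside, \<open>\<bar>p\<bar>\<^sup>2 \<le> m \<parallel>v\<parallel>\<^sup>2\<close> compensates the length of the window, and the singularity is integrable
because \<open>b < 1\<close>.\<close>

lemma toeplitz_fourier_form_le:
  assumes f: "set_integrable lebesgue {-pi..pi} f" and m: "m \<ge> 1" and b: "b < 1" and G: "G \<ge> 0"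
    and outer: "\<And>x. x \<in> {-pi..pi} \<Longrightarrow> 1 / real m < \<bar>x\<bar> \<Longrightarrow> f x \<le> G"
    and inner: "\<And>x. x \<noteq> 0 \<Longrightarrow> \<bar>x\<bar> \<le> 1 / real m \<Longrightarrow> f x \<le> G * (real m * \<bar>x\<bar>) powr - b"
    and v: "v \<in> carrier_vec m"
  shows "Re ((toeplitz m (fourier_coeff f) *\<^sub>v v) \<bullet>c v) \<le> G * (1 + 1 / (1 - b)) * norm_sq v"
proof -
  define h where "h = 1 / real m"
  have h: "h > 0" "h \<le> 1" using m by (auto simp: h_def)
  define p where "p x = (cmod (trig_poly v x))\<^sup>2" for x
  have p: "0 \<le> p x" "p x \<le> real m * norm_sq v" for x
    using trig_poly_sq_le[of v x] v by (auto simp: p_def)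
  define c where "c = G * real m * norm_sq v * real m powr - b"
  have c: "c \<ge> 0" using G by (simp add: c_def)
  note ap = integral_abs_powr[OF b h(1)]
  have i1: "integrable lebesgue (\<lambda>x. G * (indicator {-pi..pi} x *\<^sub>R p x))"
    using parseval_trig_poly(1)[OF v] by (simp add: set_integrable_def p_def)
  have i2: "integrable lebesgue (\<lambda>x. c * (indicator {-h..h} x *\<^sub>R \<bar>x\<bar> powr - b))"
    using ap(1) by (simp add: set_integrable_def)
  have "(LINT x:{-pi..pi}|lebesgue. f x * p x)
      \<le> (LINT x|lebesgue. G * (indicator {-pi..pi} x *\<^sub>R p x) + c * (indicator {-h..h} x *\<^sub>R \<bar>x\<bar> powr - b))"
    unfolding set_lebesgue_integral_def
  proof (rule integral_mono_AE)
    show "integrable lebesgue (\<lambda>x. indicator {-pi..pi} x *\<^sub>R (f x * p x))"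
      using toeplitz_fourier_form(1)[OF f v] by (simp add: set_integrable_def p_def)
    show "integrable lebesgue (\<lambda>x. G * (indicator {-pi..pi} x *\<^sub>R p x) + c * (indicator {-h..h} x *\<^sub>R \<bar>x\<bar> powr - b))"
      using i1 i2 by simp
    \<comment> \<open>Nothing is known about the density at the origin.\<close>
    have "AE x in lebesgue. x \<noteq> (0 :: real)" using AE_lborel_singleton by (rule AE_completion)
    then show "AE x in lebesgue. indicator {-pi..pi} x *\<^sub>R (f x * p x)
        \<le> G * (indicator {-pi..pi} x *\<^sub>R p x) + c * (indicator {-h..h} x *\<^sub>R \<bar>x\<bar> powr - b)"
    proof eventually_elim
      case (elim x)
      show ?case
      proof (cases "x \<in> {-pi..pi}")
        case False
        then have "indicator {-pi..pi} x = (0 :: real)" by (rule indicator_simps(2))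
        then show ?thesis using c by simp
      next
        case True
        show ?thesis
        proof (cases "\<bar>x\<bar> \<le> h")
          case False
          then have "x \<notin> {-h..h}" by auto
          then have ind: "indicator {-h..h} x = (0 :: real)" by (rule indicator_simps(2))
          have "f x \<le> G" using outer True False by (simp add: h_def)
          then have "f x * p x \<le> G * p x" using p(1) by (rule mult_right_mono)
          then show ?thesis using True ind by simp
        next
          case small: True
          then have "f x \<le> G * (real m * \<bar>x\<bar>) powr - b" using inner elim by (simp add: h_def)
          then have "f x * p x \<le> G * (real m * \<bar>x\<bar>) powr - b * p x" using p(1) by (rule mult_right_mono)
          also have "\<dots> \<le> G * (real m * \<bar>x\<bar>) powr - b * (real m * norm_sq v)"
            using p(2) G by (intro mult_left_mono) auto
          also have "\<dots> = c * \<bar>x\<bar> powr - b" by (simp add: c_def powr_mult mult_ac)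
          finally have "f x * p x \<le> c * \<bar>x\<bar> powr - b" .
          moreover have "0 \<le> G * p x" using G p(1) by simp
          moreover have "x \<in> {-h..h}" using small by auto
          ultimately show ?thesis using True by (simp only: indicator_simps(1)) simp
        qed
      qed
    qed
  qed
  also have "\<dots> = G * (2 * pi * norm_sq v) + c * (2 * h powr (1 - b) / (1 - b))"
    using i1 i2 ap(2) parseval_trig_poly(2)[OF v] by (simp add: set_lebesgue_integral_def p_def)
  also have "c * (2 * h powr (1 - b) / (1 - b)) = G * norm_sq v * (2 / (1 - b))"
  proof -
    have "h powr (1 - b) = real m powr (b - 1)" using m by (simp add: h_def powr_divide powr_minus_divide[symmetric])
    moreover have "real m * real m powr - b * real m powr (b - 1) = 1"
      using m by (simp add: powr_add[symmetric] powr_mult_base)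
    ultimately show ?thesis by (simp add: c_def)
  qed
  finally have "Re ((toeplitz m (fourier_coeff f) *\<^sub>v v) \<bullet>c v) \<le> (G * (2 * pi * norm_sq v) + G * norm_sq v * (2 / (1 - b))) / (2 * pi)"
    unfolding toeplitz_fourier_form(2)[OF f v] p_def by (intro divide_right_mono) auto
  also have "\<dots> = G * norm_sq v + G * norm_sq v * (1 / (1 - b)) * (1 / pi)"
  proof -
    have "(G * (2 * pi * N) + G * N * (2 * k)) / (2 * pi) = G * N + G * N * k * (1 / pi)" for N k :: real
      by (simp add: field_simps)
    from this[of "norm_sq v" "1 / (1 - b)"] show ?thesis by simp
  qed
  also have "\<dots> \<le> G * norm_sq v + G * norm_sq v * (1 / (1 - b)) * 1"
    using G b pi_gt3 by (intro add_left_mono mult_left_mono) auto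
  finally show ?thesis by (simp add: algebra_simps)
qed

text \<open>With \<open>s = 1 / \<bar>x\<bar>\<close>, the density is \<open>s\<^sup>a L(s)\<close>. Potter's bounds with exponent \<open>a\<close> compare it with
\<open>m\<^sup>a L(m)\<close>: for \<open>s \<le> m\<close> the loss \<open>(m / s)\<^sup>a\<close> is cancelled by the growth of \<open>s\<^sup>a\<close>, and for
\<open>s \<ge> m\<close> one gets the factor \<open>(s / m)\<^sup>2\<^sup>a\<close>, which is integrable as \<open>2 a < 1\<close>. The bounded range of
\<open>s\<close> where Potter's bounds do not apply is harmless, since \<open>m\<^sup>a L(m) \<rightarrow> \<infinity>\<close>.\<close>

lemma toeplitz_power_law_form_le:
  assumes f: "set_integrable lebesgue {-pi..pi} f"
    and f_bounded: "\<And>\<delta>. \<delta> > 0 \<Longrightarrow> bounded (f ` ({-pi..pi} - {-\<delta><..<\<delta>}))"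
    and f_form: "\<And>x. x \<in> {-pi..pi} - {0} \<Longrightarrow> f x = L (1 / \<bar>x\<bar>) / \<bar>x\<bar> powr a"
    and a: "0 < a" "a < 1 / 2" and L: "slowly_varying (1 / pi) L"
  obtains D where "D > 0" "\<forall>\<^sub>F m in sequentially. \<forall>v\<in>carrier_vec m.
    Re ((toeplitz m (fourier_coeff f) *\<^sub>v v) \<bullet>c v) \<le> D * (real m powr a * L (real m)) * norm_sq v"
proof -
  have pi_inv: "1 / pi > 0" by simp
  obtain T where T: "T \<ge> 1 / pi" and up: "\<And>s t. T \<le> s \<Longrightarrow> s \<le> t \<Longrightarrow> L t \<le> 2 powr a * (t / s) powr a * L s"
    and lo: "\<And>s t. T \<le> s \<Longrightarrow> s \<le> t \<Longrightarrow> L s \<le> 2 powr a * (t / s) powr a * L t"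
    using potter_bounds[OF L pi_inv a(1)] by blast
  have "T > 0" using T pi_inv by linarith
  obtain B where B: "\<And>x. x \<in> {-pi..pi} \<Longrightarrow> 1 / T \<le> \<bar>x\<bar> \<Longrightarrow> f x \<le> B"
  proof -
    have "bounded (f ` ({-pi..pi} - {-(1 / T)<..<1 / T}))" by (rule f_bounded) (use \<open>T > 0\<close> in simp)
    then obtain B where bd: "\<forall>y\<in>f ` ({-pi..pi} - {-(1 / T)<..<1 / T}). norm y \<le> B"
      unfolding bounded_iff by (elim exE)
    show thesis
    proof (rule that)
      fix x assume "x \<in> {-pi..pi}" "1 / T \<le> \<bar>x\<bar>"
      then have "x \<in> {-pi..pi} - {-(1 / T)<..<1 / T}" by auto
      from bspec[OF bd imageI[OF this]] show "f x \<le> B" by simp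
    qed
  qed
  have fs: "f x = (1 / \<bar>x\<bar>) powr a * L (1 / \<bar>x\<bar>)" if "x \<in> {-pi..pi}" "x \<noteq> 0" for x
    using f_form[of x] that by (simp add: powr_divide)
  have "filterlim (\<lambda>m. 2 powr a * (real m powr a * L (real m))) at_top sequentially"
    by (intro filterlim_tendsto_pos_mult_at_top[OF tendsto_const]
        filterlim_compose[OF power_times_slowly_varying_at_top[OF L pi_inv a(1)] filterlim_real_sequentially]) simp
  then have "\<forall>\<^sub>F m in sequentially. B \<le> 2 powr a * (real m powr a * L (real m))"
    by (simp add: filterlim_at_top)
  moreover have "\<forall>\<^sub>F m in sequentially. max 1 T \<le> real m"
    using filterlim_real_sequentially by (simp only: filterlim_at_top)
  ultimately have "\<forall>\<^sub>F m in sequentially. \<forall>v\<in>carrier_vec m. Re ((toeplitz m (fourier_coeff f) *\<^sub>v v) \<bullet>c v)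
      \<le> (2 powr a * (1 + 1 / (1 - 2 * a))) * (real m powr a * L (real m)) * norm_sq v"
  proof eventually_elim
    case (elim m)
    define G where "G = 2 powr a * (real m powr a * L (real m))"
    have m: "m \<ge> 1" "real m \<ge> T" "real m > 0" using elim(2) by auto
    have "real m \<ge> 1 / pi" using m(2) T by linarith
    then have "L (real m) > 0" using L by (auto simp: slowly_varying_def)
    then have "G \<ge> 0" unfolding G_def by (intro mult_nonneg_nonneg) simp_all
    have outer: "f x \<le> G" if x: "x \<in> {-pi..pi}" "1 / real m < \<bar>x\<bar>" for x
    proof -
      have "0 < 1 / real m" using m(3) by simp
      then have "\<bar>x\<bar> > 0" using x(2) by linarith
      show ?thesis
      proof (cases "1 / T \<le> \<bar>x\<bar>")
        case True
        then show ?thesis using B[OF x(1)] elim(1) by (simp add: G_def)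
      next
        case False
        define s where "s = 1 / \<bar>x\<bar>"
        have s: "T \<le> s" "s \<le> real m" "s > 0"
          using False x(2) \<open>\<bar>x\<bar> > 0\<close> m(3) \<open>T > 0\<close> by (simp_all add: s_def field_simps)
        have "f x = s powr a * L s" using fs[OF x(1)] \<open>\<bar>x\<bar> > 0\<close> by (simp add: s_def)
        also have "\<dots> \<le> s powr a * (2 powr a * (real m / s) powr a * L (real m))"
          by (intro mult_left_mono lo[OF s(1,2)]) simp
        also have "\<dots> = G" using s(3) m(3) by (simp add: G_def powr_divide)
        finally show ?thesis .
      qed
    qed
    have inner: "f x \<le> G * (real m * \<bar>x\<bar>) powr - (2 * a)" if x: "x \<noteq> 0" "\<bar>x\<bar> \<le> 1 / real m" for x
    proof -
      define s where "s = 1 / \<bar>x\<bar>"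
      have s: "real m \<le> s" "s > 0" using x m(3) by (simp_all add: s_def field_simps)
      have "1 / real m \<le> 1" using m(1) by simp
      then have "\<bar>x\<bar> \<le> pi" using x(2) pi_gt3 by linarith
      then have "f x = s powr a * L s" using fs[of x] x(1) by (simp add: s_def abs_le_iff)
      also have "\<dots> \<le> s powr a * (2 powr a * (s / real m) powr a * L (real m))"
        by (intro mult_left_mono up[OF m(2) s(1)]) simp
      also have "\<dots> = G * (s / real m) powr (2 * a)"
      proof -
        have "s powr a = real m powr a * (s / real m) powr a" using s m(3) by (simp add: powr_divide)
        moreover have "(s / real m) powr (2 * a) = (s / real m) powr a * (s / real m) powr a"
          by (simp flip: powr_add)
        ultimately show ?thesis by (simp add: G_def)
      qed
      also have "(s / real m) powr (2 * a) = (real m * \<bar>x\<bar>) powr - (2 * a)"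
        using x m(3) by (simp add: s_def powr_minus_divide powr_divide powr_mult)
      finally show ?thesis .
    qed
    have "2 * a < 1" using a by simp
    have "Re ((toeplitz m (fourier_coeff f) *\<^sub>v v) \<bullet>c v) \<le> G * (1 + 1 / (1 - 2 * a)) * norm_sq v"
      if v: "v \<in> carrier_vec m" for v
      by (rule toeplitz_fourier_form_le[OF f m(1) \<open>2 * a < 1\<close> \<open>G \<ge> 0\<close> outer inner v])
    then show ?case by (simp add: G_def mult_ac)
  qed
  moreover have "2 powr a * (1 + 1 / (1 - 2 * a)) > 0" using a by (intro mult_pos_pos add_pos_pos) auto
  ultimately show thesis using that by blast
qed

section \<open>The norm of a Toeplitz matrix on a finite grid of frequencies\<close>

definition symbol :: "nat \<Rightarrow> (int \<Rightarrow> complex) \<Rightarrow> real \<Rightarrow> complex" where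
  "symbol m d \<theta> = (\<Sum>k\<in>{1 - int m..int m - 1}. d k * exp (\<i> * of_int k * of_real \<theta>))"

text \<open>The arguments of the roots of unity of order \<open>2 m\<close>.\<close>

definition grid :: "nat \<Rightarrow> nat \<Rightarrow> real" where
  "grid m l = pi * real l / real m"

lemma sum_swap3:
  "(\<Sum>l\<in>A. \<Sum>i\<in>B. \<Sum>j\<in>C. f l i j) = (\<Sum>i\<in>B. \<Sum>j\<in>C. \<Sum>l\<in>A. f l i j)"
  by (rule trans[OF sum.swap]) (intro sum.cong refl sum.swap)

lemma sum_grid_exp:
  fixes k :: int
  assumes m: "m \<ge> 1"
  shows "(\<Sum>l<2 * m. exp (\<i> * of_int k * of_real (grid m l))) = (if int (2 * m) dvd k then of_nat (2 * m) else 0)"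
proof -
  define w where "w = exp (\<i> * of_int k * of_real (pi / real m))"
  have pow: "exp (\<i> * of_int k * of_real (grid m l)) = w ^ l" for l
    unfolding w_def exp_of_nat_mult[symmetric] by (simp add: grid_def mult_ac)
  have w1: "w = 1 \<longleftrightarrow> int (2 * m) dvd k"
  proof -
    have "w = 1 \<longleftrightarrow> (\<exists>n::int. of_int k * (pi / real m) = of_int (2 * n) * pi)"
      by (simp add: w_def exp_eq_1)
    also have "\<dots> \<longleftrightarrow> (\<exists>n::int. real_of_int k = of_int (int (2 * m) * n))"
      using m by (intro ex_cong1) (auto simp: field_simps)
    also have "\<dots> \<longleftrightarrow> int (2 * m) dvd k"
      unfolding of_int_eq_iff by (auto simp: dvd_def)
    finally show ?thesis .
  qed
  have w2m: "w ^ (2 * m) = 1"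
  proof -
    have "w ^ (2 * m) = exp (0 + \<i> * (of_int k * (of_real pi * 2)))"
      unfolding w_def exp_of_nat_mult[symmetric] using m by (simp add: field_simps)
    also have "\<dots> = 1" by (subst exp_plus_2pin) simp
    finally show ?thesis .
  qed
  show ?thesis
  proof (cases "w = 1")
    case True
    then show ?thesis using w1 by (simp add: pow)
  next
    case False
    then have "(\<Sum>l<2 * m. w ^ l) = 0" using geometric_sum[of w "2 * m"] w2m by simp
    then show ?thesis using False w1 by (simp add: pow)
  qed
qed

text \<open>Two lags of an \<open>m \<times> m\<close> matrix differ by less than \<open>2 m\<close>, so \<open>2 m\<close> frequencies tell them apart.\<close>

lemma grid_orthogonality:
  fixes k j :: int
  assumes m: "m \<ge> 1" and k: "\<bar>k\<bar> < int m" "\<bar>j\<bar> < int m"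
  shows "(\<Sum>l<2 * m. exp (\<i> * of_int (k - j) * of_real (grid m l))) = (if k = j then of_nat (2 * m) else 0)"
proof -
  have "int (2 * m) dvd k - j \<longleftrightarrow> k = j"
  proof
    assume "int (2 * m) dvd k - j"
    moreover have "\<bar>k - j\<bar> < int (2 * m)" using k by linarith
    ultimately show "k = j" using zdvd_imp_le[of "int (2 * m)" "\<bar>k - j\<bar>"] by fastforce
  qed simp
  then show ?thesis using sum_grid_exp[OF m, of "k - j"] by simp
qed

lemma grid_parseval:
  assumes m: "m \<ge> 1" and v: "v \<in> carrier_vec m"
  shows "(\<Sum>l<2 * m. (cmod (trig_poly v (grid m l)))\<^sup>2) = real (2 * m) * norm_sq v"
proof -
  have "complex_of_real (\<Sum>l<2 * m. (cmod (trig_poly v (grid m l)))\<^sup>2)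
     = (\<Sum>l<2 * m. \<Sum>i<m. \<Sum>j<m. exp (\<i> * of_int (int j - int i) * of_real (grid m l)) * (vec_index v j * cnj (vec_index v i)))"
  proof -
    have "- (\<i> * of_int (int i - int j) * complex_of_real x) = \<i> * of_int (int j - int i) * of_real x" for i j x
      by (simp add: algebra_simps)
    then show ?thesis using v unfolding of_real_sum norm_trig_poly_sq by (simp add: mult.assoc)
  qed
  also have "\<dots> = (\<Sum>i<m. \<Sum>j<m. (\<Sum>l<2 * m. exp (\<i> * of_int (int j - int i) * of_real (grid m l))) * (vec_index v j * cnj (vec_index v i)))"
    unfolding sum_distrib_right by (rule sum_swap3)
  also have "\<dots> = (\<Sum>i<m. \<Sum>j<m. (if i = j then of_nat (2 * m) * (vec_index v j * cnj (vec_index v i)) else 0))"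
    by (intro sum.cong refl) (subst grid_orthogonality[OF m], auto)
  also have "\<dots> = of_nat (2 * m) * (\<Sum>i<m. vec_index v i * cnj (vec_index v i))"
    by (simp add: sum_distrib_left)
  also have "\<dots> = complex_of_real (real (2 * m) * norm_sq v)"
    using v by (simp add: norm_sq_def flip: complex_norm_square)
  finally show ?thesis by (simp only: of_real_eq_iff)
qed

text \<open>Inversion of the discrete Fourier transform.\<close>

lemma coeff_from_grid:
  assumes m: "m \<ge> 1" and j: "\<bar>j\<bar> < int m"
  shows "(\<Sum>l<2 * m. symbol m d (grid m l) * exp (- (\<i> * of_int j * of_real (grid m l)))) = of_nat (2 * m) * d j"
proof -
  have "(\<Sum>l<2 * m. symbol m d (grid m l) * exp (- (\<i> * of_int j * of_real (grid m l))))
     = (\<Sum>l<2 * m. \<Sum>k\<in>{1 - int m..int m - 1}. d k * exp (\<i> * of_int (k - j) * of_real (grid m l)))"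
    unfolding symbol_def sum_distrib_right
    by (intro sum.cong refl) (simp add: exp_add[symmetric] algebra_simps)
  also have "\<dots> = (\<Sum>k\<in>{1 - int m..int m - 1}. d k * (\<Sum>l<2 * m. exp (\<i> * of_int (k - j) * of_real (grid m l))))"
    unfolding sum_distrib_left by (rule sum.swap)
  also have "\<dots> = (\<Sum>k\<in>{1 - int m..int m - 1}. if k = j then d k * of_nat (2 * m) else 0)"
    using j by (intro sum.cong refl) (subst grid_orthogonality[OF m], auto)
  also have "\<dots> = of_nat (2 * m) * d j"
  proof -
    have "j \<in> {1 - int m..int m - 1}" using j by auto
    then show ?thesis by (simp add: sum.delta mult.commute)
  qed
  finally show ?thesis .
qed

text \<open>The sesquilinear form of a Toeplitz matrix as a discrete version of \<open>(1 / 2 \<pi>) \<integral> d p\<^sub>u p\<^sub>y\<^sup>*\<close>; in the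
language of matrices, the embedding into a circulant matrix, which the Fourier matrix diagonalises.\<close>

lemma toeplitz_form_grid:
  assumes m: "m \<ge> 1" and u: "u \<in> carrier_vec m" and y: "y \<in> carrier_vec m"
  shows "of_nat (2 * m) * ((toeplitz m d *\<^sub>v u) \<bullet>c y)
    = (\<Sum>l<2 * m. symbol m d (grid m l) * (trig_poly u (grid m l) * cnj (trig_poly y (grid m l))))"
proof -
  have "of_nat (2 * m) * ((toeplitz m d *\<^sub>v u) \<bullet>c y)
    = (\<Sum>i<m. \<Sum>j<m. (of_nat (2 * m) * d (int i - int j)) * (vec_index u j * cnj (vec_index y i)))"
    using u y by (simp add: toeplitz_def scalar_prod_def atLeast0LessThan sum_distrib_right sum_distrib_left mult_ac)
  also have "\<dots> = (\<Sum>i<m. \<Sum>j<m. \<Sum>l<2 * m. symbol m d (grid m l) * exp (- (\<i> * of_int (int i - int j) * of_real (grid m l))) * (vec_index u j * cnj (vec_index y i)))"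
  proof (intro sum.cong refl)
    fix i j assume "i \<in> {..<m}" "j \<in> {..<m}"
    then have ij: "\<bar>int i - int j\<bar> < int m" by auto
    show "(of_nat (2 * m) * d (int i - int j)) * (vec_index u j * cnj (vec_index y i))
      = (\<Sum>l<2 * m. symbol m d (grid m l) * exp (- (\<i> * of_int (int i - int j) * of_real (grid m l))) * (vec_index u j * cnj (vec_index y i)))"
      unfolding coeff_from_grid[OF m ij, symmetric] by (rule sum_distrib_right)
  qed
  also have "\<dots> = (\<Sum>l<2 * m. \<Sum>i<m. \<Sum>j<m. symbol m d (grid m l) * exp (- (\<i> * of_int (int i - int j) * of_real (grid m l))) * (vec_index u j * cnj (vec_index y i)))"
    by (rule sum_swap3[symmetric])
  also have "\<dots> = (\<Sum>l<2 * m. symbol m d (grid m l) * (trig_poly u (grid m l) * cnj (trig_poly y (grid m l))))"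
  proof (intro sum.cong refl)
    fix l
    have e: "exp (- (\<i> * of_int (int i - int j) * of_real x)) = exp (\<i> * of_nat j * of_real x) * exp (- (\<i> * of_nat i * of_real x))" for i j x
      by (simp add: exp_add[symmetric] algebra_simps)
    have "trig_poly u (grid m l) * cnj (trig_poly y (grid m l)) = (\<Sum>i<m. \<Sum>j<m.
       exp (- (\<i> * of_int (int i - int j) * of_real (grid m l))) * (vec_index u j * cnj (vec_index y i)))"
    proof -
      have "cnj (trig_poly y (grid m l)) * trig_poly u (grid m l) = (\<Sum>i<m. \<Sum>j<m.
        exp (- (\<i> * of_int (int i - int j) * of_real (grid m l))) * (vec_index u j * cnj (vec_index y i)))"
        unfolding e trig_poly_def cnj_sum sum_product carrier_vecD[OF u] carrier_vecD[OF y]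
        by (intro sum.cong refl) (simp add: exp_cnj mult_ac)
      then show ?thesis by (simp only: mult.commute)
    qed
    then show "(\<Sum>i<m. \<Sum>j<m. symbol m d (grid m l) * exp (- (\<i> * of_int (int i - int j) * of_real (grid m l))) * (vec_index u j * cnj (vec_index y i)))
       = symbol m d (grid m l) * (trig_poly u (grid m l) * cnj (trig_poly y (grid m l)))"
      by (simp only: sum_distrib_left mult.assoc)
  qed
  finally show ?thesis .
qed

lemma op_norm_toeplitz_le:
  assumes m: "m \<ge> 1" and x: "\<And>l. l < 2 * m \<Longrightarrow> cmod (symbol m d (grid m l)) \<le> x"
  shows "op_norm (toeplitz m d) \<le> x"
  unfolding op_norm_def
proof (rule cSup_least)
  have "x \<ge> 0" using x[of 0] m norm_ge_zero[of "symbol m d (grid m 0)"] by (simp del: norm_ge_zero)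
  show "{eucl_norm (toeplitz m d *\<^sub>v v) |v. v \<in> carrier_vec (dim_col (toeplitz m d)) \<and> eucl_norm v \<le> 1} \<noteq> {}"
  proof -
    have "0\<^sub>v m \<in> carrier_vec (dim_col (toeplitz m d)) \<and> eucl_norm (0\<^sub>v m) \<le> 1"
      by (simp add: eucl_norm_def toeplitz_def)
    then show ?thesis by blast
  qed
  fix z assume "z \<in> {eucl_norm (toeplitz m d *\<^sub>v v) |v. v \<in> carrier_vec (dim_col (toeplitz m d)) \<and> eucl_norm v \<le> 1}"
  then obtain u where u: "u \<in> carrier_vec m" "eucl_norm u \<le> 1" and z: "z = eucl_norm (toeplitz m d *\<^sub>v u)"
    by (auto simp: toeplitz_def)
  define y where "y = toeplitz m d *\<^sub>v u"
  have y: "y \<in> carrier_vec m" unfolding y_def by (rule mult_mat_vec_carrier[OF toeplitz_carrier u(1)])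
  let ?U = "\<lambda>l. cmod (trig_poly u (grid m l))" and ?Y = "\<lambda>l. cmod (trig_poly y (grid m l))"
  have "real (2 * m) * norm_sq y = cmod (of_nat (2 * m) * ((toeplitz m d *\<^sub>v u) \<bullet>c y))"
    unfolding y_def[symmetric] cscalar_prod_self norm_mult by simp
  also have "\<dots> \<le> (\<Sum>l<2 * m. cmod (symbol m d (grid m l)) * (?U l * ?Y l))"
    unfolding toeplitz_form_grid[OF m u(1) y] by (rule order_trans[OF norm_sum]) (simp add: norm_mult)
  also have "\<dots> \<le> x * (\<Sum>l<2 * m. ?U l * ?Y l)"
    unfolding sum_distrib_left using x by (intro sum_mono mult_right_mono) auto
  also have "\<dots> \<le> x * (sqrt (\<Sum>l<2 * m. (?U l)\<^sup>2) * sqrt (\<Sum>l<2 * m. (?Y l)\<^sup>2))"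
    using L2_set_mult_ineq[of ?U ?Y "{..<2 * m}"] \<open>x \<ge> 0\<close>
    by (intro mult_left_mono) (simp_all add: L2_set_def)
  also have "\<dots> = x * (sqrt (real (2 * m)) * sqrt (real (2 * m))) * (sqrt (norm_sq u) * sqrt (norm_sq y))"
    unfolding grid_parseval[OF m u(1)] grid_parseval[OF m y] real_sqrt_mult by (simp only: mult_ac)
  also have "sqrt (real (2 * m)) * sqrt (real (2 * m)) = real (2 * m)" by simp
  finally have "real (2 * m) * norm_sq y \<le> real (2 * m) * (x * (eucl_norm u * eucl_norm y))"
    by (simp add: eucl_norm_eq mult_ac)
  then have "norm_sq y \<le> x * (eucl_norm u * eucl_norm y)" using m by simp
  also have "\<dots> \<le> x * (1 * eucl_norm y)"
    using u(2) \<open>x \<ge> 0\<close> by (intro mult_left_mono mult_right_mono) (auto simp: eucl_norm_eq)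
  finally have "(eucl_norm y)\<^sup>2 \<le> x * eucl_norm y" by (simp add: eucl_norm_eq)
  moreover have "eucl_norm y \<ge> 0" by (simp add: eucl_norm_eq)
  ultimately show "z \<le> x"
    unfolding z y_def[symmetric] power2_eq_square using \<open>x \<ge> 0\<close>
    by (cases "eucl_norm y = 0") (simp_all add: mult_le_cancel_right)
qed

lemma card_diagonal:
  assumes "\<bar>k\<bar> < int m"
  shows "card {i. i < m \<and> 0 \<le> int i + k \<and> int i + k < int m} = nat (int m - \<bar>k\<bar>)"
proof -
  have "{i. i < m \<and> 0 \<le> int i + k \<and> int i + k < int m} = {nat (max 0 (- k))..<nat (min (int m) (int m - k))}"
    using assms by auto
  then have "card {i. i < m \<and> 0 \<le> int i + k \<and> int i + k < int m}
      = nat (min (int m) (int m - k)) - nat (max 0 (- k))" by (simp only: card_atLeastLessThan)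
  also have "\<dots> = nat (int m - \<bar>k\<bar>)" using assms by linarith
  finally show ?thesis .
qed

lemma sum_by_diagonals:
  fixes g :: "nat \<Rightarrow> nat \<Rightarrow> 'a :: comm_monoid_add"
  shows "(\<Sum>k\<in>{1 - int m..int m - 1}. \<Sum>i | i < m \<and> 0 \<le> int i + k \<and> int i + k < int m. g (nat (int i + k)) i)
    = (\<Sum>i<m. \<Sum>j<m. g i j)"
proof -
  have "(\<Sum>k\<in>{1 - int m..int m - 1}. \<Sum>i | i < m \<and> 0 \<le> int i + k \<and> int i + k < int m. g (nat (int i + k)) i)
    = (\<Sum>(k, i)\<in>Sigma {1 - int m..int m - 1} (\<lambda>k. {i. i < m \<and> 0 \<le> int i + k \<and> int i + k < int m}). g (nat (int i + k)) i)"
    by (subst sum.Sigma) auto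
  also have "\<dots> = (\<Sum>(i, j)\<in>{..<m} \<times> {..<m}. g i j)"
    by (rule sum.reindex_bij_witness[where i = "\<lambda>(i, j). (int i - int j, j)" and j = "\<lambda>(k, i). (nat (int i + k), i)"]) auto
  finally show ?thesis by (simp add: sum.cartesian_product)
qed

text \<open>The coefficient of the entry \<open>(i, j)\<close> in the symbol of the estimator at frequency \<open>\<theta>\<close>.\<close>

definition lag_weight :: "nat \<Rightarrow> real \<Rightarrow> nat \<Rightarrow> nat \<Rightarrow> complex" where
  "lag_weight m \<theta> i j = exp (\<i> * of_int (int i - int j) * of_real \<theta>) / of_int (int m - \<bar>int i - int j\<bar>)"

lemma symbol_autocov_est:
  assumes A: "A \<in> carrier_mat m m"
  shows "symbol m (autocov_est A) \<theta> = (\<Sum>i<m. \<Sum>j<m. A $$ (i, j) * lag_weight m \<theta> i j)"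
proof -
  have "symbol m (autocov_est A) \<theta> = (\<Sum>k\<in>{1 - int m..int m - 1}. \<Sum>i | i < m \<and> 0 \<le> int i + k \<and> int i + k < int m.
      A $$ (nat (int i + k), i) * lag_weight m \<theta> (nat (int i + k)) i)"
    using A unfolding symbol_def autocov_est_def
    by (intro sum.cong refl) (auto simp: lag_weight_def sum_distrib_right sum_divide_distrib add.commute intro!: sum.cong)
  then show ?thesis by (simp only: sum_by_diagonals[of "\<lambda>i j. A $$ (i, j) * lag_weight m \<theta> i j"])
qed

text \<open>Averaging along diagonals leaves a Toeplitz matrix unchanged; therefore the error of the estimator
is the estimator applied to the error \<open>S - \<xi> R\<close>.\<close>

lemma autocov_est_toeplitz:
  assumes "\<bar>k\<bar> < int m"
  shows "autocov_est (toeplitz m r) k = r k"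
proof -
  let ?I = "{i. i < m \<and> 0 \<le> int i + k \<and> int i + k < int m}"
  have "(\<Sum>i\<in>?I. toeplitz m r $$ (nat (int i + k), i)) = (\<Sum>i\<in>?I. r k)"
    by (intro sum.cong refl) (auto simp: toeplitz_def)
  also have "\<dots> = of_int (int m - \<bar>k\<bar>) * r k"
    using assms by (simp add: card_diagonal of_nat_nat del: of_int_diff)
  finally show ?thesis using assms by (simp add: autocov_est_def toeplitz_def del: of_int_diff)
qed

lemma autocov_est_minus_smult:
  assumes A: "A \<in> carrier_mat m m" and B: "B \<in> carrier_mat m m"
  shows "autocov_est (A - c \<cdot>\<^sub>m B) k = autocov_est A k - c * autocov_est B k"
proof -
  let ?I = "{i. i < m \<and> 0 \<le> int i + k \<and> int i + k < int m}"
  have "(\<Sum>i\<in>?I. (A - c \<cdot>\<^sub>m B) $$ (nat (int i + k), i))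
     = (\<Sum>i\<in>?I. A $$ (nat (int i + k), i)) - c * (\<Sum>i\<in>?I. B $$ (nat (int i + k), i))"
    using A B unfolding sum_distrib_left sum_subtractf[symmetric]
    by (intro sum.cong refl) (simp add: nat_less_iff)
  then show ?thesis using A B by (simp add: autocov_est_def diff_divide_distrib)
qed

lemma op_norm_toeplitz_est_le:
  assumes m: "m \<ge> 1" and A: "A \<in> carrier_mat m m"
    and x: "\<And>l. l < 2 * m \<Longrightarrow>
      cmod (\<Sum>i<m. \<Sum>j<m. (A $$ (i, j) - c * toeplitz m r $$ (i, j)) * lag_weight m (grid m l) i j) \<le> x"
  shows "op_norm (toeplitz m (autocov_est A) - c \<cdot>\<^sub>m toeplitz m r) \<le> x"
proof -
  let ?D = "A - c \<cdot>\<^sub>m toeplitz m r"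
  have D: "?D \<in> carrier_mat m m" by (intro minus_carrier_mat) simp
  have "toeplitz m (autocov_est A) - c \<cdot>\<^sub>m toeplitz m r = toeplitz m (autocov_est ?D)"
  proof (rule eq_matI)
    fix i j assume ij: "i < dim_row (toeplitz m (autocov_est ?D))" "j < dim_col (toeplitz m (autocov_est ?D))"
    then have "i < m" "j < m" and lag: "\<bar>int i - int j\<bar> < int m" by (auto simp: toeplitz_def)
    then have "(toeplitz m (autocov_est A) - c \<cdot>\<^sub>m toeplitz m r) $$ (i, j) = autocov_est A (int i - int j) - c * r (int i - int j)"
      "toeplitz m (autocov_est ?D) $$ (i, j) = autocov_est ?D (int i - int j)"
      by (simp_all add: toeplitz_def)
    then show "(toeplitz m (autocov_est A) - c \<cdot>\<^sub>m toeplitz m r) $$ (i, j) = toeplitz m (autocov_est ?D) $$ (i, j)"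
      by (simp only: autocov_est_minus_smult[OF A toeplitz_carrier] autocov_est_toeplitz[OF lag])
  qed (simp_all add: toeplitz_def)
  moreover have "op_norm (toeplitz m (autocov_est ?D)) \<le> x"
  proof (rule op_norm_toeplitz_le[OF m])
    fix l assume "l < 2 * m"
    from x[OF this] show "cmod (symbol m (autocov_est ?D) (grid m l)) \<le> x"
      unfolding symbol_autocov_est[OF D] using A by (simp add: toeplitz_def)
  qed
  ultimately show ?thesis by simp
qed

lemma sum_inverse_le_ln:
  assumes "n \<ge> 1"
  shows "(\<Sum>i<n. 1 / real (n - i)) \<le> 1 + ln (real n)"
proof -
  have "(\<Sum>i<n. 1 / real (n - i)) = (\<Sum>k=1..n. inverse (real k))"
    by (rule sum.reindex_bij_witness[where i = "\<lambda>k. n - k" and j = "\<lambda>i. n - i"])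
      (auto simp: inverse_eq_divide)
  also have "\<dots> \<le> 1 + ln (real n)"
    using decseqD[OF decseq_harm_diff_ln, of 0 "n - 1"] assms by (simp add: harm_def)
  finally show ?thesis .
qed

text \<open>A diagonal at lag \<open>k\<close> has \<open>m - \<bar>k\<bar>\<close> entries of size \<open>1 / (m - \<bar>k\<bar>)\<^sup>2\<close>, so the sum is twice a harmonic sum.
This is the source of the logarithm in the exponent of the final estimate.\<close>

lemma lag_weight_frobenius:
  assumes m: "m \<ge> 1"
  shows "(\<Sum>i<m. \<Sum>j<m. (cmod (lag_weight m \<theta> i j))\<^sup>2) \<le> 2 * (1 + ln (real m))"
proof -
  have w: "(cmod (lag_weight m \<theta> i j))\<^sup>2 = (1 / real_of_int (int m - \<bar>int i - int j\<bar>))\<^sup>2" for i j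
  proof -
    have "cmod (exp (\<i> * of_int (int i - int j) * of_real \<theta>)) = 1" by simp
    moreover have "cmod (complex_of_int (int m - \<bar>int i - int j\<bar>)) = \<bar>real_of_int (int m - \<bar>int i - int j\<bar>)\<bar>"
      by (rule norm_of_int)
    ultimately show ?thesis unfolding lag_weight_def norm_divide by (simp add: power_divide del: of_int_diff)
  qed
  have "(\<Sum>i<m. \<Sum>j<m. (cmod (lag_weight m \<theta> i j))\<^sup>2)
      = (\<Sum>k\<in>{1 - int m..int m - 1}. \<Sum>i | i < m \<and> 0 \<le> int i + k \<and> int i + k < int m.
          (1 / real_of_int (int m - \<bar>int (nat (int i + k)) - int i\<bar>))\<^sup>2)"
    unfolding w by (rule sum_by_diagonals[symmetric])
  also have "\<dots> = (\<Sum>k\<in>{1 - int m..int m - 1}. 1 / real_of_int (int m - \<bar>k\<bar>))"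
  proof (intro sum.cong refl)
    fix k assume "k \<in> {1 - int m..int m - 1}"
    then have k: "\<bar>k\<bar> < int m" by auto
    have "(\<Sum>i | i < m \<and> 0 \<le> int i + k \<and> int i + k < int m. (1 / real_of_int (int m - \<bar>int (nat (int i + k)) - int i\<bar>))\<^sup>2)
      = (\<Sum>i | i < m \<and> 0 \<le> int i + k \<and> int i + k < int m. (1 / real_of_int (int m - \<bar>k\<bar>))\<^sup>2)"
      by (intro sum.cong refl) simp
    also have "\<dots> = real_of_int (int m - \<bar>k\<bar>) * (1 / real_of_int (int m - \<bar>k\<bar>))\<^sup>2"
      using k by (simp add: card_diagonal of_nat_nat del: of_int_diff)
    also have "\<dots> = 1 / real_of_int (int m - \<bar>k\<bar>)"
      using k by (simp add: power2_eq_square del: of_int_diff)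
    finally show "(\<Sum>i | i < m \<and> 0 \<le> int i + k \<and> int i + k < int m. (1 / real_of_int (int m - \<bar>int (nat (int i + k)) - int i\<bar>))\<^sup>2)
      = 1 / real_of_int (int m - \<bar>k\<bar>)" .
  qed
  also have "\<dots> \<le> (\<Sum>k\<in>int ` {..<m} \<union> (\<lambda>i. - int i) ` {..<m}. 1 / real_of_int (int m - \<bar>k\<bar>))"
  proof (rule sum_mono2)
    show "{1 - int m..int m - 1} \<subseteq> int ` {..<m} \<union> (\<lambda>i. - int i) ` {..<m}"
    proof
      fix k assume k: "k \<in> {1 - int m..int m - 1}"
      then have "k = int (nat k) \<and> nat k < m \<or> k = - int (nat (- k)) \<and> nat (- k) < m" by auto
      then show "k \<in> int ` {..<m} \<union> (\<lambda>i. - int i) ` {..<m}" by blast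
    qed
  qed auto
  also have "\<dots> \<le> (\<Sum>k\<in>int ` {..<m}. 1 / real_of_int (int m - \<bar>k\<bar>)) + (\<Sum>k\<in>(\<lambda>i. - int i) ` {..<m}. 1 / real_of_int (int m - \<bar>k\<bar>))"
    by (subst sum_Un) (auto intro!: sum_nonneg)
  also have "\<dots> = 2 * (\<Sum>i<m. 1 / real (m - i))"
    by (simp add: sum.reindex inj_on_def of_nat_diff)
  also have "\<dots> \<le> 2 * (1 + ln (real m))" using sum_inverse_le_ln[OF m] by simp
  finally show ?thesis .
qed

section \<open>Weighted sums of sample covariances as Gaussian quadratic forms\<close>

text \<open>Row-major order: the indices of the Kronecker product below are decoded by \<open>div\<close> and \<open>mod\<close>.\<close>

definition flatten :: "nat \<Rightarrow> nat \<Rightarrow> complex mat \<Rightarrow> complex Matrix.vec" where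
  "flatten n m Y = Matrix.vec (n * m) (\<lambda>p. Y $$ (p div m, p mod m))"

text \<open>The Kronecker product of \<open>C\<close> with the transpose of \<open>G\<close>; the transpose makes the next formula
\<open>kron_transpose_flatten\<close> a plain trace.\<close>

definition kron_transpose :: "nat \<Rightarrow> nat \<Rightarrow> complex mat \<Rightarrow> complex mat \<Rightarrow> complex mat" where
  "kron_transpose n m C G = Matrix.mat (n * m) (n * m) (\<lambda>(p, q). C $$ (p div m, q div m) * G $$ (q mod m, p mod m))"

lemma div_less_of_less_mult: "p < n * m \<Longrightarrow> p div m < (n::nat)"
  by (simp add: less_mult_imp_div_less)

lemma mod_less_of_less_mult: "p < n * m \<Longrightarrow> p mod m < (m::nat)"
  by (cases "m = 0") auto

lemma sum_div_mod:
  fixes g :: "nat \<Rightarrow> nat \<Rightarrow> 'a :: comm_monoid_add"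
  shows "(\<Sum>p<n * m. g (p div m) (p mod m)) = (\<Sum>a<n. \<Sum>i<m. g a i)"
proof -
  have "(\<Sum>p<n * m. g (p div m) (p mod m)) = (\<Sum>(a, i)\<in>{..<n} \<times> {..<m}. g a i)"
  proof (rule sum.reindex_bij_witness[where i = "\<lambda>(a, i). a * m + i" and j = "\<lambda>p. (p div m, p mod m)"])
    fix x assume "x \<in> {..<n} \<times> {..<m}"
    then obtain a i where x: "x = (a, i)" "a < n" "i < m" by auto
    then have "a * m + i < (a + 1) * m" by simp
    also have "\<dots> \<le> n * m" using x by (intro mult_right_mono) auto
    finally show "(case x of (a, i) \<Rightarrow> a * m + i) \<in> {..<n * m}" using x by simp
    show "((case x of (a, i) \<Rightarrow> a * m + i) div m, (case x of (a, i) \<Rightarrow> a * m + i) mod m) = x"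
      using x by simp
  qed (auto simp: div_less_of_less_mult mod_less_of_less_mult)
  then show ?thesis by (simp add: sum.cartesian_product)
qed

lemma norm_sq_flatten: "Y \<in> carrier_mat n m \<Longrightarrow> norm_sq (flatten n m Y) = frob_sq Y"
  using sum_div_mod[of "\<lambda>a i. (cmod (Y $$ (a, i)))\<^sup>2" m n] by (simp add: norm_sq_def flatten_def frob_sq_def)

lemma flatten_surj:
  assumes "v \<in> carrier_vec (n * m)"
  obtains Y where "Y \<in> carrier_mat n m" "flatten n m Y = v"
proof
  let ?Y = "Matrix.mat n m (\<lambda>(a, i). vec_index v (a * m + i))"
  show "?Y \<in> carrier_mat n m" by simp
  show "flatten n m ?Y = v"
    using assms by (intro eq_vecI) (auto simp: flatten_def div_less_of_less_mult mod_less_of_less_mult)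
qed

lemma kron_transpose_carrier [simp]: "kron_transpose n m C G \<in> carrier_mat (n * m) (n * m)"
  by (simp add: kron_transpose_def)

lemma kron_transpose_hermitian:
  assumes C: "C \<in> carrier_mat n n" "mat_adjoint C = C" and G: "G \<in> carrier_mat m m" "mat_adjoint G = G"
  shows "mat_adjoint (kron_transpose n m C G) = kron_transpose n m C G"
proof (rule eq_matI)
  note C' = hermitian_entry[OF C] and G' = hermitian_entry[OF G]
  fix p q assume "p < dim_row (kron_transpose n m C G)" "q < dim_col (kron_transpose n m C G)"
  then show "mat_adjoint (kron_transpose n m C G) $$ (p, q) = kron_transpose n m C G $$ (p, q)"
    by (simp add: kron_transpose_def C' G' div_less_of_less_mult mod_less_of_less_mult)
qed (simp_all add: kron_transpose_def)

lemma trace_kron_transpose: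
  assumes C: "C \<in> carrier_mat n n" and G: "G \<in> carrier_mat m m"
  shows "trace_mat (kron_transpose n m C G) = trace_mat C * trace_mat G"
  using sum_div_mod[of "\<lambda>a i. C $$ (a, a) * G $$ (i, i)" m n] carrier_matD[OF C] carrier_matD[OF G]
  by (simp add: trace_mat_def kron_transpose_def sum_product)

lemma frob_sq_kron_transpose:
  assumes C: "C \<in> carrier_mat n n" and G: "G \<in> carrier_mat m m"
  shows "frob_sq (kron_transpose n m C G) = frob_sq C * frob_sq G"
proof -
  let ?c = "\<lambda>a b. (cmod (C $$ (a, b)))\<^sup>2" and ?g = "\<lambda>i j. (cmod (G $$ (i, j)))\<^sup>2"
  have "frob_sq (kron_transpose n m C G) = (\<Sum>p<n * m. \<Sum>q<n * m. ?c (p div m) (q div m) * ?g (q mod m) (p mod m))"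
    by (simp add: frob_sq_def kron_transpose_def norm_mult power_mult_distrib)
  also have "\<dots> = (\<Sum>a<n. \<Sum>i<m. \<Sum>b<n. \<Sum>j<m. ?c a b * ?g j i)"
    using sum_div_mod[of "\<lambda>a i. \<Sum>q<n * m. ?c a (q div m) * ?g (q mod m) i" m n]
      sum_div_mod[of "\<lambda>b j. ?c _ b * ?g j _" m n] by simp
  also have "\<dots> = (\<Sum>a<n. \<Sum>i<m. (\<Sum>b<n. ?c a b) * (\<Sum>j<m. ?g j i))"
    by (simp add: sum_product)
  also have "\<dots> = (\<Sum>a<n. \<Sum>b<n. ?c a b) * (\<Sum>i<m. \<Sum>j<m. ?g j i)"
    by (rule sum_product[symmetric])
  also have "(\<Sum>i<m. \<Sum>j<m. ?g j i) = frob_sq G" using G by (subst sum.swap) (simp add: frob_sq_def)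
  finally show ?thesis using C by (simp add: frob_sq_def)
qed

lemma kron_transpose_flatten:
  assumes C: "C \<in> carrier_mat n n" and G: "G \<in> carrier_mat m m" and Y: "Y \<in> carrier_mat n m"
  shows "(kron_transpose n m C G *\<^sub>v flatten n m Y) \<bullet>c flatten n m Y = trace_mat (mat_adjoint Y * (C * Y) * G)"
proof -
  let ?T = "\<lambda>a i b j. C $$ (a, b) * G $$ (j, i) * Y $$ (b, j) * cnj (Y $$ (a, i))"
  have "(kron_transpose n m C G *\<^sub>v flatten n m Y) \<bullet>c flatten n m Y
    = (\<Sum>p<n * m. \<Sum>q<n * m. ?T (p div m) (p mod m) (q div m) (q mod m))"
    by (simp add: kron_transpose_def flatten_def scalar_prod_def atLeast0LessThan sum_distrib_right)
  also have "\<dots> = (\<Sum>a<n. \<Sum>i<m. \<Sum>q<n * m. ?T a i (q div m) (q mod m))"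
    by (rule sum_div_mod[of "\<lambda>a i. \<Sum>q<n * m. ?T a i (q div m) (q mod m)" m n])
  also have "\<dots> = (\<Sum>a<n. \<Sum>i<m. \<Sum>b<n. \<Sum>j<m. ?T a i b j)"
    by (rule sum.cong[OF refl], rule sum.cong[OF refl], rule sum_div_mod)
  also have "\<dots> = (\<Sum>i<m. \<Sum>a<n. \<Sum>j<m. \<Sum>b<n. ?T a i b j)"
    by (subst sum.swap) (intro sum.cong refl sum.swap)
  also have "\<dots> = (\<Sum>i<m. \<Sum>j<m. \<Sum>a<n. \<Sum>b<n. ?T a i b j)"
    by (intro sum.cong refl sum.swap)
  also have "\<dots> = (\<Sum>i<m. \<Sum>j<m. (\<Sum>a<n. cnj (Y $$ (a, i)) * (\<Sum>b<n. C $$ (a, b) * Y $$ (b, j))) * G $$ (j, i))"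
    by (simp add: sum_distrib_left sum_distrib_right mult_ac)
  also have "\<dots> = trace_mat (mat_adjoint Y * (C * Y) * G)"
    using C G Y by (simp add: trace_mat_def mult_mat_index del: index_mult_mat(1))
  finally show ?thesis .
qed

text \<open>Needed to number the entries of the random matrix by the positions of its flattening.\<close>

lemma (in prob_space) indep_vars_reindex_inj:
  assumes ind: "indep_vars (\<lambda>_. N) X I" and h: "inj_on h J" "h ` J \<subseteq> I"
  shows "indep_vars (\<lambda>_. N) (\<lambda>j. X (h j)) J"
proof -
  let ?F = "\<lambda>i. {X i -` A \<inter> space M | A. A \<in> sets N}"
  have rv: "\<And>i. i \<in> I \<Longrightarrow> random_variable N (X i)" and sets: "indep_sets ?F I"
    using ind by (auto simp: indep_vars_def2)
  have "indep_sets (\<lambda>j. ?F (h j)) J"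
  proof (rule indep_setsI)
    show "?F (h j) \<subseteq> events" if "j \<in> J" for j
      using rv that h(2) by (auto intro!: measurable_sets)
    fix A K assume K: "K \<noteq> {}" "K \<subseteq> J" "finite K" and A: "\<forall>j\<in>K. A j \<in> ?F (h j)"
    define A' where "A' i = A (the_inv_into K h i)" for i
    have inj: "inj_on h K" using h(1) K(2) by (rule inj_on_subset)
    have A': "A' (h j) = A j" if "j \<in> K" for j
      using the_inv_into_f_f[OF inj that] by (simp add: A'_def)
    have "prob (\<Inter>i\<in>h ` K. A' i) = (\<Prod>i\<in>h ` K. prob (A' i))"
    proof (rule indep_setsD[OF sets])
      show "h ` K \<subseteq> I" using K(2) h(2) by auto
      show "\<forall>i\<in>h ` K. A' i \<in> ?F i" using A A' by auto
    qed (use K in auto)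
    then show "prob (\<Inter>j\<in>K. A j) = (\<Prod>j\<in>K. prob (A j))"
      using A' by (simp add: prod.reindex[OF inj])
  qed
  then show ?thesis using rv h(2) by (auto simp: indep_vars_def2)
qed

lemma dim_sample_matrix:
  assumes "psd_hermitian n C" "psd_hermitian m R" "Y \<in> carrier_mat n m"
  shows "sample_matrix C Y R \<in> carrier_mat n m"
  using psd_sqrt_root(1)[OF assms(1)] psd_sqrt_root(1)[OF assms(2)] assms(3)
  unfolding sample_matrix_def psd_hermitian_def by (intro mult_carrier_mat) auto

lemma trace_mult_eq_sum:
  assumes "A \<in> carrier_mat m m" "B \<in> carrier_mat m m"
  shows "trace_mat (A * B) = (\<Sum>i<m. \<Sum>j<m. A $$ (i, j) * B $$ (j, i))"
  using assms by (simp add: trace_mat_def mult_mat_index del: index_mult_mat(1))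

text \<open>The square roots of \<open>C\<close> recombine to \<open>C\<close> inside \<open>X\<^sup>* X\<close>, and those of \<open>R\<close> move around the trace to both
sides of \<open>W\<close>.\<close>

lemma sample_trace_eq_kron_transpose:
  assumes C: "psd_hermitian n C" and R: "psd_hermitian m R" and Y: "Y \<in> carrier_mat n m" and W: "W \<in> carrier_mat m m"
  defines "X \<equiv> sample_matrix C Y R"
  shows "trace_mat (mat_adjoint X * X * W) =
    (kron_transpose n m C (psd_sqrt R * W * psd_sqrt R) *\<^sub>v flatten n m Y) \<bullet>c flatten n m Y"
proof -
  define S T where "S = psd_sqrt C" and "T = psd_sqrt R"
  have S: "S \<in> carrier_mat n n" "mat_adjoint S = S" "S * S = C"
    using psd_sqrt_root[OF C] by (auto simp: S_def psd_hermitian_def)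
  have T: "T \<in> carrier_mat m m" "mat_adjoint T = T"
    using psd_sqrt_root[OF R] by (auto simp: T_def psd_hermitian_def)
  have Y': "mat_adjoint Y \<in> carrier_mat m n" using Y by simp
  have Cc: "C \<in> carrier_mat n n" using C by (simp add: psd_hermitian_def)
  have SY: "S * Y \<in> carrier_mat n m" "C * Y \<in> carrier_mat n m" using S Y Cc by (auto intro: mult_carrier_mat)
  have X: "X = S * Y * T" by (simp add: X_def sample_matrix_def S_def T_def)
  have YCY: "mat_adjoint Y * (C * Y) \<in> carrier_mat m m" using Y' SY by (auto intro: mult_carrier_mat)
  have "mat_adjoint X = T * (mat_adjoint Y * S)"
    unfolding X mat_adjoint_mult[OF SY(1) T(1)] mat_adjoint_mult[OF S(1) Y] S(2) T(2) ..
  moreover have "mat_adjoint Y * S * (S * Y) = mat_adjoint Y * (C * Y)"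
  proof -
    have "mat_adjoint Y * S * (S * Y) = mat_adjoint Y * (S * (S * Y))"
      by (rule assoc_mult_mat[OF Y' S(1) SY(1)])
    also have "S * (S * Y) = C * Y" using assoc_mult_mat[OF S(1) S(1) Y] S(3) by simp
    finally show ?thesis .
  qed
  moreover have "T * (mat_adjoint Y * S) * (S * Y * T) = T * (mat_adjoint Y * S * (S * Y) * T)"
  proof -
    have YS: "mat_adjoint Y * S \<in> carrier_mat m n" using Y' S by (auto intro: mult_carrier_mat)
    have "T * (mat_adjoint Y * S) * (S * Y * T) = T * ((mat_adjoint Y * S) * (S * Y * T))"
      by (rule assoc_mult_mat[OF T(1) YS mult_carrier_mat[OF SY(1) T(1)]])
    then show ?thesis using assoc_mult_mat[OF YS SY(1) T(1)] by simp
  qed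
  ultimately have XX: "mat_adjoint X * X = T * (mat_adjoint Y * (C * Y) * T)" by (simp add: X)
  have YT: "mat_adjoint Y * (C * Y) * T \<in> carrier_mat m m" using YCY T by (auto intro: mult_carrier_mat)
  have TW: "T * W \<in> carrier_mat m m" using T W by (auto intro: mult_carrier_mat)
  have "trace_mat (mat_adjoint X * X * W) = trace_mat (T * ((mat_adjoint Y * (C * Y) * T) * W))"
    unfolding XX using assoc_mult_mat[OF T(1) YT W] by simp
  also have "\<dots> = trace_mat ((mat_adjoint Y * (C * Y) * T) * W * T)"
    by (rule trace_mult_commute[OF T(1) mult_carrier_mat[OF YT W]])
  also have "(mat_adjoint Y * (C * Y) * T) * W * T = mat_adjoint Y * (C * Y) * (T * W * T)"
    using assoc_mult_mat[OF YCY T(1) W] assoc_mult_mat[OF YCY TW T(1)] by simp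
  also have "trace_mat \<dots> = (kron_transpose n m C (T * W * T) *\<^sub>v flatten n m Y) \<bullet>c flatten n m Y"
    by (rule kron_transpose_flatten[OF Cc _ Y, symmetric]) (rule mult_carrier_mat[OF TW T(1)])
  finally show ?thesis by (simp add: T_def)
qed

lemma frob_sq_sample_matrix_le:
  assumes C: "psd_hermitian n C" and R: "psd_hermitian m R" and Y: "Y \<in> carrier_mat n m"
    and \<gamma>: "\<And>v. v \<in> carrier_vec n \<Longrightarrow> Re ((C *\<^sub>v v) \<bullet>c v) \<le> \<gamma> * norm_sq v" "\<gamma> \<ge> 0"
    and u: "\<And>v. v \<in> carrier_vec m \<Longrightarrow> Re ((R *\<^sub>v v) \<bullet>c v) \<le> u * norm_sq v"
  shows "frob_sq (sample_matrix C Y R) \<le> \<gamma> * u * frob_sq Y"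
proof -
  have S: "psd_sqrt C \<in> carrier_mat n n" "mat_adjoint (psd_sqrt C) = psd_sqrt C"
    and T: "psd_sqrt R \<in> carrier_mat m m" "mat_adjoint (psd_sqrt R) = psd_sqrt R"
    using psd_sqrt_root(1)[OF C] psd_sqrt_root(1)[OF R] by (auto simp: psd_hermitian_def)
  have "frob_sq (sample_matrix C Y R) = frob_sq (psd_sqrt C * (Y * psd_sqrt R))"
    unfolding sample_matrix_def using assoc_mult_mat[OF S(1) Y T(1)] by simp
  also have "\<dots> \<le> \<gamma> * frob_sq (Y * psd_sqrt R)"
    by (rule frob_sq_root_mult_le(1)[OF S _ mult_carrier_mat[OF Y T(1)]]) (simp add: psd_sqrt_root(2)[OF C] \<gamma>)
  also have "\<dots> \<le> \<gamma> * (u * frob_sq Y)"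
    using \<gamma>(2) by (intro mult_left_mono frob_sq_root_mult_le(2)[OF T _ Y]) (simp_all add: psd_sqrt_root(2)[OF R] u)
  finally show ?thesis by (simp add: mult.assoc)
qed

lemma frob_sq_sandwich_le:
  assumes R: "psd_hermitian m R" and W: "W \<in> carrier_mat m m" and "u \<ge> 0"
    and u: "\<And>v. v \<in> carrier_vec m \<Longrightarrow> Re ((R *\<^sub>v v) \<bullet>c v) \<le> u * norm_sq v"
  shows "frob_sq (psd_sqrt R * W * psd_sqrt R) \<le> u\<^sup>2 * frob_sq W"
proof -
  have T: "psd_sqrt R \<in> carrier_mat m m" "mat_adjoint (psd_sqrt R) = psd_sqrt R"
    using psd_sqrt_root(1)[OF R] by (auto simp: psd_hermitian_def)
  have "frob_sq (psd_sqrt R * W * psd_sqrt R) \<le> u * frob_sq (psd_sqrt R * W)"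
    by (rule frob_sq_root_mult_le(2)[OF T _ mult_carrier_mat[OF T(1) W]]) (simp add: psd_sqrt_root(2)[OF R] u)
  also have "\<dots> \<le> u * (u * frob_sq W)"
    using \<open>u \<ge> 0\<close> by (intro mult_left_mono frob_sq_root_mult_le(1)[OF T _ W]) (simp_all add: psd_sqrt_root(2)[OF R] u)
  finally show ?thesis by (simp add: power2_eq_square mult.assoc)
qed

lemma frob_sq_psd_le:
  assumes C: "psd_hermitian n C" and "\<gamma> \<ge> 0"
    and \<gamma>: "\<And>v. v \<in> carrier_vec n \<Longrightarrow> Re ((C *\<^sub>v v) \<bullet>c v) \<le> \<gamma> * norm_sq v"
  shows "frob_sq C \<le> \<gamma>\<^sup>2 * real n"
proof -
  have S: "psd_sqrt C \<in> carrier_mat n n" using psd_sqrt_root(1)[OF C] by (simp add: psd_hermitian_def)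
  have "frob_sq (1\<^sub>m n) = (\<Sum>i<n. \<Sum>j<n. if i = j then 1 else 0)"
    unfolding frob_sq_def index_one_mat(2,3) by (intro sum.cong refl) simp
  then have one: "frob_sq (1\<^sub>m n) = real n" by simp
  have "psd_sqrt C * 1\<^sub>m n * psd_sqrt C = C" using S psd_sqrt_root(2)[OF C] by simp
  then show ?thesis using frob_sq_sandwich_le[OF C one_carrier_mat \<open>\<gamma> \<ge> 0\<close> \<gamma>] one by simp
qed

text \<open>With \<open>Q\<close> the Kronecker product of \<open>C\<close> and \<open>R\<^sup>1\<^sup>/\<^sup>2 W R\<^sup>1\<^sup>/\<^sup>2\<close> (transposed), \<open>n T\<close> is \<open>z\<^sup>* Q z - tr Q\<close>. The Frobenius
norm of \<open>Q\<close> factorises. Its operator norm is not estimated through the Frobenius norm, which would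
lose a factor of order \<open>n\<^sup>1\<^sup>/\<^sup>2\<close>, but by rewriting the form as a trace against \<open>X\<^sup>* X\<close>.\<close>

lemma (in prob_space) weighted_cov_tail:
  fixes W :: "complex mat"
  assumes n: "n \<ge> 1" and m: "m \<ge> 1" and C: "psd_hermitian n C" and R: "psd_hermitian m R"
    and Z: "iid_complex_gaussian_matrix M n m Z"
    and \<gamma>: "\<And>v. v \<in> carrier_vec n \<Longrightarrow> Re ((C *\<^sub>v v) \<bullet>c v) \<le> \<gamma> * norm_sq v" "\<gamma> \<ge> 0"
    and u: "\<And>v. v \<in> carrier_vec m \<Longrightarrow> Re ((R *\<^sub>v v) \<bullet>c v) \<le> u * norm_sq v" "u \<ge> 0"
    and W: "W \<in> carrier_mat m m" "mat_adjoint W = W" "frob_sq W \<le> H"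
    and t: "t \<ge> 0" "t * (\<gamma> * u * sqrt H / real n) \<le> 1 / 2"
  defines "T \<equiv> \<lambda>w. Re (\<Sum>i<m. \<Sum>j<m. (sample_cov (sample_matrix C (Z w) R) $$ (i, j) - xi C * R $$ (i, j)) * W $$ (j, i))"
  shows "{w \<in> space M. T w \<ge> x} \<in> events"
    and "prob {w \<in> space M. T w \<ge> x} \<le> exp (- t * x + 2 * t\<^sup>2 * (\<gamma>\<^sup>2 * u\<^sup>2 * H / real n))"
proof -
  define P where "P = psd_sqrt R"
  have P: "P \<in> carrier_mat m m" "mat_adjoint P = P" "P * P = R"
    using psd_sqrt_root[OF R] by (auto simp: P_def psd_hermitian_def)
  have Cc: "C \<in> carrier_mat n n" "mat_adjoint C = C" and Rc: "R \<in> carrier_mat m m"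
    using C R by (auto simp: psd_hermitian_def)
  define G where "G = P * W * P"
  have PW: "P * W \<in> carrier_mat m m" using P W by (auto intro: mult_carrier_mat)
  have G: "G \<in> carrier_mat m m" unfolding G_def by (rule mult_carrier_mat[OF PW P(1)])
  have Gh: "mat_adjoint G = G"
    unfolding G_def mat_adjoint_mult[OF PW P(1)] mat_adjoint_mult[OF P(1) W(1)] P(2) W(2)
    by (rule assoc_mult_mat[OF P(1) W(1) P(1), symmetric])
  define Q where "Q = kron_transpose n m C G"
  have Q: "Q \<in> carrier_mat (n * m) (n * m)" "mat_adjoint Q = Q"
    unfolding Q_def by (simp, rule kron_transpose_hermitian[OF Cc G Gh])
  define z where "z p w = Z w $$ (p div m, p mod m)" for p w
  have nm: "n * m > 0" using n m by simp
  have gauss: "std_complex_gaussian M (z p)" if "p < n * m" for p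
    using Z that unfolding z_def
    by (auto simp: iid_complex_gaussian_matrix_def div_less_of_less_mult mod_less_of_less_mult)
  have ind: "indep_vars (\<lambda>_. borel) z {..<n * m}"
    unfolding z_def
  proof (rule indep_vars_reindex_inj[of borel "\<lambda>ij w. Z w $$ ij" "{..<n} \<times> {..<m}" "\<lambda>p. (p div m, p mod m)"])
    show "indep_vars (\<lambda>_. borel) (\<lambda>ij w. Z w $$ ij) ({..<n} \<times> {..<m})"
      using Z by (simp add: iid_complex_gaussian_matrix_def)
    show "inj_on (\<lambda>p. (p div m, p mod m)) {..<n * m}"
      by (rule inj_onI) (metis div_mult_mod_eq prod.inject)
  qed (auto simp: div_less_of_less_mult mod_less_of_less_mult)
  have flat: "Matrix.vec (n * m) (\<lambda>p. z p w) = flatten n m (Z w)" for w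
    by (simp add: flatten_def z_def)
  have Zc: "Z w \<in> carrier_mat n m" if "w \<in> space M" for w
    using Z that by (simp add: iid_complex_gaussian_matrix_def)
  \<comment> \<open>By Cauchy-Schwarz for traces, \<open>\<bar>tr (X\<^sup>* X W)\<bar> \<le> \<parallel>X\<parallel>\<^sub>F \<parallel>X W\<parallel>\<^sub>F \<le> \<parallel>X\<parallel>\<^sub>F\<^sup>2 \<parallel>W\<parallel>\<^sub>F\<close>.\<close>
  have bound: "\<bar>Re ((Q *\<^sub>v v) \<bullet>c v)\<bar> \<le> \<gamma> * u * sqrt H * norm_sq v" if v: "v \<in> carrier_vec (n * m)" for v
  proof -
    obtain Y where Y: "Y \<in> carrier_mat n m" "flatten n m Y = v" using flatten_surj[OF v] .
    define X where "X = sample_matrix C Y R"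
    have X: "X \<in> carrier_mat n m" unfolding X_def by (rule dim_sample_matrix[OF C R Y(1)])
    have XW: "X * W \<in> carrier_mat n m" using X W by (auto intro: mult_carrier_mat)
    have fX: "frob_sq X \<le> \<gamma> * u * norm_sq v"
      unfolding X_def Y(2)[symmetric] norm_sq_flatten[OF Y(1)] by (rule frob_sq_sample_matrix_le[OF C R Y(1) \<gamma> u(1)])
    have "(Q *\<^sub>v v) \<bullet>c v = trace_mat (mat_adjoint X * X * W)"
      unfolding Q_def G_def P_def Y(2)[symmetric] X_def by (rule sample_trace_eq_kron_transpose[OF C R Y(1) W(1), symmetric])
    also have "mat_adjoint X * X * W = mat_adjoint X * (X * W)"
      by (rule assoc_mult_mat[OF mat_adjoint_carrier[OF X] X W(1)])
    finally have "\<bar>Re ((Q *\<^sub>v v) \<bullet>c v)\<bar> \<le> cmod (trace_mat (mat_adjoint X * (X * W)))"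
      by (simp add: abs_Re_le_cmod)
    also have "\<dots> \<le> sqrt (frob_sq X) * sqrt (frob_sq (X * W))"
      by (rule cmod_trace_adjoint_mult_le[OF X XW])
    also have "\<dots> \<le> sqrt (frob_sq X) * sqrt (frob_sq X * H)"
    proof (intro mult_left_mono real_sqrt_le_mono)
      have "frob_sq (X * W) \<le> frob_sq X * frob_sq W" by (rule frob_sq_mult_le[OF X W(1)])
      also have "\<dots> \<le> frob_sq X * H" using W(3) by (intro mult_left_mono) auto
      finally show "frob_sq (X * W) \<le> frob_sq X * H" .
    qed simp
    also have "\<dots> = frob_sq X * sqrt H" by (simp add: real_sqrt_mult)
    also have "\<dots> \<le> (\<gamma> * u * norm_sq v) * sqrt H"
      using fX order_trans[OF frob_sq_nonneg W(3)] by (intro mult_right_mono) auto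
    finally show ?thesis by (simp add: mult_ac)
  qed
  have frobQ: "frob_sq Q \<le> \<gamma>\<^sup>2 * real n * (u\<^sup>2 * H)"
  proof -
    have "frob_sq G \<le> u\<^sup>2 * frob_sq W" unfolding G_def P_def by (rule frob_sq_sandwich_le[OF R W(1) u(2) u(1)])
    also have "\<dots> \<le> u\<^sup>2 * H" using W(3) by (intro mult_left_mono) auto
    finally show ?thesis
      unfolding Q_def frob_sq_kron_transpose[OF Cc(1) G]
      using frob_sq_psd_le[OF C \<gamma>(2) \<gamma>(1)] by (intro mult_mono) auto
  qed
  define V where "V w = Re ((Q *\<^sub>v flatten n m (Z w)) \<bullet>c flatten n m (Z w))" for w
  have "trace_mat G = trace_mat (R * W)"
  proof -
    have "trace_mat G = trace_mat (P * (P * W))" unfolding G_def by (rule trace_mult_commute[OF PW P(1)])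
    then show ?thesis using assoc_mult_mat[OF P(1) P(1) W(1)] P(3) by simp
  qed
  then have trQ: "trace_mat Q = trace_mat C * trace_mat (R * W)"
    unfolding Q_def trace_kron_transpose[OF Cc(1) G] by simp
  have T: "T w = (V w - Re (trace_mat Q)) / real n" if w: "w \<in> space M" for w
  proof -
    define X where "X = sample_matrix C (Z w) R"
    have X: "X \<in> carrier_mat n m" unfolding X_def by (rule dim_sample_matrix[OF C R Zc[OF w]])
    have XX: "mat_adjoint X * X \<in> carrier_mat m m" using X by (auto intro: mult_carrier_mat)
    have "(\<Sum>i<m. \<Sum>j<m. (sample_cov X $$ (i, j) - xi C * R $$ (i, j)) * W $$ (j, i))
        = (\<Sum>i<m. \<Sum>j<m. (1 / of_nat n) * ((mat_adjoint X * X) $$ (i, j) * W $$ (j, i)) - xi C * (R $$ (i, j) * W $$ (j, i)))"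
      using X XX by (intro sum.cong refl) (simp add: sample_cov_def algebra_simps del: index_mult_mat(1))
    also have "\<dots> = (1 / of_nat n) * trace_mat (mat_adjoint X * X * W) - xi C * trace_mat (R * W)"
      unfolding trace_mult_eq_sum[OF XX W(1)] trace_mult_eq_sum[OF Rc W(1)] sum_subtractf sum_distrib_left ..
    also have "trace_mat (mat_adjoint X * X * W) = (Q *\<^sub>v flatten n m (Z w)) \<bullet>c flatten n m (Z w)"
      unfolding Q_def G_def P_def X_def by (rule sample_trace_eq_kron_transpose[OF C R Zc[OF w] W(1)])
    also have "xi C * trace_mat (R * W) = (1 / of_nat n) * trace_mat Q"
      using Cc by (simp add: xi_def trQ)
    also have "(1 / of_nat n) * ((Q *\<^sub>v flatten n m (Z w)) \<bullet>c flatten n m (Z w)) - (1 / of_nat n) * trace_mat Q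
       = ((Q *\<^sub>v flatten n m (Z w)) \<bullet>c flatten n m (Z w) - trace_mat Q) / complex_of_real (real n)"
      by (simp add: diff_divide_distrib)
    finally show ?thesis unfolding T_def X_def[symmetric] V_def by (simp only: Re_divide_of_real minus_complex.sel)
  qed
  have ev: "{w \<in> space M. T w \<ge> x} = {w \<in> space M. V w - Re (trace_mat Q) \<ge> real n * x}"
    using T n by (auto simp: pos_le_divide_eq mult.commute)
  have "V \<in> borel_measurable M"
    unfolding V_def flat[symmetric] using ind Q(1)
    by (intro borel_measurable_form) (auto simp: indep_vars_def)
  then show "{w \<in> space M. T w \<ge> x} \<in> events" unfolding ev by measurable
  have "prob {w \<in> space M. V w - Re (trace_mat Q) \<ge> real n * x}
      \<le> exp (- (t / real n) * (real n * x) + 2 * (t / real n)\<^sup>2 * (\<gamma>\<^sup>2 * real n * (u\<^sup>2 * H)))"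
    unfolding V_def flat[symmetric]
    by (rule gaussian_form_tail[OF nm gauss ind Q bound frobQ]) (use t n in simp_all)
  also have "- (t / real n) * (real n * x) + 2 * (t / real n)\<^sup>2 * (\<gamma>\<^sup>2 * real n * (u\<^sup>2 * H))
      = - t * x + 2 * t\<^sup>2 * (\<gamma>\<^sup>2 * u\<^sup>2 * H / real n)"
    using n by (simp add: power2_eq_square)
  finally show "prob {w \<in> space M. T w \<ge> x} \<le> exp (- t * x + 2 * t\<^sup>2 * (\<gamma>\<^sup>2 * u\<^sup>2 * H / real n))"
    unfolding ev .
qed

section \<open>The deviation bound\<close>

text \<open>Union bound over the \<open>2 m\<close> grid frequencies and the two signs. The symbol of the error is real at
every frequency because the sample covariance, \<open>R\<close> and the weights are Hermitian and \<open>\<xi>\<close> is real. The upper bound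
on \<open>x\<close> keeps the optimal Chernoff parameter in the range where the moment generating function is
controlled.\<close>

lemma (in prob_space) toeplitz_est_deviation:
  assumes n: "n \<ge> 1" and m: "m \<ge> 3" and C: "psd_hermitian n C"
    and R: "psd_hermitian m (toeplitz m r)"
    and Z: "iid_complex_gaussian_matrix M n m Z"
    and u: "\<And>v. v \<in> carrier_vec m \<Longrightarrow> Re ((toeplitz m r *\<^sub>v v) \<bullet>c v) \<le> u * norm_sq v" "u > 0"
    and \<gamma>: "op_norm C > 0" and x: "x > 0" "x \<le> 4 * op_norm C * u * sqrt (ln (real m))"
  shows "prob {w \<in> space M. op_norm (toeplitz_est (sample_matrix C (Z w) (toeplitz m r)) - xi C \<cdot>\<^sub>m toeplitz m r) > x}
    \<le> 4 * real m * exp (- (real n * x\<^sup>2 / (32 * (op_norm C)\<^sup>2 * u\<^sup>2 * ln (real m))))"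
proof -
  define \<gamma> where "\<gamma> = op_norm C"
  define H where "H = 4 * ln (real m)"
  define F where "F = \<gamma>\<^sup>2 * u\<^sup>2 * H / real n"
  \<comment> \<open>The minimiser of \<open>- t x + 2 t\<^sup>2 F\<close>.\<close>
  define t where "t = x / (4 * F)"
  have Cc: "C \<in> carrier_mat n n" using C by (simp add: psd_hermitian_def)
  \<comment> \<open>For \<open>m \<ge> 3\<close> the logarithm is at least 1, so \<open>2 (1 + ln m) \<le> 4 ln m\<close>.\<close>
  have "exp 1 \<le> real m" using exp_le m by linarith
  then have ln1: "1 \<le> ln (real m)" using m by (subst ln_ge_iff) auto
  have H: "H > 0" using ln1 by (simp add: H_def)
  have F: "F > 0" using n u(2) \<gamma> H by (simp add: F_def \<gamma>_def)
  have t: "t \<ge> 0" using x F by (simp add: t_def)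
  have ts: "t * (\<gamma> * u * sqrt H / real n) \<le> 1 / 2"
  proof -
    define g where "g = \<gamma> * u * sqrt H"
    have g: "g > 0" using u(2) \<gamma> H by (simp add: g_def \<gamma>_def)
    have "F = g * g / real n" using H by (simp add: F_def g_def power2_eq_square)
    then have "t * (g / real n) = x / (4 * g)" using n g by (simp add: t_def)
    then have "t * (\<gamma> * u * sqrt H / real n) = x / (4 * \<gamma> * u * sqrt H)"
      by (simp add: g_def mult.assoc)
    also have "x / (4 * \<gamma> * u * sqrt H) = x / (4 * \<gamma> * u * sqrt (ln (real m))) / 2"
      by (simp add: H_def real_sqrt_mult)
    also have "\<dots> \<le> 1 / 2"
      using x u(2) \<gamma> ln1 by (intro divide_right_mono) (simp_all add: \<gamma>_def)
    finally show ?thesis .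
  qed
  have form: "\<And>v. v \<in> carrier_vec n \<Longrightarrow> Re ((C *\<^sub>v v) \<bullet>c v) \<le> \<gamma> * norm_sq v"
    unfolding \<gamma>_def by (rule form_le_op_norm[OF Cc])
  define W where "W s l = Matrix.mat m m (\<lambda>(j, i). complex_of_real s * lag_weight m (grid m l) i j)" for s l
  have W: "W s l \<in> carrier_mat m m" for s l by (simp add: W_def)
  have lw: "cnj (lag_weight m \<theta> i j) = lag_weight m \<theta> j i" for \<theta> i j
    by (simp add: lag_weight_def exp_cnj abs_minus_commute[of "int i"] algebra_simps)
  have Wh: "mat_adjoint (W s l) = W s l" for s l
    by (rule eq_matI) (simp_all add: W_def lw)
  have Wf: "frob_sq (W s l) \<le> H" if "s \<in> {1, -1}" for s l
  proof -
    have "frob_sq (W s l) = (\<Sum>i<m. \<Sum>j<m. (cmod (lag_weight m (grid m l) i j))\<^sup>2)"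
      using that by (subst sum.swap) (auto simp: frob_sq_def W_def norm_mult)
    also have "\<dots> \<le> 2 * (1 + ln (real m))" using m by (intro lag_weight_frobenius) simp
    also have "\<dots> \<le> H" using ln1 by (simp add: H_def)
    finally show ?thesis .
  qed
  define X where "X w = sample_matrix C (Z w) (toeplitz m r)" for w
  define T where "T s l w = Re (\<Sum>i<m. \<Sum>j<m. (sample_cov (X w) $$ (i, j) - xi C * toeplitz m r $$ (i, j)) * W s l $$ (j, i))" for s l w
  have m1: "m \<ge> 1" using m by simp
  have \<gamma>0: "\<gamma> \<ge> 0" and u0: "u \<ge> 0" using \<gamma> u(2) by (auto simp: \<gamma>_def)
  have tail: "{w \<in> space M. T s l w \<ge> x} \<in> events" "prob {w \<in> space M. T s l w \<ge> x} \<le> exp (- t * x + 2 * t\<^sup>2 * F)"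
    if s: "s \<in> {1, -1}" for s l
    unfolding T_def X_def F_def
    by (rule weighted_cov_tail[OF n m1 C R Z form \<gamma>0 u(1) u0 W Wh Wf[OF s] t ts]; assumption)+
  let ?I = "{1, -1 :: real} \<times> {..<2 * m}"
  have "prob {w \<in> space M. op_norm (toeplitz_est (X w) - xi C \<cdot>\<^sub>m toeplitz m r) > x}
      \<le> prob (\<Union>(s, l)\<in>?I. {w \<in> space M. T s l w \<ge> x})"
  proof (rule finite_measure_mono)
    show "{w \<in> space M. op_norm (toeplitz_est (X w) - xi C \<cdot>\<^sub>m toeplitz m r) > x} \<subseteq> (\<Union>(s, l)\<in>?I. {w \<in> space M. T s l w \<ge> x})"
    proof (rule subsetI, rule ccontr)
      fix w assume w: "w \<in> {w \<in> space M. op_norm (toeplitz_est (X w) - xi C \<cdot>\<^sub>m toeplitz m r) > x}"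
        and neg: "w \<notin> (\<Union>(s, l)\<in>?I. {w \<in> space M. T s l w \<ge> x})"
      have Zw: "Z w \<in> carrier_mat n m" using Z w by (simp add: iid_complex_gaussian_matrix_def)
      have Xc: "X w \<in> carrier_mat n m" unfolding X_def by (rule dim_sample_matrix[OF C R Zw])
      have XX: "mat_adjoint (X w) * X w \<in> carrier_mat m m" using Xc by (auto intro: mult_carrier_mat)
      have S: "sample_cov (X w) \<in> carrier_mat m m" using XX by (simp add: sample_cov_def)
      have "mat_adjoint (mat_adjoint (X w) * X w) = mat_adjoint (X w) * X w"
        using mat_adjoint_mult[OF mat_adjoint_carrier[OF Xc] Xc] by simp
      note XXh = hermitian_entry[OF XX this]
      have Sh: "mat_adjoint (sample_cov (X w)) = sample_cov (X w)"
      proof (rule eq_matI)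
        fix i j assume "i < dim_row (sample_cov (X w))" "j < dim_col (sample_cov (X w))"
        then have "i < m" "j < m" using S by simp_all
        then show "mat_adjoint (sample_cov (X w)) $$ (i, j) = sample_cov (X w) $$ (i, j)"
          using Xc XXh[of i j] by (simp add: sample_cov_def del: index_mult_mat(1))
      qed (use S in simp_all)
      have small: "cmod (\<Sum>i<m. \<Sum>j<m. (sample_cov (X w) $$ (i, j) - xi C * toeplitz m r $$ (i, j)) * lag_weight m (grid m l) i j) \<le> x"
        (is "cmod ?c \<le> x") if l: "l < 2 * m" for l
      proof -
        have T: "T s l w = s * Re ?c" if "s \<in> {1, -1}" for s
          unfolding T_def W_def by (auto simp: sum_distrib_left mult_ac intro!: sum.cong)
        have "T 1 l w < x" "T (-1) l w < x" using neg w l by force+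
        then have "\<bar>Re ?c\<bar> < x" using T[of 1] T[of "-1"] by simp
        moreover have "Im ?c = 0"
        proof -
          have "?c = trace_mat (sample_cov (X w) * W 1 l) - xi C * trace_mat (toeplitz m r * W 1 l)"
            unfolding trace_mult_eq_sum[OF S W] trace_mult_eq_sum[OF toeplitz_carrier W] sum_distrib_left sum_subtractf[symmetric]
            by (intro sum.cong refl) (simp add: W_def algebra_simps)
          moreover have "Im (xi C) = 0"
            using trace_mat_adjoint[OF Cc] C by (simp add: xi_def psd_hermitian_def complex_eq_iff)
          moreover have "Im (trace_mat (sample_cov (X w) * W 1 l)) = 0"
            by (rule trace_hermitian_mult_real[OF S Sh W Wh])
          moreover have "Im (trace_mat (toeplitz m r * W 1 l)) = 0"
            using R by (intro trace_hermitian_mult_real[OF _ _ W Wh]) (auto simp: psd_hermitian_def)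
          ultimately show ?thesis by simp
        qed
        ultimately show ?thesis by (simp add: cmod_eq_Re)
      qed
      have "op_norm (toeplitz_est (X w) - xi C \<cdot>\<^sub>m toeplitz m r) \<le> x"
        using op_norm_toeplitz_est_le[OF m1 S small] Xc by (simp add: toeplitz_est_def)
      then show False using w by simp
    qed
    show "(\<Union>(s, l)\<in>?I. {w \<in> space M. T s l w \<ge> x}) \<in> events"
      using tail(1) by (intro sets.finite_UN) auto
  qed
  also have "\<dots> \<le> (\<Sum>(s, l)\<in>?I. prob {w \<in> space M. T s l w \<ge> x})"
    using tail(1) by (intro order_trans[OF finite_measure_subadditive_finite]) (auto simp: case_prod_beta)
  also have "\<dots> \<le> (\<Sum>(s, l)\<in>?I. exp (- t * x + 2 * t\<^sup>2 * F))"
    unfolding case_prod_beta by (intro sum_mono tail(2)) auto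
  also have "\<dots> = 4 * real m * exp (- t * x + 2 * t\<^sup>2 * F)"
    by (simp add: case_prod_beta card_cartesian_product)
  also have "- t * x + 2 * t\<^sup>2 * F = - (real n * x\<^sup>2 / (32 * \<gamma>\<^sup>2 * u\<^sup>2 * ln (real m)))"
  proof -
    have "- t * x + 2 * t\<^sup>2 * F = - (x\<^sup>2 / (8 * F))"
      using F by (simp add: t_def power2_eq_square field_simps)
    also have "8 * F = 32 * \<gamma>\<^sup>2 * u\<^sup>2 * ln (real m) / real n" by (simp add: F_def H_def)
    finally show ?thesis by (simp add: mult.commute)
  qed
  finally show ?thesis by (simp add: X_def \<gamma>_def)
qed

theorem proposition2p1:
  fixes P :: "nat \<Rightarrow> 'w measure"
    and Z :: "nat \<Rightarrow> 'w \<Rightarrow> complex mat"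
    and C :: "nat \<Rightarrow> complex mat"
    and M N :: "nat \<Rightarrow> nat"
    and f L :: "real \<Rightarrow> real"
    and a c :: real
  assumes C_psd: "\<And>n. n \<ge> 1 \<Longrightarrow> psd_hermitian n (C n)"
    and C_bounded: "\<exists>B. \<forall>n\<ge>1. op_norm (C n) \<le> B"
    and C_nondegenerate: "\<exists>b>0. \<forall>\<^sub>F n in sequentially. b \<le> op_norm (C n)"
    and f_L1: "set_integrable lebesgue {-pi..pi} f"
    and f_pos: "\<And>x. x \<in> {-pi..pi} - {0} \<Longrightarrow> 0 < f x"
    and f_bounded: "\<And>\<delta>. \<delta> > 0 \<Longrightarrow> bounded (f ` ({-pi..pi} - {-\<delta><..<\<delta>}))"
    and f_even: "\<And>x. x \<in> {-pi..pi} \<Longrightarrow> f (- x) = f x"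
    and f_form: "\<And>x. x \<in> {-pi..pi} - {0} \<Longrightarrow> f x = L (1 / \<bar>x\<bar>) / \<bar>x\<bar> powr a"
    and a: "0 < a" "a < 1 / 2"
    and L_sv: "slowly_varying (1 / pi) L"
    and dims: "\<And>k. M k \<ge> 1" "\<And>k. N k \<ge> 1"
    and M_lim: "filterlim M at_top sequentially"
    and N_lim: "filterlim N at_top sequentially"
    and ratio_lim: "(\<lambda>k. real (N k) / real (M k)) \<longlonglongrightarrow> c"
    and c: "0 < c"
    and prob: "\<And>k. prob_space (P k)"
    and Z_gauss: "\<And>k. iid_complex_gaussian_matrix (P k) (N k) (M k) (Z k)"
  shows "\<exists>K>0. \<forall>x>0. \<exists>\<epsilon> :: nat \<Rightarrow> real. \<epsilon> \<longlonglongrightarrow> 0 \<and>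
    (\<forall>\<^sub>F k in sequentially.
      measure (P k) {w \<in> space (P k).
          op_norm (toeplitz_est
              (sample_matrix (C (N k)) (Z k w) (toeplitz (M k) (fourier_coeff f)))
            - xi (C (N k)) \<cdot>\<^sub>m toeplitz (M k) (fourier_coeff f)) > x}
      \<le> exp (- (K * c * real (M k) powr (1 - 2 * a) * x\<^sup>2
                 / ((op_norm (C (N k)))\<^sup>2 * (L (real (M k)))\<^sup>2 * ln (real (M k)))
                 * (1 + \<epsilon> k))))"
proof -
  have pi_inv: "1 / pi > 0" by simp
  obtain B where B: "\<And>n. n \<ge> 1 \<Longrightarrow> op_norm (C n) \<le> B" using C_bounded by blast
  obtain b where b: "b > 0" "\<forall>\<^sub>F n in sequentially. b \<le> op_norm (C n)" using C_nondegenerate by blast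
  obtain D where D: "D > 0" "\<forall>\<^sub>F m in sequentially. \<forall>v\<in>carrier_vec m.
    Re ((toeplitz m (fourier_coeff f) *\<^sub>v v) \<bullet>c v) \<le> D * (real m powr a * L (real m)) * norm_sq v"
    using toeplitz_power_law_form_le[OF f_L1 f_bounded f_form a L_sv] by blast
  \<comment> \<open>Then \<open>L(m)\<^sup>2\<close> costs \<open>m\<^sup>(\<^sup>1\<^sup>-\<^sup>2\<^sup>a\<^sup>)\<^sup>/\<^sup>2\<close> at most, half of the available power.\<close>
  define \<eta> where "\<eta> = (1 - 2 * a) / 4"
  have \<eta>: "\<eta> > 0" using a by (simp add: \<eta>_def)
  obtain A T where A: "A > 0" "T \<ge> 1 / pi" "\<And>t. t \<ge> T \<Longrightarrow> L t \<le> A * t powr \<eta>"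
    using slowly_varying_power_bounds[OF L_sv pi_inv \<eta>] by metis
  \<comment> \<open>Here \<open>128 = 32 * 2 * 2\<close>: the constant of the deviation bound, the replacement of \<open>n\<close> by
    \<open>c m / 2\<close>, and the half of the exponent that absorbs the factor \<open>4 m\<close>.\<close>
  define K where "K = 1 / (128 * D\<^sup>2)"
  have K: "K > 0" using D(1) by (simp add: K_def)
  define E where "E x k = K * c * real (M k) powr (1 - 2 * a) * x\<^sup>2
    / ((op_norm (C (N k)))\<^sup>2 * (L (real (M k)))\<^sup>2 * ln (real (M k)))" for x k
  have RM: "filterlim (\<lambda>k. real (M k)) at_top sequentially"
    by (rule filterlim_compose[OF filterlim_real_sequentially M_lim])
  have main: "\<forall>\<^sub>F k in sequentially. measure (P k) {w \<in> space (P k).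
          op_norm (toeplitz_est
              (sample_matrix (C (N k)) (Z k w) (toeplitz (M k) (fourier_coeff f)))
            - xi (C (N k)) \<cdot>\<^sub>m toeplitz (M k) (fourier_coeff f)) > x}
      \<le> exp (- E x k)" if x: "x > 0" for x
  proof -
    have "\<forall>\<^sub>F k in sequentially. b \<le> op_norm (C (N k))"
      using b(2) N_lim by (rule eventually_compose_filterlim)
    moreover have "\<forall>\<^sub>F k in sequentially. \<forall>v\<in>carrier_vec (M k). Re ((toeplitz (M k) (fourier_coeff f) *\<^sub>v v) \<bullet>c v)
        \<le> D * (real (M k) powr a * L (real (M k))) * norm_sq v"
      using D(2) M_lim by (rule eventually_compose_filterlim)
    moreover have "\<forall>\<^sub>F k in sequentially. max 3 T \<le> real (M k)"
      using RM by (simp only: filterlim_at_top)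
    moreover have "\<forall>\<^sub>F k in sequentially. c / 2 < real (N k) / real (M k)"
      using order_tendstoD(1)[OF ratio_lim, of "c / 2"] c by simp
    moreover have "\<forall>\<^sub>F k in sequentially. x / (4 * b * D) \<le> real (M k) powr a * L (real (M k))"
      using filterlim_compose[OF power_times_slowly_varying_at_top[OF L_sv pi_inv a(1)] RM]
      by (simp add: filterlim_at_top)
    moreover have "\<forall>\<^sub>F k in sequentially. ln (real (M k)) * ln (4 * real (M k)) / real (M k) powr ((1 - 2 * a) / 2)
        < K * c * x\<^sup>2 / (B\<^sup>2 * A\<^sup>2 + 1)"
    proof (rule order_tendstoD(2)[OF filterlim_compose[OF _ RM]])
      have "(1 - 2 * a) / 2 > 0" using a by simp
      then show "((\<lambda>t. ln t * ln (4 * t) / t powr ((1 - 2 * a) / 2)) \<longlongrightarrow> 0) at_top"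
        by real_asymp
      show "0 < K * c * x\<^sup>2 / (B\<^sup>2 * A\<^sup>2 + 1)" using K c x by (intro divide_pos_pos mult_pos_pos add_nonneg_pos) auto
    qed
    ultimately show ?thesis
    proof eventually_elim
      case (elim k)
      define m n \<gamma> where "m = real (M k)" and "n = real (N k)" and "\<gamma> = op_norm (C (N k))"
      note elim' = elim[folded m_def n_def \<gamma>_def]
      define u where "u = D * (m powr a * L m)"
      interpret prob_space "P k" by (rule prob)
      have m: "m \<ge> 3" "m \<ge> T" using elim'(3) by auto
      have \<gamma>: "\<gamma> > 0" "\<gamma> \<le> B" using elim'(1) b(1) B[OF dims(2)[of k]] by (auto simp: \<gamma>_def)
      have "exp 1 \<le> m" using exp_le m by linarith
      then have ln1: "1 \<le> ln m" using m by (subst ln_ge_iff) auto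
      have Lm: "L m > 0" "L m \<le> A * m powr \<eta>" using m A L_sv by (auto simp: slowly_varying_def)
      have u: "u > 0" using D(1) Lm m by (simp add: u_def)
      have R: "psd_hermitian (M k) (toeplitz (M k) (fourier_coeff f))"
        by (rule toeplitz_fourier_psd[OF f_L1 f_pos])
      have "x \<le> 4 * b * u"
        using elim'(5) b(1) D(1) by (simp add: u_def field_simps)
      also have "\<dots> \<le> 4 * \<gamma> * u * 1" using elim'(1) u by simp
      also have "\<dots> \<le> 4 * \<gamma> * u * sqrt (ln m)"
        using \<gamma> u ln1 by (intro mult_left_mono) auto
      finally have xu: "x \<le> 4 * \<gamma> * u * sqrt (ln m)" .
      have "measure (P k) {w \<in> space (P k).
          op_norm (toeplitz_est
              (sample_matrix (C (N k)) (Z k w) (toeplitz (M k) (fourier_coeff f)))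
            - xi (C (N k)) \<cdot>\<^sub>m toeplitz (M k) (fourier_coeff f)) > x}
        \<le> 4 * m * exp (- (n * x\<^sup>2 / (32 * \<gamma>\<^sup>2 * u\<^sup>2 * ln m)))"
        unfolding m_def n_def \<gamma>_def
      proof (rule toeplitz_est_deviation[OF dims(2) _ C_psd[OF dims(2)] R Z_gauss _ u])
        show "3 \<le> M k" using m(1) by (simp add: m_def)
        show "Re ((toeplitz (M k) (fourier_coeff f) *\<^sub>v v) \<bullet>c v) \<le> u * norm_sq v" if "v \<in> carrier_vec (M k)" for v
          using elim'(2) that by (simp add: u_def m_def)
      qed (use x xu \<gamma> in \<open>simp_all add: m_def \<gamma>_def\<close>)
      also have "\<dots> \<le> exp (E x k) * exp (- (2 * E x k))"
      proof (intro mult_mono)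
        have mm: "m powr (1 - 2 * a) * m powr (2 * a) = m" using m by (simp flip: powr_add)
        have "2 * E x k = c / 2 * m * x\<^sup>2 / (32 * \<gamma>\<^sup>2 * u\<^sup>2 * ln m)"
        proof -
          have "u\<^sup>2 = D\<^sup>2 * (m powr (2 * a) * (L m)\<^sup>2)"
            by (simp add: u_def power_mult_distrib flip: powr_add powr_power) (simp add: power2_eq_square flip: powr_add)
          then show ?thesis
            using mm D(1) Lm \<gamma> ln1 m unfolding E_def K_def m_def[symmetric] \<gamma>_def[symmetric]
            by (simp add: field_simps)
        qed
        also have "\<dots> \<le> n * x\<^sup>2 / (32 * \<gamma>\<^sup>2 * u\<^sup>2 * ln m)"
          using elim'(4) m ln1 by (intro divide_right_mono mult_right_mono) (auto simp: field_simps)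
        finally show "exp (- (n * x\<^sup>2 / (32 * \<gamma>\<^sup>2 * u\<^sup>2 * ln m))) \<le> exp (- (2 * E x k))" by simp
        have "ln m * ln (4 * m) \<le> K * c * x\<^sup>2 / (B\<^sup>2 * A\<^sup>2 + 1) * m powr ((1 - 2 * a) / 2)"
          using elim'(6) m by (simp add: pos_divide_less_eq)
        also have "\<dots> \<le> K * c * x\<^sup>2 / (B\<^sup>2 * A\<^sup>2) * m powr ((1 - 2 * a) / 2)"
        proof -
          have "0 < B\<^sup>2 * A\<^sup>2" using \<gamma> A(1) by simp
          then show ?thesis using K c by (intro mult_right_mono divide_left_mono mult_pos_pos) auto
        qed
        also have "\<dots> = K * c * m powr (1 - 2 * a) * x\<^sup>2 / (B\<^sup>2 * (A * m powr \<eta>)\<^sup>2)"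
        proof -
          have "m powr (1 - 2 * a) = m powr ((1 - 2 * a) / 2) * (m powr \<eta> * m powr \<eta>)"
          proof -
            have "(1 - 2 * a) / 2 + (\<eta> + \<eta>) = 1 - 2 * a" by (simp add: \<eta>_def)
            then show ?thesis by (simp only: powr_add[symmetric])
          qed
          moreover have "m powr \<eta> > 0" using m by simp
          ultimately show ?thesis using \<gamma> A(1) by (simp add: power2_eq_square field_simps)
        qed
        also have "\<dots> \<le> K * c * m powr (1 - 2 * a) * x\<^sup>2 / (\<gamma>\<^sup>2 * (L m)\<^sup>2)"
          using K c \<gamma> Lm m A(1) by (intro divide_left_mono mult_mono power_mono mult_pos_pos) auto
        also have "\<dots> = E x k * ln m"
          using ln1 unfolding E_def m_def[symmetric] \<gamma>_def[symmetric] by simp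
        finally have "ln (4 * m) \<le> E x k" using ln1 by (simp add: mult.commute)
        then have "exp (ln (4 * m)) \<le> exp (E x k)" by (simp only: exp_le_cancel_iff)
        then show "4 * m \<le> exp (E x k)" using m by simp
      qed auto
      also have "\<dots> = exp (- E x k)" by (simp flip: exp_add)
      finally show ?case .
    qed
  qed
  show ?thesis
    using K main unfolding E_def by (intro exI[of _ K] conjI allI impI exI[of _ "\<lambda>_. 0"]) auto
qed

end
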